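(* Fix $\lambda\in(0,\frac13)$. Let $(\Gamma,h)$ be a connected metric graph of first Betti number $b\geq 2$ such that $$\operatorname{length}(\Gamma,h)\leq\lambda\operatorname{length}(\Gamma_b,h_b).$$ Then there exists a vertex $\tilde{u}$ in $\widetilde{\Gamma}$ such that for any $R\geq 0$, $$\operatorname{length} B_{\widetilde{h}}(\tilde{u},R)\geq(1-3\lambda)V'_{(\widetilde{\Gamma}_b,\widetilde{h}_b)}(R).$$ In particular, for any $R\ge 0$, $$V'_{(\widetilde{\Gamma},\widetilde{h})}(R)\geq(1-3\lambda)V'_{(\widetilde{\Gamma}_b,\widetilde{h}_b)}(R).$$
   Context: A graph is a finite one-dimensional CW-complex (multiple edges and loops allowed). A metric graph $(\Gamma,h)$ is a graph endowed with a metric $h$ such that $(\Gamma,h)$ is a length space; the length of a subset is its one-dimensional Hausdorff measure. $(\widetilde{\Gamma},\widetilde{h})$ is the universal cover of $(\Gamma,h)$ with the lifted length metric, $B_{\widetilde{h}}(\tilde{v},R)$ is the ball of radius $R$ centered at the point $\tilde v$ of $\widetilde\Gamma$, and $$V'_{(\widetilde{\Gamma},\widetilde{h})}(R):=\sup_{\tilde{v}\in\widetilde{\Gamma}}\operatorname{length}(B_{\widetilde{h}}(\tilde{v},R)),$$ the supremum being over all points of $\widetilde\Gamma$. For an integer $b\geq2$, $\Gamma_b$ denotes a connected trivalent graph (every vertex has degree $3$, loops counted twice) of first Betti number $b$, and $h_b$ is the metric on it for which all edges have length $1$. One has $\operatorname{length}(\Gamma_b,h_b)=3b-3$, and $(\widetilde{\Gamma}_b,\widetilde{h}_b)$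 is isometric to the infinite trivalent tree with unit edges, so $V'_{(\widetilde{\Gamma}_b,\widetilde{h}_b)}$ does not depend on $b$ or on the choice of $\Gamma_b$. *)

theory Defs
  imports "HOL-Analysis.Analysis" "HOL-Analysis.Finite_Function_Topology"
begin

section \<open>One-dimensional Hausdorff measure\<close>

text \<open>Boundedness of the covering sets is required because the library's \<open>diameter\<close> is
  unspecified on unbounded sets. The infimum over no cover at all is \<open>\<infinity>\<close>. In dimension one the
  normalising constant is \<open>1\<close>, so that an interval of the real line has its usual length.\<close>

definition hausdorff1_content :: "real \<Rightarrow> 'a::metric_space set \<Rightarrow> ennreal" where
  "hausdorff1_content \<delta> S =
     (INF U\<in>{U :: nat \<Rightarrow> 'a set. S \<subseteq> (\<Union>i. U i) \<and> (\<forall>i. bounded (U i) \<and> diameter (U i) \<le> \<delta>)}.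
        suminf (\<lambda>i. ennreal (diameter (U i))))"

definition hausdorff1 :: "'a::metric_space set \<Rightarrow> ennreal" where
  "hausdorff1 S = (SUP \<delta>\<in>{0<..}. hausdorff1_content \<delta> S)"


section \<open>Length spaces\<close>

definition curve_length :: "(real \<Rightarrow> 'a::metric_space) \<Rightarrow> ennreal" where
  "curve_length g =
     (SUP (n, t)\<in>{(n :: nat, t :: nat \<Rightarrow> real). mono t \<and> range t \<subseteq> {0..1}}.
        \<Sum>i<n. ennreal (dist (g (t i)) (g (t (Suc i)))))"

definition length_space :: "'a::metric_space set \<Rightarrow> bool" where
  "length_space X \<longleftrightarrow>
     (\<forall>x\<in>X. \<forall>y\<in>X. ennreal (dist x y) =
        (INF g\<in>{g. path g \<and> path_image g \<subseteq> X \<and> pathstart g = x \<and> pathfinish g = y}.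
           curve_length g))"


section \<open>Metric graphs\<close>

text \<open>\<open>V\<close> is the set of 0-cells of \<open>X\<close>, \<open>E\<close> indexes the 1-cells, and
  \<open>\<phi> e :: real \<Rightarrow> 'a\<close>, restricted to the unit interval, is the characteristic map of the cell \<open>e\<close>.
  For finitely many cells in a Hausdorff space the remaining CW axioms (that \<open>\<phi> e\<close> is a
  homeomorphism from the open interval onto the open cell, and that \<open>X\<close> carries the weak
  topology) follow by compactness. Loops and multiple edges are allowed.\<close>

definition cw_graph :: "'a::metric_space set \<Rightarrow> 'a set \<Rightarrow> 'e set \<Rightarrow> ('e \<Rightarrow> real \<Rightarrow> 'a) \<Rightarrow> bool" where
  "cw_graph X V E \<phi> \<longleftrightarrow>
     finite V \<and> finite E \<and>
     (\<forall>e\<in>E. path (\<phi> e) \<and> pathstart (\<phi> e) \<in> V \<and> pathfinish (\<phi> e) \<in> V \<and>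
            inj_on (\<phi> e) {0<..<1} \<and> \<phi> e ` {0<..<1} \<inter> V = {}) \<and>
     disjoint_family_on (\<lambda>e. \<phi> e ` {0<..<1}) E \<and>
     X = V \<union> (\<Union>e\<in>E. path_image (\<phi> e))"

definition metric_graph ::
    "'a::metric_space set \<Rightarrow> 'a set \<Rightarrow> 'e set \<Rightarrow> ('e \<Rightarrow> real \<Rightarrow> 'a) \<Rightarrow> bool" where
  "metric_graph X V E \<phi> \<longleftrightarrow> cw_graph X V E \<phi> \<and> length_space X"

definition vertex_degree :: "'e set \<Rightarrow> ('e \<Rightarrow> real \<Rightarrow> 'a::metric_space) \<Rightarrow> 'a \<Rightarrow> nat" where
  "vertex_degree E \<phi> v = card {e\<in>E. pathstart (\<phi> e) = v} + card {e\<in>E. pathfinish (\<phi> e) = v}"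

definition trivalent :: "'a set \<Rightarrow> 'e set \<Rightarrow> ('e \<Rightarrow> real \<Rightarrow> 'a::metric_space) \<Rightarrow> bool" where
  "trivalent V E \<phi> \<longleftrightarrow> (\<forall>v\<in>V. vertex_degree E \<phi> v = 3)"

definition unit_edges :: "'e set \<Rightarrow> ('e \<Rightarrow> real \<Rightarrow> 'a::metric_space) \<Rightarrow> bool" where
  "unit_edges E \<phi> \<longleftrightarrow> (\<forall>e\<in>E. hausdorff1 (path_image (\<phi> e)) = 1)"

text \<open>Cellular homology with real coefficients: the 1-chains are the finitely supported functions
  on \<open>E\<close>, and since there are no 2-cells the first homology is the space of 1-cycles.\<close>

definition cellular_boundary :: "('e \<Rightarrow> real \<Rightarrow> 'a::metric_space) \<Rightarrow> ('e \<Rightarrow>\<^sub>0 real) \<Rightarrow> ('a \<Rightarrow>\<^sub>0 real)" where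
  "cellular_boundary \<phi> c =
     (\<Sum>e\<in>Poly_Mapping.keys c. Poly_Mapping.lookup c e *\<^sub>R
        (Poly_Mapping.single (pathfinish (\<phi> e)) 1 - Poly_Mapping.single (pathstart (\<phi> e)) 1))"

definition first_betti :: "'e set \<Rightarrow> ('e \<Rightarrow> real \<Rightarrow> 'a::metric_space) \<Rightarrow> nat" where
  "first_betti E \<phi> = dim {c. Poly_Mapping.keys c \<subseteq> E \<and> cellular_boundary \<phi> c = 0}"


section \<open>Universal covers and balls\<close>

text \<open>The second condition says that the metric of \<open>Y\<close> is the lifted length metric: the length of
  a path in \<open>Y\<close> is the length of its projection to \<open>X\<close>. Path-connectedness of \<open>Y\<close> is part of the
  library's \<open>simply_connected\<close>.\<close>

definition metric_universal_cover ::
    "'b::metric_space set \<Rightarrow> ('b \<Rightarrow> 'a::metric_space) \<Rightarrow> 'a set \<Rightarrow> bool" where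
  "metric_universal_cover Y p X \<longleftrightarrow>
     covering_space Y p X \<and> simply_connected Y \<and>
     (\<forall>x\<in>Y. \<forall>y\<in>Y. ennreal (dist x y) =
        (INF g\<in>{g. path g \<and> path_image g \<subseteq> Y \<and> pathstart g = x \<and> pathfinish g = y}.
           curve_length (p \<circ> g)))"

definition ball_length :: "'b::metric_space set \<Rightarrow> 'b \<Rightarrow> real \<Rightarrow> ennreal" where
  "ball_length Y v R = hausdorff1 (Y \<inter> ball v R)"

definition sup_ball_length :: "'b::metric_space set \<Rightarrow> real \<Rightarrow> ennreal" where
  "sup_ball_length Y R = (SUP v\<in>Y. ball_length Y v R)"

end

theory Submission
  imports Defs "HOL-Complex_Analysis.Winding_Numbers"
begin

text \<open>
  The proof establishes more than the factor \<open>1 - 3\<lambda>\<close>: some vertex \<open>u\<close> of the universal cover of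
  \<open>\<Gamma>\<close> satisfies \<open>length B(u, R) \<ge> 3 L(R)\<close> for all \<open>R \<ge> 0\<close>, where \<open>3 L(R)\<close> is the length of the ball of
  radius \<open>R\<close> around a vertex of the trivalent tree and \<open>L(R)\<close> the share of one of the three directions
  (\<open>binary_length\<close>), while no ball of radius \<open>R\<close> in the trivalent tree is longer than \<open>3 L(R)\<close>.

  The combinatorial core is \<open>branching_subgraph\<close>. By Euler's formula \<open>b - 1\<close> is the number of edges
  minus the number of vertices, and the trivalent graph has \<open>3b - 3\<close> edges, so that the hypothesis
  gives \<open>\<Gamma>\<close> a length of at most \<open>3\<lambda>(b - 1) < b - 1\<close>. Hence the number of edges minus the number
  of vertices minus the length is positive for \<open>\<Gamma>\<close>, and all the more for a subgraph that maximises it.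
  From such a subgraph nothing can be removed with profit: there are no vertices of degree \<open>0\<close> or
  \<open>1\<close>; a chain of \<open>k\<close> edges through \<open>k - 1\<close> vertices of degree \<open>2\<close> has length at most \<open>1\<close>, because its
  removal changes the quantity by its length minus \<open>1\<close>; and some vertex has degree at least \<open>3\<close>. For a walk
  without backtracking that starts at such a vertex, the next vertex of this kind therefore always comes
  within length \<open>1\<close>, and the walks branch at least as often as in the trivalent tree.

  This has to be turned into lengths of balls in a simply connected metric space \<open>Y\<close> that covers the graph.
  The edges of the graph lift to open cells of \<open>Y\<close>, and the tree structure of \<open>Y\<close> rests on a single
  topological fact, \<open>open_cell_bridge\<close>: the ends of an open cell are not connected outside the cell,
  because a winding number would otherwise detect a loop that is not contractible. Consequently cells are
  geodesics (\<open>arc_cell_dist\<close>), different cells at a point start disjoint branches of \<open>Y\<close>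
  (\<open>branch_disjoint\<close>), and the distance into a branch is measured through the point where the branch is
  attached (\<open>dist_into_branch\<close>). The growth of balls follows by recursion along the branches. From below
  (\<open>branch_growth_ge\<close>) it suffices to find disjoint pieces of sufficient length, from above
  (\<open>branch_growth_le\<close>) to cover a ball by finitely many pieces.

  The Hausdorff measure enters only through subadditivity, its behaviour under \<open>1\<close>-Lipschitz maps, the
  fact that an open arc has its length as measure (\<open>hausdorff1_open_arc\<close>), and superadditivity on
  disjoint sets of the inner measure that compact subsets define.
\<close>

section \<open>One-dimensional Hausdorff measure\<close>

lemma diameter_leI:
  fixes S :: "'a::metric_space set"
  assumes "0 \<le> d" and "\<And>x y. x \<in> S \<Longrightarrow> y \<in> S \<Longrightarrow> dist x y \<le> d"
  shows "diameter S \<le> d"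
  using assms by (auto simp: diameter_def intro: cSUP_least)

abbreviation cover_sum :: "(nat \<Rightarrow> 'a::metric_space set) \<Rightarrow> ennreal" where
  "cover_sum U \<equiv> suminf (\<lambda>i. ennreal (diameter (U i)))"

lemma hausdorff1_content_le:
  assumes "S \<subseteq> (\<Union>i. U i)" and "\<And>i. bounded (U i)" and "\<And>i. diameter (U i) \<le> \<delta>"
  shows "hausdorff1_content \<delta> S \<le> cover_sum U"
  unfolding hausdorff1_content_def by (rule INF_lower) (use assms in auto)

lemma hausdorff1_content_greatest:
  assumes "\<And>U. \<lbrakk>S \<subseteq> (\<Union>i. U i); \<And>i. bounded (U i); \<And>i. diameter (U i) \<le> \<delta>\<rbrakk>
             \<Longrightarrow> c \<le> cover_sum U"
  shows "c \<le> hausdorff1_content \<delta> S"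
  unfolding hausdorff1_content_def by (rule INF_greatest) (use assms in auto)

lemma hausdorff1_content_antimono:
  assumes "\<delta> \<le> \<delta>'"
  shows "hausdorff1_content \<delta>' S \<le> hausdorff1_content \<delta> S"
  by (intro hausdorff1_content_greatest hausdorff1_content_le) (assumption | rule order_trans[OF _ assms])+

lemma hausdorff1_content_le_hausdorff1:
  "0 < \<delta> \<Longrightarrow> hausdorff1_content \<delta> S \<le> hausdorff1 S"
  unfolding hausdorff1_def by (rule SUP_upper) auto

lemma hausdorff1_leI:
  assumes "\<And>\<delta>. 0 < \<delta> \<Longrightarrow> hausdorff1_content \<delta> S \<le> c"
  shows "hausdorff1 S \<le> c"
  unfolding hausdorff1_def by (rule SUP_least) (use assms in auto)

lemma hausdorff1_lipschitz_image:
  assumes lip: "\<And>x y. x \<in> S \<Longrightarrow> y \<in> S \<Longrightarrow> dist (f x) (f y) \<le> dist x y"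
  shows "hausdorff1 (f ` S) \<le> hausdorff1 S"
proof (rule hausdorff1_leI)
  fix \<delta> :: real assume "0 < \<delta>"
  have "hausdorff1_content \<delta> (f ` S) \<le> hausdorff1_content \<delta> S"
  proof (rule hausdorff1_content_greatest)
    fix U :: "nat \<Rightarrow> 'a set"
    assume U: "S \<subseteq> (\<Union>i. U i)" "\<And>i. bounded (U i)" "\<And>i. diameter (U i) \<le> \<delta>"
    have d: "dist x y \<le> diameter (U i)" if "x \<in> f ` (U i \<inter> S)" "y \<in> f ` (U i \<inter> S)" for x y i
    proof -
      obtain x' y' where *: "x' \<in> U i \<inter> S" "x = f x'" "y' \<in> U i \<inter> S" "y = f y'"
        using \<open>x \<in> f ` (U i \<inter> S)\<close> \<open>y \<in> f ` (U i \<inter> S)\<close> by blast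
      then show ?thesis
        using lip[of x' y'] diameter_bounded_bound[OF U(2), of x' i y'] by simp
    qed
    have diam: "diameter (f ` (U i \<inter> S)) \<le> diameter (U i)" for i
      by (intro diameter_leI diameter_ge_0 U d)
    have "hausdorff1_content \<delta> (f ` S) \<le> (suminf (\<lambda>i::nat. ennreal (diameter (f ` (U i \<inter> S)))))"
    proof (rule hausdorff1_content_le)
      have "S = (\<Union>i. U i \<inter> S)" using U(1) by auto
      then show "f ` S \<subseteq> (\<Union>i. f ` (U i \<inter> S))" by (metis image_UN order_refl)
      show "bounded (f ` (U i \<inter> S))" for i
        unfolding bounded_two_points by (intro exI[of _ "diameter (U i)"] ballI d)
      show "diameter (f ` (U i \<inter> S)) \<le> \<delta>" for i by (rule order_trans[OF diam U(3)])
    qed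
    also have "\<dots> \<le> cover_sum U"
      by (intro suminf_le ennreal_leI diam) auto
    finally show "hausdorff1_content \<delta> (f ` S) \<le> cover_sum U" .
  qed
  also have "\<dots> \<le> hausdorff1 S" by (rule hausdorff1_content_le_hausdorff1) fact
  finally show "hausdorff1_content \<delta> (f ` S) \<le> hausdorff1 S" .
qed

lemma hausdorff1_mono:
  assumes "S \<subseteq> T"
  shows "hausdorff1 S \<le> hausdorff1 T"
  unfolding hausdorff1_def hausdorff1_content_def
  by (intro SUP_mono bexI INF_superset_mono) (use assms in auto)

lemma hausdorff1_content_Un:
  "hausdorff1_content \<delta> (S \<union> T) \<le> hausdorff1_content \<delta> S + hausdorff1_content \<delta> T"
proof -
  have *: "hausdorff1_content \<delta> (S \<union> T)
        \<le> cover_sum U + cover_sum W"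
    if U: "S \<subseteq> (\<Union>i. U i)" "\<And>i. bounded (U i)" "\<And>i. diameter (U i) \<le> \<delta>"
    and W: "T \<subseteq> (\<Union>i. W i)" "\<And>i. bounded (W i)" "\<And>i. diameter (W i) \<le> \<delta>"
    for U W :: "nat \<Rightarrow> 'a set"
  proof -
    define Z where "Z i = (if even i then U (i div 2) else W (i div 2))" for i
    have "hausdorff1_content \<delta> (S \<union> T) \<le> cover_sum Z"
    proof (rule hausdorff1_content_le)
      have "U i \<subseteq> (\<Union>i. Z i)" "W i \<subseteq> (\<Union>i. Z i)" for i
        using UN_upper[of "2 * i" UNIV Z] UN_upper[of "2 * i + 1" UNIV Z] by (simp_all add: Z_def)
      then have "(\<Union>i. U i) \<subseteq> (\<Union>i. Z i)" "(\<Union>i. W i) \<subseteq> (\<Union>i. Z i)"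
        by (simp_all add: UN_least)
      then show "S \<union> T \<subseteq> (\<Union>i. Z i)" using order_trans[OF U(1)] order_trans[OF W(1)] by simp
    qed (use U W in \<open>auto simp: Z_def\<close>)
    also have "\<dots> \<le> cover_sum U + cover_sum W"
    proof (rule suminf_le_const)
      fix n
      have "(\<Sum>i<2 * n. ennreal (diameter (Z i)))
          = (\<Sum>i<n. ennreal (diameter (U i))) + (\<Sum>i<n. ennreal (diameter (W i)))"
        by (induction n) (auto simp: Z_def algebra_simps)
      moreover have "(\<Sum>i<n. ennreal (diameter (Z i))) \<le> (\<Sum>i<2 * n. ennreal (diameter (Z i)))"
        by (rule sum_mono2) auto
      ultimately show "(\<Sum>i<n. ennreal (diameter (Z i)))
          \<le> cover_sum U + cover_sum W"
        using add_mono[OF sum_le_suminf[of "\<lambda>i. ennreal (diameter (U i))" "{..<n}"]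
            sum_le_suminf[of "\<lambda>i. ennreal (diameter (W i))" "{..<n}"]]
        by (auto intro: order_trans)
    qed auto
    finally show ?thesis .
  qed
  show ?thesis
  proof (rule ennreal_le_epsilon)
    fix e :: real
    assume fin: "hausdorff1_content \<delta> S + hausdorff1_content \<delta> T < top" and e: "0 < e"
    have lt: "x < x + ennreal (e/2)" if "x < top" for x :: ennreal
      using that e by (cases x) (auto simp: ennreal_plus[symmetric] ennreal_less_iff simp del: ennreal_plus)
    have "hausdorff1_content \<delta> S < hausdorff1_content \<delta> S + ennreal (e/2)"
      using fin by (intro lt) (auto simp: less_top)
    then obtain U :: "nat \<Rightarrow> 'a set" where U: "S \<subseteq> (\<Union>i. U i)" "\<And>i. bounded (U i)" "\<And>i. diameter (U i) \<le> \<delta>"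
      "cover_sum U < hausdorff1_content \<delta> S + ennreal (e/2)"
      unfolding hausdorff1_content_def[of \<delta> S] INF_less_iff by auto
    have "hausdorff1_content \<delta> T < hausdorff1_content \<delta> T + ennreal (e/2)"
      using fin by (intro lt) (auto simp: less_top)
    then obtain W :: "nat \<Rightarrow> 'a set" where W: "T \<subseteq> (\<Union>i. W i)" "\<And>i. bounded (W i)" "\<And>i. diameter (W i) \<le> \<delta>"
      "cover_sum W < hausdorff1_content \<delta> T + ennreal (e/2)"
      unfolding hausdorff1_content_def[of \<delta> T] INF_less_iff by auto
    have "hausdorff1_content \<delta> (S \<union> T)
        \<le> (hausdorff1_content \<delta> S + ennreal (e/2)) + (hausdorff1_content \<delta> T + ennreal (e/2))"
      using *[OF U(1-3) W(1-3)] U(4) W(4) by (meson add_mono less_imp_le order_trans)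
    also have "\<dots> = hausdorff1_content \<delta> S + hausdorff1_content \<delta> T + (ennreal (e/2) + ennreal (e/2))"
      by (simp add: algebra_simps)
    also have "ennreal (e/2) + ennreal (e/2) = ennreal e"
      using e by (simp add: ennreal_plus[symmetric] del: ennreal_plus)
    finally show "hausdorff1_content \<delta> (S \<union> T)
        \<le> hausdorff1_content \<delta> S + hausdorff1_content \<delta> T + ennreal e" .
  qed
qed

lemma hausdorff1_Un: "hausdorff1 (S \<union> T) \<le> hausdorff1 S + hausdorff1 T"
  by (rule hausdorff1_leI)
     (rule order_trans[OF hausdorff1_content_Un add_mono[OF
        hausdorff1_content_le_hausdorff1 hausdorff1_content_le_hausdorff1]])

lemma hausdorff1_content_le_diameter:
  assumes "bounded S" and "diameter S \<le> \<delta>"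
  shows "hausdorff1_content \<delta> S \<le> ennreal (diameter S)"
proof -
  have "hausdorff1_content \<delta> S \<le> (suminf (\<lambda>i::nat. ennreal (diameter (if i = (0::nat) then S else {}))))"
  proof (rule hausdorff1_content_le)
    show "S \<subseteq> (\<Union>i. if i = (0::nat) then S else {})" by (auto intro!: exI[of _ 0])
    show "diameter (if i = 0 then S else {}) \<le> \<delta>" for i :: nat
      using assms diameter_ge_0[OF assms(1)] by auto
  qed (use assms in auto)
  also have "\<dots> = ennreal (diameter S)"
    by (subst suminf_finite[where N = "{0}"]) auto
  finally show ?thesis .
qed

lemma hausdorff1_empty [simp]: "hausdorff1 ({} :: 'a::metric_space set) = 0"
proof -
  have "hausdorff1 ({} :: 'a set) \<le> 0"
    by (rule hausdorff1_leI) (use hausdorff1_content_le_diameter[of "{} :: 'a set"] in simp)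
  then show ?thesis by simp
qed

lemma hausdorff1_singleton [simp]: "hausdorff1 {x} = 0"
proof -
  have "hausdorff1 {x} \<le> 0"
    by (rule hausdorff1_leI) (use hausdorff1_content_le_diameter[of "{x}"] in force)
  then show ?thesis by simp
qed

lemma hausdorff1_UN:
  "finite I \<Longrightarrow> hausdorff1 (\<Union>i\<in>I. S i) \<le> (\<Sum>i\<in>I. hausdorff1 (S i))"
  by (induction I rule: finite_induct)
     (auto intro: order_trans[OF hausdorff1_Un] add_mono)

lemma hausdorff1_finite: "finite S \<Longrightarrow> hausdorff1 S = 0"
  using hausdorff1_UN[of S "\<lambda>x. {x}"] by simp

lemma compact_disjoint_separated:
  fixes K L :: "'a::metric_space set"
  assumes "compact K" "compact L" "K \<inter> L = {}"
  obtains d where "0 < d" "\<And>x y. x \<in> K \<Longrightarrow> y \<in> L \<Longrightarrow> d \<le> dist x y"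
proof (cases "K = {} \<or> L = {}")
  case False
  have "\<exists>z\<in>K \<times> L. \<forall>w\<in>K \<times> L. dist (fst z) (snd z) \<le> dist (fst w) (snd w)"
    by (rule continuous_attains_inf) (use False assms in \<open>auto intro!: compact_Times continuous_intros\<close>)
  then obtain z where z: "z \<in> K \<times> L" "\<And>w. w \<in> K \<times> L \<Longrightarrow> dist (fst z) (snd z) \<le> dist (fst w) (snd w)"
    by blast
  show ?thesis
  proof
    show "0 < dist (fst z) (snd z)" using z(1) assms(3) by auto
  qed (use z(2) in force)
qed (auto intro: that[of 1])

text \<open>Covering sets that are smaller than the distance of the two compact sets meet only one of them.\<close>

lemma hausdorff1_compact_Un_disjoint:
  fixes K L :: "'a::metric_space set"
  assumes K: "compact K" and L: "compact L" and disj: "K \<inter> L = {}"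
  shows "hausdorff1 K + hausdorff1 L \<le> hausdorff1 (K \<union> L)"
proof -
  obtain d where d: "0 < d" "\<And>x y. x \<in> K \<Longrightarrow> y \<in> L \<Longrightarrow> d \<le> dist x y"
    using compact_disjoint_separated[OF assms] by blast
  have sep: "hausdorff1_content \<delta> K + hausdorff1_content \<delta> L \<le> hausdorff1 (K \<union> L)"
    if \<delta>: "0 < \<delta>" "\<delta> < d" for \<delta>
  proof -
    have "hausdorff1_content \<delta> K + hausdorff1_content \<delta> L \<le> hausdorff1_content \<delta> (K \<union> L)"
    proof (rule hausdorff1_content_greatest)
      fix U :: "nat \<Rightarrow> 'a set"
      assume U: "K \<union> L \<subseteq> (\<Union>i. U i)" "\<And>i. bounded (U i)" "\<And>i. diameter (U i) \<le> \<delta>"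
      define UK where "UK i = (if U i \<inter> K \<noteq> {} then U i else {})" for i
      define UL where "UL i = (if U i \<inter> L \<noteq> {} then U i else {})" for i
      have "U i \<inter> K = {} \<or> U i \<inter> L = {}" for i
      proof (rule ccontr)
        assume "\<not> ?thesis"
        then obtain x y where "x \<in> U i \<inter> K" "y \<in> U i \<inter> L" by blast
        then show False
          using d(2)[of x y] diameter_bounded_bound[OF U(2)[of i], of x y] U(3)[of i] \<delta> by auto
      qed
      then have le: "ennreal (diameter (UK i)) + ennreal (diameter (UL i)) \<le> ennreal (diameter (U i))" for i
        by (auto simp: UK_def UL_def)
      have sub: "K \<subseteq> (\<Union>i. UK i)" "L \<subseteq> (\<Union>i. UL i)"
        using U(1) by (auto simp: UK_def UL_def subset_iff) blast+
      have "hausdorff1_content \<delta> K + hausdorff1_content \<delta> L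
          \<le> cover_sum UK + cover_sum UL"
        by (intro add_mono hausdorff1_content_le sub)
           (use U \<delta> in \<open>auto simp: UK_def UL_def\<close>)
      also have "\<dots> = (suminf (\<lambda>i::nat. ennreal (diameter (UK i)) + ennreal (diameter (UL i))))"
        by (rule suminf_add) auto
      also have "\<dots> \<le> cover_sum U"
        by (intro suminf_le le) auto
      finally show "hausdorff1_content \<delta> K + hausdorff1_content \<delta> L \<le> cover_sum U" .
    qed
    also have "\<dots> \<le> hausdorff1 (K \<union> L)"
      by (rule hausdorff1_content_le_hausdorff1) fact
    finally show ?thesis .
  qed
  have "hausdorff1 K + hausdorff1 L
      = (SUP \<delta>\<in>{0<..}. hausdorff1_content \<delta> K + hausdorff1_content \<delta> L)"
    unfolding hausdorff1_def
  proof (rule SUP_add_directed_ennreal[symmetric])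
    fix i j :: real assume "i \<in> {0<..}" "j \<in> {0<..}"
    then show "\<exists>k\<in>{0<..}. hausdorff1_content i K + hausdorff1_content j L
        \<le> hausdorff1_content k K + hausdorff1_content k L"
      by (intro bexI[of _ "min i j"] add_mono hausdorff1_content_antimono) auto
  qed
  also have "\<dots> \<le> hausdorff1 (K \<union> L)"
  proof (rule SUP_least)
    fix \<delta> :: real assume "\<delta> \<in> {0<..}"
    then have "hausdorff1_content \<delta> K + hausdorff1_content \<delta> L
        \<le> hausdorff1_content (min \<delta> (d/2)) K + hausdorff1_content (min \<delta> (d/2)) L"
      by (intro add_mono hausdorff1_content_antimono) auto
    also have "\<dots> \<le> hausdorff1 (K \<union> L)"
      by (rule sep) (use d \<open>\<delta> \<in> _\<close> in auto)
    finally show "hausdorff1_content \<delta> K + hausdorff1_content \<delta> L \<le> hausdorff1 (K \<union> L)" .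
  qed
  finally show ?thesis .
qed

text \<open>A covering set of diameter \<open>d\<close> lies in a closed interval of length \<open>d\<close>, so that a cover of small
  total diameter would contradict the subadditivity of Lebesgue measure.\<close>

lemma hausdorff1_interval_ge:
  fixes a b :: real
  shows "ennreal (b - a) \<le> hausdorff1 {a..b}"
proof (cases "a \<le> b")
  case True
  have "ennreal (b - a) \<le> hausdorff1_content 1 {a..b}"
  proof (rule hausdorff1_content_greatest)
    fix U :: "nat \<Rightarrow> real set"
    assume U: "{a..b} \<subseteq> (\<Union>i. U i)" "\<And>i. bounded (U i)" "\<And>i. diameter (U i) \<le> 1"
    define J where "J i = (if U i = {} then {} else {Inf (U i)..Sup (U i)})" for i
    have bdd: "bdd_above (U i)" "bdd_below (U i)" for i
      using bounded_imp_bdd_above[OF U(2)] bounded_imp_bdd_below[OF U(2)] by auto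
    have J: "U i \<subseteq> J i" for i
      using cInf_lower[OF _ bdd(2)] cSup_upper[OF _ bdd(1)] by (auto simp: J_def)
    have "emeasure lborel (J i) \<le> ennreal (diameter (U i))" for i
    proof (cases "U i = {}")
      case False
      have "Sup (U i) \<le> Inf (U i) + diameter (U i)"
      proof (rule cSup_least[OF False])
        fix x assume x: "x \<in> U i"
        have "x - diameter (U i) \<le> Inf (U i)"
        proof (rule cInf_greatest[OF False])
          fix y assume "y \<in> U i"
          then show "x - diameter (U i) \<le> y"
            using diameter_bounded_bound[OF U(2) x, of y] by (auto simp: dist_real_def)
        qed
        then show "x \<le> Inf (U i) + diameter (U i)" by simp
      qed
      moreover have "Inf (U i) \<le> Sup (U i)"
        using False bdd by (simp add: cInf_le_cSup)
      ultimately show ?thesis using False by (auto simp: J_def intro!: ennreal_leI)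
    qed (simp add: J_def)
    then have le: "(suminf (\<lambda>i::nat. emeasure lborel (J i))) \<le> cover_sum U"
      by (intro suminf_le) auto
    have "ennreal (b - a) = emeasure lborel {a..b}" using True by simp
    also have "\<dots> \<le> emeasure lborel (\<Union>i. J i)"
    proof (rule emeasure_mono)
      show "{a..b} \<subseteq> (\<Union>i. J i)" using U(1) J by (meson SUP_mono' order_trans)
    qed (auto simp: J_def)
    also have "\<dots> \<le> (suminf (\<lambda>i::nat. emeasure lborel (J i)))"
      by (rule emeasure_subadditive_countably) (auto simp: J_def)
    finally show "ennreal (b - a) \<le> cover_sum U" using le by simp
  qed
  also have "\<dots> \<le> hausdorff1 {a..b}" by (rule hausdorff1_content_le_hausdorff1) simp
  finally show ?thesis .
qed (simp add: ennreal_neg)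

text \<open>A connected set is at least as long as it is wide: the distance from one of its points is a
  \<open>1\<close>-Lipschitz function that takes every intermediate value.\<close>

lemma dist_le_hausdorff1_connected:
  assumes "connected S" "x \<in> S" "y \<in> S"
  shows "ennreal (dist x y) \<le> hausdorff1 S"
proof -
  have "connected (dist x ` S)"
    by (intro connected_continuous_image continuous_intros assms)
  then have "{0..dist x y} \<subseteq> dist x ` S"
    by (rule connected_contains_Icc) (use assms in \<open>auto intro: image_eqI[of _ _ x]\<close>)
  then have "hausdorff1 {0..dist x y} \<le> hausdorff1 (dist x ` S)" by (rule hausdorff1_mono)
  also have "\<dots> \<le> hausdorff1 S"
  proof (rule hausdorff1_lipschitz_image)
    show "dist (dist x u) (dist x v) \<le> dist u v" for u v
      using abs_dist_diff_le[of u x v] by (simp add: dist_real_def dist_commute)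
  qed
  finally show ?thesis using hausdorff1_interval_ge[of "dist x y" 0] by simp
qed

section \<open>Inner Hausdorff measure\<close>

text \<open>Disjoint compact sets lie at positive distance, so that this inner measure is superadditive on
  arbitrary disjoint sets. It yields lower bounds for lengths without questions of measurability.\<close>

definition inner_hausdorff1 :: "'a::metric_space set \<Rightarrow> ennreal" where
  "inner_hausdorff1 S = (SUP K\<in>{K. compact K \<and> K \<subseteq> S}. hausdorff1 K)"

lemma hausdorff1_le_inner: "compact K \<Longrightarrow> K \<subseteq> S \<Longrightarrow> hausdorff1 K \<le> inner_hausdorff1 S"
  unfolding inner_hausdorff1_def by (rule SUP_upper) auto

lemma inner_le_hausdorff1: "inner_hausdorff1 S \<le> hausdorff1 S"
  unfolding inner_hausdorff1_def by (auto intro!: SUP_least hausdorff1_mono)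

lemma inner_hausdorff1_mono: "S \<subseteq> T \<Longrightarrow> inner_hausdorff1 S \<le> inner_hausdorff1 T"
  unfolding inner_hausdorff1_def by (intro SUP_subset_mono) auto

lemma inner_hausdorff1_Un:
  assumes "S \<inter> T = {}"
  shows "inner_hausdorff1 S + inner_hausdorff1 T \<le> inner_hausdorff1 (S \<union> T)"
proof -
  let ?C = "\<lambda>S. {K. compact K \<and> K \<subseteq> S}"
  have "inner_hausdorff1 S + inner_hausdorff1 T
      = (SUP K\<in>?C S. SUP L\<in>?C T. hausdorff1 K + hausdorff1 L)"
    unfolding inner_hausdorff1_def
    by (subst ennreal_SUP_add_left[symmetric], blast)
       (intro SUP_cong refl ennreal_SUP_add_right, blast)
  also have "\<dots> \<le> inner_hausdorff1 (S \<union> T)"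
  proof (intro SUP_least)
    fix K L assume "K \<in> ?C S" "L \<in> ?C T"
    then have "hausdorff1 K + hausdorff1 L \<le> hausdorff1 (K \<union> L)"
      by (intro hausdorff1_compact_Un_disjoint) (use assms in auto)
    also have "\<dots> \<le> inner_hausdorff1 (S \<union> T)"
      using \<open>K \<in> ?C S\<close> \<open>L \<in> ?C T\<close> by (intro hausdorff1_le_inner) auto
    finally show "hausdorff1 K + hausdorff1 L \<le> inner_hausdorff1 (S \<union> T)" .
  qed
  finally show ?thesis .
qed

lemma inner_hausdorff1_UN:
  assumes "finite I" and "disjoint_family_on S I"
  shows "(\<Sum>i\<in>I. inner_hausdorff1 (S i)) \<le> inner_hausdorff1 (\<Union>i\<in>I. S i)"
  using assms
proof (induction I rule: finite_induct)
  case (insert i I)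
  have "(\<Sum>j\<in>insert i I. inner_hausdorff1 (S j))
      \<le> inner_hausdorff1 (S i) + inner_hausdorff1 (\<Union>j\<in>I. S j)"
    using insert by (auto intro!: add_mono disjoint_family_on_mono[OF _ insert.prems])
  also have "\<dots> \<le> inner_hausdorff1 (S i \<union> (\<Union>j\<in>I. S j))"
    by (rule inner_hausdorff1_Un) (use insert in \<open>auto simp: disjoint_family_on_def\<close>)
  finally show ?case by simp
qed simp

section \<open>Lengths of curves\<close>

text \<open>Lengths of parts of a curve are needed everywhere; this version of \<open>curve_length\<close> spares their
  reparametrisation.\<close>

definition curve_length_on :: "(real \<Rightarrow> 'a::metric_space) \<Rightarrow> real \<Rightarrow> real \<Rightarrow> ennreal" where
  "curve_length_on g a b =
     (SUP (n, t)\<in>{(n :: nat, t :: nat \<Rightarrow> real). mono t \<and> range t \<subseteq> {a..b}}.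
        \<Sum>i<n. ennreal (dist (g (t i)) (g (t (Suc i)))))"

lemma curve_length_eq: "curve_length g = curve_length_on g 0 1"
  by (simp add: curve_length_def curve_length_on_def)

lemma curve_length_on_upper:
  "mono t \<Longrightarrow> range t \<subseteq> {a..b} \<Longrightarrow>
    (\<Sum>i<n. ennreal (dist (g (t i)) (g (t (Suc i))))) \<le> curve_length_on g a b"
  unfolding curve_length_on_def by (rule SUP_upper2[of "(n, t)"]) auto

lemma curve_length_on_least:
  assumes "\<And>n t. mono t \<Longrightarrow> range t \<subseteq> {a..b} \<Longrightarrow>
    (\<Sum>i<n::nat. ennreal (dist (g (t i)) (g (t (Suc i))))) \<le> c"
  shows "curve_length_on g a b \<le> c"
  unfolding curve_length_on_def by (rule SUP_least) (use assms in auto)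

lemma dist_le_curve_length_on:
  assumes "a \<le> s" "s \<le> t" "t \<le> b"
  shows "ennreal (dist (g s) (g t)) \<le> curve_length_on g a b"
proof -
  let ?t = "\<lambda>n::nat. if n = 0 then s else t"
  have "(\<Sum>i<1. ennreal (dist (g (?t i)) (g (?t (Suc i))))) \<le> curve_length_on g a b"
    by (rule curve_length_on_upper) (use assms in \<open>auto simp: mono_def\<close>)
  then show ?thesis by simp
qed

lemma sum_lessThan_add:
  fixes f :: "nat \<Rightarrow> 'a::comm_monoid_add"
  shows "(\<Sum>i<k + m. f i) = (\<Sum>i<k. f i) + (\<Sum>i<m. f (k + i))"
  by (induction m) (simp_all add: add.assoc)

text \<open>Two partitions are concatenated; the possible gap between the last point of the first and the first
  point of the second contributes a nonnegative summand.\<close>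

lemma curve_length_on_add:
  assumes "a \<le> b" "b \<le> c"
  shows "curve_length_on g a b + curve_length_on g b c \<le> curve_length_on g a c"
proof -
  let ?P = "\<lambda>a b. {(n :: nat, t :: nat \<Rightarrow> real). mono t \<and> range t \<subseteq> {a..b}}"
  let ?S = "\<lambda>(n, t). \<Sum>i<n::nat. ennreal (dist (g (t i)) (g (t (Suc i))))"
  have ne: "(0, \<lambda>_. b) \<in> ?P a b" "(0, \<lambda>_. b) \<in> ?P b c"
    using assms by (auto simp: mono_def)
  have "curve_length_on g a b + curve_length_on g b c
      = (SUP x\<in>?P a b. SUP y\<in>?P b c. ?S x + ?S y)"
    unfolding curve_length_on_def
    by (subst ennreal_SUP_add_left[symmetric], use ne in blast)
       (intro SUP_cong refl ennreal_SUP_add_right, use ne in blast)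
  also have "\<dots> \<le> curve_length_on g a c"
  proof (intro SUP_least)
    fix x y assume x: "x \<in> ?P a b" and y: "y \<in> ?P b c"
    obtain n t m s where [simp]: "x = (n, t)" "y = (m, s)" by (cases x, cases y) auto
    have t: "mono t" "\<And>i. t i \<in> {a..b}" and s: "mono s" "\<And>i. s i \<in> {b..c}"
      using x y by (simp_all add: image_subset_iff)
    define r where "r i = (if i \<le> n then t i else s (i - Suc n))" for i
    have tb: "t i \<le> s j" for i j using t(2)[of i] s(2)[of j] by auto
    have "mono r"
      unfolding incseq_Suc_iff
    proof
      fix i
      show "r i \<le> r (Suc i)"
        using tb t(1) s(1) by (auto simp: r_def Suc_diff_le intro: monoD)
    qed
    moreover have "range r \<subseteq> {a..c}"
    proof (clarify, simp only: atLeastAtMost_iff)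
      fix i show "a \<le> r i \<and> r i \<le> c"
        using t(2)[of i] s(2)[of "i - Suc n"] assms by (auto simp: r_def)
    qed
    ultimately have le: "?S (Suc n + m, r) \<le> curve_length_on g a c"
      unfolding prod.case by (intro curve_length_on_upper)
    have "(\<Sum>i<Suc n + m. ennreal (dist (g (r i)) (g (r (Suc i)))))
        = (\<Sum>i<Suc n. ennreal (dist (g (r i)) (g (r (Suc i)))))
          + (\<Sum>i<m. ennreal (dist (g (r (Suc n + i))) (g (r (Suc (Suc n + i))))))"
      by (rule sum_lessThan_add)
    moreover have "(\<Sum>i<m. ennreal (dist (g (r (Suc n + i))) (g (r (Suc (Suc n + i)))))) = ?S (m, s)"
      by (auto simp: r_def intro!: sum.cong)
    moreover have "?S (n, t) \<le> (\<Sum>i<Suc n. ennreal (dist (g (r i)) (g (r (Suc i)))))"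
      by (auto simp: r_def)
    ultimately have "?S (n, t) + ?S (m, s) \<le> ?S (Suc n + m, r)"
      unfolding prod.case by (simp only: add_right_mono)
    then show "?S x + ?S y \<le> curve_length_on g a c" using le by simp
  qed
  finally show ?thesis .
qed

definition subarc :: "real \<Rightarrow> real \<Rightarrow> (real \<Rightarrow> 'a) \<Rightarrow> real \<Rightarrow> 'a" where
  "subarc a b g = (\<lambda>t. g (a + (b - a) * t))"

lemma curve_length_subarc_le:
  assumes "a \<le> b"
  shows "curve_length (subarc a b g) \<le> curve_length_on g a b"
  unfolding curve_length_eq
proof (rule curve_length_on_least)
  fix n :: nat and t :: "nat \<Rightarrow> real" assume t: "mono t" "range t \<subseteq> {0..1}"
  have "a + (b - a) * t i \<in> {a..b}" for i
  proof -
    have "0 \<le> t i" "t i \<le> 1" using t(2) by (simp_all add: image_subset_iff)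
    then have "(b - a) * t i \<le> (b - a) * 1" "0 \<le> (b - a) * t i"
      using assms by (intro mult_left_mono mult_nonneg_nonneg; simp)+
    then show ?thesis by simp
  qed
  moreover have "mono (\<lambda>i. a + (b - a) * t i)"
    using t(1) assms by (auto simp: mono_def intro!: mult_left_mono)
  ultimately have "(\<Sum>i<n. ennreal (dist (g (a + (b - a) * t i)) (g (a + (b - a) * t (Suc i)))))
      \<le> curve_length_on g a b"
    by (intro curve_length_on_upper) auto
  then show "(\<Sum>i<n. ennreal (dist (subarc a b g (t i)) (subarc a b g (t (Suc i)))))
      \<le> curve_length_on g a b"
    by (simp add: subarc_def)
qed

text \<open>For a fixed bound \<open>\<delta>\<close> on the diameters the estimate is clear on short parameter intervals, whose images
  are covering sets themselves, and it is preserved when adjacent intervals are joined. Compactness of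
  \<open>{a..b}\<close> then yields the estimate on the whole interval.\<close>

lemma hausdorff1_image_le_curve_length_on:
  fixes g :: "real \<Rightarrow> 'a::metric_space"
  assumes "continuous_on {a..b} g" "a \<le> b"
  shows "hausdorff1 (g ` {a..b}) \<le> curve_length_on g a b"
proof (rule hausdorff1_leI)
  fix \<delta> :: real assume \<delta>: "0 < \<delta>"
  have "a \<le> a \<and> b \<le> b \<longrightarrow> hausdorff1_content \<delta> (g ` {a..b}) \<le> curve_length_on g a b"
    using \<open>a \<le> b\<close>
  proof (induction rule: Bolzano[where P = "\<lambda>u v. a \<le> u \<and> v \<le> b \<longrightarrow>
      hausdorff1_content \<delta> (g ` {u..v}) \<le> curve_length_on g u v"])
    case (trans u v w)
    show ?case
    proof
      assume "a \<le> u \<and> w \<le> b"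
      have "g ` {u..w} = g ` {u..v} \<union> g ` {v..w}"
        using trans(3,4) by (simp add: image_Un[symmetric] ivl_disj_un_two_touch)
      then have "hausdorff1_content \<delta> (g ` {u..w})
          \<le> hausdorff1_content \<delta> (g ` {u..v}) + hausdorff1_content \<delta> (g ` {v..w})"
        by (simp add: hausdorff1_content_Un)
      also have "\<dots> \<le> curve_length_on g u v + curve_length_on g v w"
        using trans \<open>a \<le> u \<and> w \<le> b\<close> by (intro add_mono) auto
      also have "\<dots> \<le> curve_length_on g u w" by (rule curve_length_on_add) (use trans in auto)
      finally show "hausdorff1_content \<delta> (g ` {u..w}) \<le> curve_length_on g u w" .
    qed
  next
    case (local x)
    obtain d where d: "0 < d" "\<And>y. y \<in> {a..b} \<Longrightarrow> dist y x < d \<Longrightarrow> dist (g y) (g x) < \<delta>/2"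
      using assms(1)[unfolded continuous_on_iff, rule_format, of x "\<delta>/2"] local \<delta> by auto
    show ?case
    proof (intro exI[of _ d] conjI allI impI)
      fix u v assume uv: "u \<le> x \<and> x \<le> v \<and> v - u < d" and ab: "a \<le> u \<and> v \<le> b"
      have cont: "continuous_on {u..v} g"
        by (rule continuous_on_subset[OF assms(1)]) (use ab in auto)
      then have K: "compact (g ` {u..v})" by (intro compact_continuous_image) auto
      have close: "dist (g y) (g x) < \<delta>/2" if "y \<in> {u..v}" for y
        using that uv ab by (intro d) (auto simp: dist_real_def)
      have "dist (g y) (g z) \<le> \<delta>" if "y \<in> {u..v}" "z \<in> {u..v}" for y z
        using close[OF that(1)] close[OF that(2)] dist_triangle2[of "g y" "g z" "g x"] by linarith
      then have "diameter (g ` {u..v}) \<le> \<delta>"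
        by (intro diameter_leI) (use \<delta> in auto)
      then have "hausdorff1_content \<delta> (g ` {u..v}) \<le> ennreal (diameter (g ` {u..v}))"
        by (intro hausdorff1_content_le_diameter compact_imp_bounded K)
      also obtain y z where yz: "y \<in> {u..v}" "z \<in> {u..v}" "dist (g y) (g z) = diameter (g ` {u..v})"
        using diameter_compact_attained[OF K] uv by auto
      have "ennreal (diameter (g ` {u..v})) \<le> curve_length_on g u v"
        using dist_le_curve_length_on[of u y z v g] dist_le_curve_length_on[of u z y v g] yz
        by (cases "y \<le> z") (auto simp: dist_commute)
      finally show "hausdorff1_content \<delta> (g ` {u..v}) \<le> curve_length_on g u v" .
    qed (use d in simp)
  qed
  then show "hausdorff1_content \<delta> (g ` {a..b}) \<le> curve_length_on g a b" by simp
qed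

lemma hausdorff1_path_image_le: "path g \<Longrightarrow> hausdorff1 (path_image g) \<le> curve_length g"
  unfolding path_def path_image_def curve_length_eq
  by (rule hausdorff1_image_le_curve_length_on) auto

lemma hausdorff1_real_interval_le:
  "0 \<le> r \<Longrightarrow> hausdorff1 {0..r::real} \<le> ennreal r"
proof -
  assume r: "0 \<le> r"
  have "hausdorff1 ((\<lambda>t::real. t) ` {0..r}) \<le> curve_length_on (\<lambda>t. t) 0 r"
    by (rule hausdorff1_image_le_curve_length_on) (use r in auto)
  also have "\<dots> \<le> ennreal r"
  proof (rule curve_length_on_least)
    fix n :: nat and t :: "nat \<Rightarrow> real" assume t: "mono t" "range t \<subseteq> {0..r}"
    have "(\<Sum>i<n. ennreal (dist (t i) (t (Suc i)))) = (\<Sum>i<n. ennreal (t (Suc i) - t i))"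
      using t(1) by (intro sum.cong) (auto simp: dist_real_def mono_def)
    also have "\<dots> = ennreal (\<Sum>i<n. t (Suc i) - t i)"
      by (rule sum_ennreal) (use t(1) in \<open>auto simp: mono_def\<close>)
    also have "(\<Sum>i<n. t (Suc i) - t i) = t n - t 0" by (rule sum_lessThan_telescope)
    also have "ennreal (t n - t 0) \<le> ennreal r"
    proof (rule ennreal_leI)
      have "t n \<in> {0..r}" "t 0 \<in> {0..r}" using t(2) by (simp_all add: image_subset_iff)
      then show "t n - t 0 \<le> r" by auto
    qed
    finally show "(\<Sum>i<n. ennreal (dist (t i) (t (Suc i)))) \<le> ennreal r" .
  qed
  finally show ?thesis by simp
qed

text \<open>The compact subarcs obtained by cutting off short pieces at both ends are connected, and their ends are
  almost as far apart as those of the whole arc.\<close>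

lemma dist_le_inner_hausdorff1_arc:
  fixes g :: "real \<Rightarrow> 'a::metric_space"
  assumes cont: "continuous_on {s..t} g" and "s \<le> t"
  shows "ennreal (dist (g s) (g t)) \<le> inner_hausdorff1 (g ` {s<..<t})"
proof (cases "s < t")
  case True
  show ?thesis
  proof (rule ennreal_le_epsilon)
    fix e :: real assume e: "0 < e"
    obtain d1 where d1: "0 < d1" "\<And>y. y \<in> {s..t} \<Longrightarrow> dist y s < d1 \<Longrightarrow> dist (g y) (g s) < e/2"
      using cont[unfolded continuous_on_iff, rule_format, of s "e/2"] \<open>s \<le> t\<close> e by auto
    obtain d2 where d2: "0 < d2" "\<And>y. y \<in> {s..t} \<Longrightarrow> dist y t < d2 \<Longrightarrow> dist (g y) (g t) < e/2"
      using cont[unfolded continuous_on_iff, rule_format, of t "e/2"] \<open>s \<le> t\<close> e by auto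
    define h where "h = min (min d1 d2) (t - s) / 3"
    have h: "0 < h" "h < d1" "h < d2" "2 * h < t - s"
      using d1(1) d2(1) True by (simp_all add: h_def min_def)
    let ?K = "g ` {s + h..t - h}"
    have c: "continuous_on {s + h..t - h} g"
      by (rule continuous_on_subset[OF cont]) (use h in auto)
    have "ennreal (dist (g (s + h)) (g (t - h))) \<le> hausdorff1 ?K"
      by (rule dist_le_hausdorff1_connected) (use h c in \<open>auto intro: connected_continuous_image\<close>)
    also have "\<dots> \<le> inner_hausdorff1 (g ` {s<..<t})"
      by (rule hausdorff1_le_inner) (use h c in \<open>auto intro: compact_continuous_image\<close>)
    finally have le: "ennreal (dist (g (s + h)) (g (t - h))) \<le> inner_hausdorff1 (g ` {s<..<t})" .
    have "dist (g (s + h)) (g s) < e/2" "dist (g (t - h)) (g t) < e/2"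
      by (rule d1 d2; use h in \<open>simp add: dist_real_def\<close>)+
    then have "dist (g s) (g t) \<le> dist (g (s + h)) (g (t - h)) + e"
      using dist_triangle[of "g s" "g t" "g (s + h)"] dist_triangle[of "g (s + h)" "g t" "g (t - h)"]
      by (simp add: dist_commute)
    then have "ennreal (dist (g s) (g t)) \<le> ennreal (dist (g (s + h)) (g (t - h))) + ennreal e"
      using e by (simp add: ennreal_plus[symmetric] ennreal_leI del: ennreal_plus)
    also have "\<dots> \<le> inner_hausdorff1 (g ` {s<..<t}) + ennreal e"
      by (intro add_right_mono le)
    finally show "ennreal (dist (g s) (g t)) \<le> inner_hausdorff1 (g ` {s<..<t}) + ennreal e" .
  qed
qed (use \<open>s \<le> t\<close> in simp)

text \<open>The open pieces of an injective arc that a partition cuts out are disjoint, and each has at least the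
  distance of its ends as inner measure.\<close>

lemma curve_length_on_le_inner_hausdorff1:
  fixes g :: "real \<Rightarrow> 'a::metric_space"
  assumes cont: "continuous_on {a..b} g" and inj: "inj_on g {a<..<b}"
  shows "curve_length_on g a b \<le> inner_hausdorff1 (g ` {a<..<b})"
proof (rule curve_length_on_least)
  fix n :: nat and t :: "nat \<Rightarrow> real" assume t: "mono t" "range t \<subseteq> {a..b}"
  have ab: "t i \<in> {a..b}" for i using t(2) by (simp add: image_subset_iff)
  have "(\<Sum>i<n. ennreal (dist (g (t i)) (g (t (Suc i))))) \<le> inner_hausdorff1 (g ` {t 0<..<t n})"
  proof (induction n)
    case (Suc n)
    have le: "t 0 \<le> t n" "t n \<le> t (Suc n)" using t(1) by (auto simp: mono_def)
    have sub: "{t 0<..<t n} \<subseteq> {a<..<b}" "{t n<..<t (Suc n)} \<subseteq> {a<..<b}"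
      using ab[of 0] ab[of n] ab[of "Suc n"] by auto
    have "(\<Sum>i<Suc n. ennreal (dist (g (t i)) (g (t (Suc i)))))
        \<le> inner_hausdorff1 (g ` {t 0<..<t n}) + inner_hausdorff1 (g ` {t n<..<t (Suc n)})"
      unfolding sum.lessThan_Suc
      by (intro add_mono Suc dist_le_inner_hausdorff1_arc continuous_on_subset[OF cont] le)
         (use ab[of n] ab[of "Suc n"] in auto)
    also have "\<dots> \<le> inner_hausdorff1 (g ` {t 0<..<t n} \<union> g ` {t n<..<t (Suc n)})"
    proof (rule inner_hausdorff1_Un)
      show "g ` {t 0<..<t n} \<inter> g ` {t n<..<t (Suc n)} = {}"
        by (subst inj_on_image_Int[OF inj sub, symmetric]) auto
    qed
    also have "\<dots> \<le> inner_hausdorff1 (g ` {t 0<..<t (Suc n)})"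
      by (rule inner_hausdorff1_mono) (use le in auto)
    finally show ?case .
  qed simp
  also have "\<dots> \<le> inner_hausdorff1 (g ` {a<..<b})"
    by (rule inner_hausdorff1_mono) (use ab[of 0] ab[of n] in auto)
  finally show "(\<Sum>i<n. ennreal (dist (g (t i)) (g (t (Suc i))))) \<le> inner_hausdorff1 (g ` {a<..<b})" .
qed

lemma hausdorff1_open_arc:
  fixes g :: "real \<Rightarrow> 'a::metric_space"
  assumes "continuous_on {a..b} g" "a \<le> b" "inj_on g {a<..<b}"
  shows "curve_length_on g a b = hausdorff1 (g ` {a<..<b})"
    and "inner_hausdorff1 (g ` {a<..<b}) = hausdorff1 (g ` {a<..<b})"
proof -
  have "hausdorff1 (g ` {a<..<b}) \<le> hausdorff1 (g ` {a..b})" by (rule hausdorff1_mono) auto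
  with hausdorff1_image_le_curve_length_on[OF assms(1,2)] curve_length_on_le_inner_hausdorff1[OF assms(1,3)]
    inner_le_hausdorff1[of "g ` {a<..<b}"]
  show "curve_length_on g a b = hausdorff1 (g ` {a<..<b})"
    and "inner_hausdorff1 (g ` {a<..<b}) = hausdorff1 (g ` {a<..<b})"
    by (auto intro!: antisym)
qed

section \<open>Cells in a simply connected space\<close>

text \<open>Openness of \<open>a ` {0<..<1}\<close> in \<open>Y\<close> means that nothing branches off the interior of the cell. The
  ends may coincide; simple connectedness of \<open>Y\<close> will exclude that (\<open>open_cell_ends_neq\<close>).\<close>

definition open_cell :: "'a::metric_space set \<Rightarrow> (real \<Rightarrow> 'a) \<Rightarrow> bool" where
  "open_cell Y a \<longleftrightarrow> path a \<and> path_image a \<subseteq> Y \<and> inj_on a {0<..<1} \<and>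
     openin (top_of_set Y) (a ` {0<..<1}) \<and> a 0 \<notin> a ` {0<..<1} \<and> a 1 \<notin> a ` {0<..<1}"

lemma open_cellD:
  assumes "open_cell Y a"
  shows "path a" "continuous_on {0..1} a" "\<And>t. t \<in> {0..1} \<Longrightarrow> a t \<in> Y" "path_image a \<subseteq> Y"
    "inj_on a {0<..<1}" "openin (top_of_set Y) (a ` {0<..<1})"
    "a 0 \<notin> a ` {0<..<1}" "a 1 \<notin> a ` {0<..<1}"
  using assms by (auto simp: open_cell_def path_def path_image_def)

lemma open_cell_eqD:
  assumes "open_cell Y a" "a s = a t" "s \<in> {0<..<1}" "t \<in> {0..1}"
  shows "s = t"
proof -
  have "t \<noteq> 0" "t \<noteq> 1"
    using open_cellD(7,8)[OF assms(1)] assms(2,3) by (metis imageI)+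
  then have "t \<in> {0<..<1}" using assms(4) by auto
  then show ?thesis using inj_onD[OF open_cellD(5)[OF assms(1)] assms(2,3)] by simp
qed

lemma affine_image:
  fixes a b :: real
  assumes "a < b"
  shows "(\<lambda>t. a + (b - a) * t) ` {0<..<1} = {a<..<b}" "(\<lambda>t. a + (b - a) * t) ` {0..1} = {a..b}"
proof -
  have inv: "x = a + (b - a) * ((x - a) / (b - a))" for x using assms by simp
  have "a + (b - a) * t \<in> {a<..<b} \<longleftrightarrow> t \<in> {0<..<1}" "a + (b - a) * t \<in> {a..b} \<longleftrightarrow> t \<in> {0..1}" for t
  proof -
    have "a + (b - a) * t < b \<longleftrightarrow> (b - a) * t < (b - a) * 1" "a + (b - a) * t \<le> b \<longleftrightarrow> (b - a) * t \<le> (b - a) * 1"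
      unfolding mult_1_right by linarith+
    then have "a + (b - a) * t < b \<longleftrightarrow> t < 1" "a + (b - a) * t \<le> b \<longleftrightarrow> t \<le> 1"
      using mult_less_cancel_left_pos[of "b - a" t 1] mult_le_cancel_left_pos[of "b - a" t 1] assms by simp_all
    then show "a + (b - a) * t \<in> {a<..<b} \<longleftrightarrow> t \<in> {0<..<1}" "a + (b - a) * t \<in> {a..b} \<longleftrightarrow> t \<in> {0..1}"
      using assms by (auto simp: zero_less_mult_iff zero_le_mult_iff)
  qed
  then show "(\<lambda>t. a + (b - a) * t) ` {0<..<1} = {a<..<b}" "(\<lambda>t. a + (b - a) * t) ` {0..1} = {a..b}"
    using inv by (metis (no_types, lifting) image_eqI image_subsetI subsetI subset_antisym)+
qed

lemma subarc_image:
  assumes "a < b"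
  shows "subarc a b g ` {0<..<1} = g ` {a<..<b}" "subarc a b g ` {0..1} = g ` {a..b}"
  unfolding affine_image[OF assms, symmetric] by (simp_all add: subarc_def image_image)

lemma inj_on_subarc:
  assumes "inj_on g {0<..<1}" "0 \<le> s" "s < t" "t \<le> 1"
  shows "inj_on (subarc s t g) {0<..<1}"
proof -
  have "inj_on (g \<circ> (\<lambda>r. s + (t - s) * r)) {0<..<1}"
    by (rule comp_inj_on, simp add: inj_on_def, use assms in simp,
        rule inj_on_subset[OF assms(1)], simp only: affine_image(1)[OF assms(3)]) (use assms in auto)
  then show ?thesis by (simp add: subarc_def comp_def)
qed

lemma subarc_ends [simp]: "subarc a b g 0 = g a" "subarc a b g 1 = g b"
  by (simp_all add: subarc_def)

lemma path_subarc:
  assumes "continuous_on {a..b} g" "a < b"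
  shows "path (subarc a b g)"
proof -
  have "(\<lambda>t. a + (b - a) * t) ` {0..1} \<subseteq> {a..b}" by (simp add: affine_image(2)[OF assms(2)])
  then show ?thesis
    unfolding path_def subarc_def
    by (intro continuous_on_compose2[OF assms(1)] continuous_intros)
qed

text \<open>The complement of the image within the cell is the trace of a compact set.\<close>

lemma open_cell_image_subset:
  assumes "open_cell Y a" "J \<subseteq> {0<..<1}" "open J"
  shows "openin (top_of_set Y) (a ` J)"
proof -
  have K: "compact (a ` ({0..1} - J))"
    by (intro compact_continuous_image continuous_on_subset[OF open_cellD(2)[OF assms(1)]])
       (use assms(3) in \<open>auto intro: compact_diff\<close>)
  have "a ` J = a ` {0<..<1} - a ` ({0..1} - J)"
  proof (intro set_eqI iffI)
    fix y assume "y \<in> a ` J"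
    then obtain s where s: "s \<in> J" "y = a s" by blast
    have "y \<notin> a ` ({0..1} - J)"
    proof
      assume "y \<in> a ` ({0..1} - J)"
      then obtain t where t: "t \<in> {0..1} - J" "y = a t" by (elim imageE)
      have "s = t" by (rule open_cell_eqD[OF assms(1)]) (use s t assms(2) in auto)
      then show False using s t by simp
    qed
    then show "y \<in> a ` {0<..<1} - a ` ({0..1} - J)" using s assms(2) by blast
  next
    fix y assume "y \<in> a ` {0<..<1} - a ` ({0..1} - J)"
    then show "y \<in> a ` J" by force
  qed
  moreover have "openin (top_of_set Y) (a ` {0<..<1} \<inter> - (a ` ({0..1} - J)))"
    by (intro openin_Int_open open_cellD(6)[OF assms(1)] open_Compl compact_imp_closed K)
  ultimately show ?thesis by (simp add: Diff_eq)
qed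

lemma open_cell_subarc:
  assumes "open_cell Y a" "0 \<le> s" "s < t" "t \<le> 1"
  shows "open_cell Y (subarc s t a)"
  unfolding open_cell_def
proof (intro conjI)
  have sub: "{s<..<t} \<subseteq> {0<..<1}" using assms by auto
  show "path (subarc s t a)"
    by (rule path_subarc[OF continuous_on_subset[OF open_cellD(2)[OF assms(1)]]]) (use assms in auto)
  show "path_image (subarc s t a) \<subseteq> Y"
    unfolding path_image_def subarc_image(2)[OF assms(3)]
    using open_cellD(3)[OF assms(1)] assms by auto
  show "inj_on (subarc s t a) {0<..<1}" by (rule inj_on_subarc[OF open_cellD(5)[OF assms(1)] assms(2-4)])
  show "openin (top_of_set Y) (subarc s t a ` {0<..<1})"
    unfolding subarc_image(1)[OF assms(3)] using sub by (intro open_cell_image_subset[OF assms(1)]) auto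
  have ne: "a u \<notin> a ` {s<..<t}" if "u \<in> {0..1}" "u \<notin> {s<..<t}" for u
    using open_cell_eqD[OF assms(1)] sub that by (metis imageE subsetD)
  show "subarc s t a 0 \<notin> subarc s t a ` {0<..<1}" "subarc s t a 1 \<notin> subarc s t a ` {0<..<1}"
    unfolding subarc_image(1)[OF assms(3)] using assms by (simp_all add: ne)
qed

lemma reversepath_image: "reversepath a ` {0<..<1} = a ` {0<..<1}"
proof -
  have "(\<lambda>t::real. 1 - t) ` {0<..<1} = {0<..<1}"
    by (auto intro!: image_eqI[where x = "1 - _"])
  then show ?thesis by (metis (no_types, lifting) image_cong image_image reversepath_def)
qed

lemma open_cell_reversepath:
  assumes "open_cell Y a"
  shows "open_cell Y (reversepath a)"
proof -
  have "inj_on (reversepath a) {0<..<1}"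
    unfolding reversepath_def
    by (rule inj_onI, drule inj_onD[OF open_cellD(5)[OF assms]]) auto
  then show ?thesis
    using open_cellD[OF assms] unfolding open_cell_def reversepath_image path_image_reversepath
    by (simp add: path_reversepath) (simp add: reversepath_def)
qed

text \<open>The map that wraps an open cell once around the unit circle and sends everything else to \<open>1\<close>
  is continuous. A path that closes the cell up outside the open cell would be mapped to a loop of
  winding number \<open>1\<close>, although every loop in a simply connected space is contractible.\<close>

lemma open_cell_bridge:
  assumes sc: "simply_connected Y" and cell: "open_cell Y a"
  shows "\<not> path_component (Y - a ` {0<..<1}) (a 1) (a 0)"
proof
  let ?A = "a ` {0<..<1}"
  note c = open_cellD[OF cell]
  assume "path_component (Y - ?A) (a 1) (a 0)"
  then obtain g where g: "path g" "path_image g \<subseteq> Y - ?A" "pathstart g = a 1" "pathfinish g = a 0"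
    unfolding path_component_def by blast
  define f :: "'a \<Rightarrow> complex" where
    "f y = (if y \<in> ?A then circlepath 0 1 (the_inv_into {0<..<1} a y) else 1)" for y
  have fa: "f (a t) = circlepath 0 1 t" if "t \<in> {0..1}" for t
  proof (cases "t \<in> {0<..<1}")
    case True
    then show ?thesis using the_inv_into_f_f[OF c(5)] by (auto simp: f_def)
  next
    case False
    then have "t = 0 \<or> t = 1" using that by auto
    then show ?thesis using c(7,8) by (auto simp: f_def circlepath)
  qed
  have f1: "f y = 1" if "y \<notin> ?A" for y using that by (simp add: f_def)
  have K: "compact (path_image a)" using c(1) by (rule compact_path_image)
  have "continuous_on (path_image a) f"
    unfolding continuous_on_closed_vimage[OF compact_imp_closed[OF K]]
  proof (intro allI impI)
    fix C :: "complex set" assume C: "closed C"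
    have "f -` C \<inter> path_image a = a ` ({0..1} \<inter> circlepath 0 1 -` C)"
      using fa by (auto simp: path_image_def)
    moreover have "compact ({0..1} \<inter> circlepath 0 1 -` C)"
      by (intro compact_Int_closed compact_Icc continuous_closed_vimage C)
         (simp add: circlepath_def part_circlepath_def)
    ultimately show "closed (f -` C \<inter> path_image a)"
      using c(2) by (auto intro!: compact_imp_closed compact_continuous_image intro: continuous_on_subset)
  qed
  moreover have "continuous_on (Y - ?A) f"
    using continuous_on_const[of "Y - ?A" 1] by (rule continuous_on_eq) (simp add: f1)
  moreover have "Y = path_image a \<union> (Y - ?A)"
    using c(4) by (auto simp: path_image_def)
  moreover have "closedin (top_of_set Y) (path_image a)"
    using c(4) compact_imp_closed[OF K] by (simp add: closed_subset)
  moreover have "closedin (top_of_set Y) (Y - ?A)"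
    using closedin_diff[OF closedin_topspace c(6)] by simp
  ultimately have contf: "continuous_on Y f"
    using continuous_on_Un_local[of "path_image a" "Y - ?A" f] by metis
  have "f \<in> Y \<rightarrow> - {0}"
  proof
    fix y show "f y \<in> - {0}"
    proof (cases "y \<in> ?A")
      case True
      then obtain t where "t \<in> {0<..<1}" "y = a t" by blast
      then show ?thesis using fa[of t] by (simp add: circlepath)
    qed (simp add: f1)
  qed
  define l where "l = a +++ g"
  have l: "path l" "path_image l \<subseteq> Y" "pathfinish l = pathstart l"
  proof -
    have j: "pathfinish a = pathstart g" "pathstart a = pathfinish g" using g by (simp_all add: pathfinish_def pathstart_def)
    show "path l" "pathfinish l = pathstart l" using j c(1) g(1) by (simp_all add: l_def)
    show "path_image l \<subseteq> Y" using path_image_join[OF j(1)] c(4) g(2) by (auto simp: l_def)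
  qed
  define k where "k = (\<lambda>t::real. a 0)"
  have k: "path k" "path_image k \<subseteq> Y" "pathfinish k = pathstart k"
    using c(3)[of 0] by (auto simp: k_def path_def path_image_def pathstart_def pathfinish_def)
  have "homotopic_loops Y l k"
    using sc l k unfolding simply_connected_def by blast
  then have "homotopic_loops (- {0}) (f \<circ> l) (f \<circ> k)"
    using contf \<open>f \<in> Y \<rightarrow> - {0}\<close> by (rule homotopic_loops_continuous_image)
  then have w: "winding_number (f \<circ> l) 0 = winding_number (f \<circ> k) 0"
    by (rule winding_number_homotopic_loops)
  have "winding_number (f \<circ> k) 0 = 0"
    using winding_number_zero_const[of 1 0] c(7) by (simp add: k_def comp_def f1)
  moreover have "winding_number (f \<circ> l) 0 = winding_number (circlepath 0 1 +++ (\<lambda>t. 1)) 0"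
  proof (rule winding_number_cong)
    fix t :: real assume t: "0 \<le> t" "t \<le> 1"
    show "(f \<circ> l) t = (circlepath 0 1 +++ (\<lambda>t. 1)) t"
    proof (cases "t \<le> 1/2")
      case True
      then show ?thesis using t fa[of "2 * t"] by (simp add: l_def joinpaths_def)
    next
      case False
      then have "g (2 * t - 1) \<in> path_image g" using t by (auto simp: path_image_def)
      then have "g (2 * t - 1) \<notin> ?A" using g(2) by blast
      then show ?thesis using False by (simp add: l_def joinpaths_def f1)
    qed
  qed
  moreover have "winding_number (circlepath 0 1 +++ (\<lambda>t. 1)) 0
      = winding_number (circlepath 0 1) 0 + winding_number (\<lambda>t. 1) 0"
    by (rule winding_number_join)
       (auto simp: path_def pathstart_def pathfinish_def circlepath path_image_def intro!: continuous_intros)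
  ultimately show False
    using w winding_number_circlepath_centre[of 1 0] winding_number_zero_const[of 1 0] by simp
qed

lemma open_cell_ends_neq:
  assumes "simply_connected Y" "open_cell Y a"
  shows "a 0 \<noteq> a 1"
proof
  assume eq: "a 0 = a 1"
  have "a 0 \<in> Y - a ` {0<..<1}" using open_cellD(3,7)[OF assms(2)] by auto
  then have "path_component (Y - a ` {0<..<1}) (a 0) (a 0)" by (rule path_component_refl)
  then show False using open_cell_bridge[OF assms] eq by simp
qed

lemma open_cell_eq_iff:
  assumes "simply_connected Y" "open_cell Y a" "s \<in> {0..1}" "t \<in> {0..1}"
  shows "a s = a t \<longleftrightarrow> s = t"
proof
  assume eq: "a s = a t"
  show "s = t"
  proof (cases "s \<in> {0<..<1} \<or> t \<in> {0<..<1}")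
    case True
    then show ?thesis using open_cell_eqD[OF assms(2)] eq assms(3,4) by metis
  next
    case False
    then have "s \<in> {0, 1}" "t \<in> {0, 1}" using assms(3,4) by auto
    then show ?thesis using eq open_cell_ends_neq[OF assms(1,2)] by auto
  qed
qed simp

lemma path_connected_arc_image:
  fixes a :: "real \<Rightarrow> 'a::topological_space"
  assumes "continuous_on {0..1} a" "0 \<le> s" "t \<le> 1"
  shows "path_connected (a ` {s..t})"
proof (intro path_connected_continuous_image continuous_on_subset[OF assms(1)])
  show "path_connected {s..t}" by (rule convex_imp_path_connected) simp
qed (use assms in auto)

text \<open>For splitting a path at its last visit to a closed set.\<close>

lemma last_time_in:
  fixes g :: "real \<Rightarrow> 'a::topological_space"
  assumes g: "continuous_on {0..1} g" and K: "closed K" "g 0 \<in> K"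
  obtains t where "t \<in> {0..1}" "g t \<in> K" "\<And>s. t < s \<Longrightarrow> s \<le> 1 \<Longrightarrow> g s \<notin> K"
proof -
  define C where "C = {0..1} \<inter> g -` K"
  have "closed C" unfolding C_def by (rule continuous_closed_preimage[OF g closed_atLeastAtMost K(1)])
  moreover have bdd: "bdd_above C" by (auto simp: C_def intro!: bdd_aboveI[of _ 1])
  moreover have "0 \<in> C" using K(2) by (simp add: C_def)
  ultimately have "Sup C \<in> C" by (intro closed_contains_Sup) auto
  then have sup: "Sup C \<in> {0..1}" "g (Sup C) \<in> K" by (auto simp: C_def)
  have "g s \<notin> K" if "Sup C < s" "s \<le> 1" for s
  proof
    assume "g s \<in> K"
    then have "s \<in> C" using that sup by (auto simp: C_def)
    then have "s \<le> Sup C" by (rule cSup_upper[OF _ bdd])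
    then show False using that by simp
  qed
  then show ?thesis using that[OF sup] by blast
qed

lemma path_component_joinI:
  assumes "path_connected T" "T \<subseteq> S" "x \<in> T" "y \<in> T"
  shows "path_component S x y"
  using assms path_component_of_subset path_connected_component by blast

text \<open>A path along a cell cannot take a detour: it would avoid a small subarc, against
  \<open>open_cell_bridge\<close>.\<close>

lemma open_cell_crossing:
  assumes sc: "simply_connected Y" and cell: "open_cell Y a" and s: "s \<in> {0..1}"
    and g: "path g" "path_image g \<subseteq> Y" "pathstart g = a 0" "pathfinish g = a s"
  shows "a ` {0<..<s} \<subseteq> path_image g"
proof (rule ccontr)
  note c = open_cellD[OF cell]
  assume "\<not> ?thesis"
  then obtain y where "y \<in> a ` {0<..<s}" "y \<notin> path_image g" by blast
  then obtain r where r: "0 < r" "r < s" "a r \<notin> path_image g" by (metis greaterThanLessThan_iff imageE)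
  have "closed (path_image g)" using g(1) by (intro compact_imp_closed compact_path_image)
  moreover have "continuous (at r) a"
    using continuous_on_interior[OF c(2), of r] r s by (simp add: interior_atLeastAtMost_real)
  ultimately have "\<forall>\<^sub>F t in at r. a t \<in> - path_image g"
    using r(3) by (intro topological_tendstoD[where S = "- path_image g"]) (auto simp: continuous_at isCont_def)
  then obtain d where d: "0 < d" "\<And>t. t \<noteq> r \<Longrightarrow> dist t r < d \<Longrightarrow> a t \<notin> path_image g"
    unfolding eventually_at by auto
  define h where "h = min d (min r (s - r)) / 2"
  have h: "0 < h" "h < d" "h < r" "h < s - r"
    using d(1) r by (auto simp: h_def min_def)
  have av: "a ` {r - h<..<r + h} \<inter> path_image g = {}"
  proof -
    have "a t \<notin> path_image g" if "t \<in> {r - h<..<r + h}" for t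
    proof (cases "t = r")
      case False
      moreover have "dist t r < d" using that h(2) unfolding dist_real_def by (simp add: abs_less_iff)
      ultimately show ?thesis by (rule d(2))
    qed (use r(3) in simp)
    then show ?thesis by blast
  qed
  have cell': "open_cell Y (subarc (r - h) (r + h) a)"
    using h r s by (intro open_cell_subarc[OF cell]) auto
  have im: "subarc (r - h) (r + h) a ` {0<..<1} = a ` {r - h<..<r + h}"
    using h by (intro subarc_image) auto
  have off: "a t \<notin> a ` {r - h<..<r + h}" if "t \<in> {0..1}" "t \<notin> {r - h<..<r + h}" for t
  proof
    assume "a t \<in> a ` {r - h<..<r + h}"
    then obtain u where u: "u \<in> {r - h<..<r + h}" "a u = a t" by auto
    then have "u = t" using open_cell_eqD[OF cell u(2)] that h r s by auto
    then show False using u that by simp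
  qed
  define T where "T = (a ` {r + h..s} \<union> path_image g) \<union> a ` {0..r - h}"
  have "path_connected T"
    unfolding T_def
  proof (intro path_connected_Un path_connected_arc_image c path_connected_path_image g)
    have "a s \<in> path_image g" "a s \<in> a ` {r + h..s}"
      using pathfinish_in_path_image[of g] g(4) h by auto
    then show "a ` {r + h..s} \<inter> path_image g \<noteq> {}" by blast
    have "a 0 \<in> path_image g" "a 0 \<in> a ` {0..r - h}"
      using pathstart_in_path_image[of g] g(3) h by auto
    then show "(a ` {r + h..s} \<union> path_image g) \<inter> a ` {0..r - h} \<noteq> {}" by blast
  qed (use r s h in auto)
  moreover have "T \<subseteq> Y - a ` {r - h<..<r + h}"
  proof
    fix y assume "y \<in> T"
    then consider "y \<in> path_image g" | t where "t \<in> {0..1}" "t \<notin> {r - h<..<r + h}" "y = a t"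
    proof (cases "y \<in> path_image g")
      case False
      with \<open>y \<in> T\<close> obtain t where "t \<in> {r + h..s} \<union> {0..r - h}" "y = a t"
        unfolding T_def by blast
      then show ?thesis using r s h by (intro that(2)[of t]) auto
    qed (rule that(1))
    then show "y \<in> Y - a ` {r - h<..<r + h}"
    proof cases
      case 1
      then show ?thesis using av g(2) by blast
    next
      case 2
      then show ?thesis using off c(3) by simp
    qed
  qed
  moreover have "a (r + h) \<in> T" "a (r - h) \<in> T" using h r s by (auto simp: T_def)
  ultimately have "path_component (Y - a ` {r - h<..<r + h}) (a (r + h)) (a (r - h))"
    by (rule path_component_joinI)
  then show False using open_cell_bridge[OF sc cell'] im by simp
qed

text \<open>The part of \<open>Y\<close> that one reaches from \<open>a 0\<close> by starting along the cell \<open>a\<close> and never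
  returning to \<open>a 0\<close>.\<close>

definition branch :: "'a::metric_space set \<Rightarrow> (real \<Rightarrow> 'a) \<Rightarrow> 'a set" where
  "branch Y a = path_component_set (Y - {a 0}) (a (1/2))"

lemma branch_subset: "branch Y a \<subseteq> Y - {a 0}"
  unfolding branch_def by (rule path_component_subset)

lemma mem_branchI:
  assumes "path_connected T" "T \<subseteq> Y - {a 0}" "a (1/2) \<in> T" "y \<in> T"
  shows "y \<in> branch Y a"
  unfolding branch_def using path_component_joinI[OF assms] by simp

lemma branch_absorb:
  assumes "path_connected T" "T \<subseteq> Y - {a 0}" "x \<in> T" "x \<in> branch Y a"
  shows "T \<subseteq> branch Y a"
proof
  fix y assume "y \<in> T"
  then have "path_component (Y - {a 0}) x y" by (intro path_component_joinI[OF assms(1,2)] assms)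
  then show "y \<in> branch Y a" using assms(4) unfolding branch_def by (auto intro: path_component_trans)
qed

lemma path_connected_branch: "path_connected (branch Y a)"
  unfolding branch_def by (rule path_connected_path_component)

lemma open_cell_arc_in_branch:
  assumes "simply_connected Y" "open_cell Y a" "0 < t" "t \<le> 1"
  shows "a t \<in> branch Y a"
proof (rule mem_branchI)
  let ?T = "a ` {min t (1/2)..1}"
  show "path_connected ?T"
    by (rule path_connected_arc_image[OF open_cellD(2)[OF assms(2)]]) (use assms in auto)
  show "?T \<subseteq> Y - {a 0}"
  proof
    fix y assume "y \<in> ?T"
    then obtain s where "s \<in> {min t (1/2)..1}" "y = a s" by (elim imageE)
    then have s: "s \<in> {0..1}" "s \<noteq> 0" "y = a s" using assms(3) by auto
    then show "y \<in> Y - {a 0}"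
      using open_cell_eq_iff[OF assms(1,2), of s 0] open_cellD(3)[OF assms(2)] by auto
  qed
qed (use assms in auto)

text \<open>Two cells leaving the same point start different branches: a connection of them that misses the
  point stays away from a short initial piece of the first cell, and going back along the second
  cell closes that piece up.\<close>

lemma branch_disjoint:
  assumes sc: "simply_connected Y" and a: "open_cell Y a" and b: "open_cell Y b"
    and start: "a 0 = b 0" and disj: "a ` {0<..<1} \<inter> b ` {0<..<1} = {}"
  shows "branch Y a \<inter> branch Y b = {}"
proof (rule ccontr)
  note ca = open_cellD[OF a] and cb = open_cellD[OF b]
  assume "branch Y a \<inter> branch Y b \<noteq> {}"
  then have "path_component (Y - {a 0}) (a (1/2)) (b (1/2))"
    unfolding branch_def start by (auto intro: path_component_trans path_component_sym)
  then obtain g where g: "path g" "path_image g \<subseteq> Y - {a 0}" "pathstart g = a (1/2)" "pathfinish g = b (1/2)"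
    unfolding path_component_def by blast
  have "closed (path_image g)" using g(1) by (intro compact_imp_closed compact_path_image)
  then have "open (- path_image g)" by auto
  moreover have "a 0 \<in> - path_image g" using g(2) by auto
  ultimately obtain e where e: "0 < e" "ball (a 0) e \<subseteq> - path_image g"
    using open_contains_ball by blast
  obtain d where d: "0 < d" "\<And>t. t \<in> {0..1} \<Longrightarrow> dist t 0 < d \<Longrightarrow> dist (a t) (a 0) < e"
    using ca(2)[unfolded continuous_on_iff, rule_format, of 0 e] e(1) by auto
  define h where "h = min d (1/2) / 2"
  have h: "0 < h" "h < d" "h < 1/2" using d(1) by (auto simp: h_def min_def)
  have av: "a t \<notin> path_image g" if "t \<in> {0..h}" for t
  proof -
    have "dist (a t) (a 0) < e" using that h by (intro d) auto
    then show ?thesis using e(2) by (auto simp: dist_commute subset_iff)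
  qed
  have cell': "open_cell Y (subarc 0 h a)" using h by (intro open_cell_subarc[OF a]) auto
  have im: "subarc 0 h a ` {0<..<1} = a ` {0<..<h}" using h by (intro subarc_image) auto
  define T where "T = (a ` {h..1/2} \<union> path_image g) \<union> b ` {0..1/2}"
  have "path_connected T"
    unfolding T_def
  proof (intro path_connected_Un path_connected_arc_image ca cb path_connected_path_image g)
    have "a (1/2) \<in> path_image g" "a (1/2) \<in> a ` {h..1/2}"
      using pathstart_in_path_image[of g] g(3) h by auto
    then show "a ` {h..1/2} \<inter> path_image g \<noteq> {}" by blast
    have "b (1/2) \<in> path_image g" "b (1/2) \<in> b ` {0..1/2}"
      using pathfinish_in_path_image[of g] g(4) h by auto
    then show "(a ` {h..1/2} \<union> path_image g) \<inter> b ` {0..1/2} \<noteq> {}" by blast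
  qed (use h in auto)
  moreover have "T \<subseteq> Y - a ` {0<..<h}"
  proof
    fix y assume "y \<in> T"
    then consider "y \<in> path_image g" | t where "t \<in> {h..1/2}" "y = a t" | t where "t \<in> {0..1/2}" "y = b t"
      unfolding T_def by blast
    then show "y \<in> Y - a ` {0<..<h}"
    proof cases
      case 1
      then show ?thesis using g(2) av by fastforce
    next
      case 2
      have "y \<notin> a ` {0<..<h}"
      proof
        assume "y \<in> a ` {0<..<h}"
        then obtain u where u: "u \<in> {0<..<h}" "y = a u" by blast
        have "u = t" by (rule open_cell_eqD[OF a]) (use u 2 h in auto)
        then show False using u 2 by simp
      qed
      then show ?thesis using ca(3)[of t] 2 h by auto
    next
      case 3
      have "y \<notin> a ` {0<..<1}"
      proof (cases "t = 0")
        case False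
        then have "y \<in> b ` {0<..<1}" using 3 by auto
        then show ?thesis using disj by blast
      qed (use 3 ca(7) start in simp)
      then show ?thesis using cb(3)[of t] 3 h by auto
    qed
  qed
  moreover have "a h \<in> T" using h by (auto simp: T_def)
  moreover have "a 0 \<in> T" unfolding start by (auto simp: T_def)
  ultimately have "path_component (Y - a ` {0<..<h}) (a h) (a 0)"
    by (rule path_component_joinI)
  then show False using open_cell_bridge[OF sc cell'] im by simp
qed

text \<open>The branches at the two ends of a cell, both taken in the direction of the cell, share only the cell:
  from a common point outside, both ends of the cell could be reached without entering it.\<close>

lemma branch_reverse_Int:
  assumes sc: "simply_connected Y" and a: "open_cell Y a"
    and y: "y \<in> branch Y a" "y \<in> branch Y (reversepath a)"
  shows "y \<in> a ` {0<..<1}"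
proof (rule ccontr)
  assume ny: "y \<notin> a ` {0<..<1}"
  let ?A = "a ` {0<..<1}"
  note c = open_cellD[OF a]
  have K: "closed (path_image a)" using c(1) by (intro compact_imp_closed compact_path_image)
  \<comment> \<open>A path from the cell to a point outside leaves the closed cell through one of its ends.\<close>
  have exit: "\<exists>z\<in>{a 0, a 1} - {v}. path_component (Y - ?A) z y"
    if pc: "path_component (Y - {v}) (a (1/2)) y" for v
  proof -
    obtain g where g: "path g" "path_image g \<subseteq> Y - {v}" "pathstart g = a (1/2)" "pathfinish g = y"
      using pc unfolding path_component_def by blast
    have contg: "continuous_on {0..1} g" using g(1) by (simp add: path_def)
    have gY: "g s \<in> Y - {v}" if "s \<in> {0..1}" for s using g(2) that unfolding path_image_def by blast
    have "g 0 \<in> path_image a" using g(3) by (auto simp: pathstart_def path_image_def)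
    then obtain t where t: "t \<in> {0..1}" "g t \<in> path_image a"
      and max: "\<And>s. t < s \<Longrightarrow> s \<le> 1 \<Longrightarrow> g s \<notin> path_image a"
      using last_time_in[OF contg K] by metis
    have gt: "g t \<notin> ?A"
    proof
      assume "g t \<in> ?A"
      then have "t \<noteq> 1" using ny g(4) by (auto simp: pathfinish_def)
      obtain O' where O': "open O'" "?A = Y \<inter> O'" using c(6) by (auto simp: openin_open)
      have "g t \<in> O'" using \<open>g t \<in> ?A\<close> O' by auto
      then obtain e where e: "0 < e" "ball (g t) e \<subseteq> O'" using O'(1) open_contains_ball by blast
      obtain d where d: "0 < d" "\<And>s. s \<in> {0..1} \<Longrightarrow> dist s t < d \<Longrightarrow> dist (g s) (g t) < e"
        using contg[unfolded continuous_on_iff, rule_format, of t e] e(1) t(1) by auto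
      define s where "s = min 1 (t + d/2)"
      have s: "s \<in> {0..1}" "t < s" "dist s t < d"
        using d(1) t(1) \<open>t \<noteq> 1\<close> by (auto simp: s_def dist_real_def min_def)
      have "dist (g s) (g t) < e" by (rule d(2)[OF s(1,3)])
      then have "g s \<in> O'" using e(2) by (auto simp: dist_commute subset_iff)
      moreover have "g s \<in> Y" using gY[OF s(1)] by simp
      ultimately have "g s \<in> ?A" using O'(2) by blast
      then show False using max[OF s(2)] s(1) by (auto simp: path_image_def)
    qed
    have "path_component (Y - ?A) (g t) y"
    proof (rule path_component_joinI)
      show "path_connected (g ` {t..1})"
        by (rule path_connected_arc_image[OF contg]) (use t in auto)
      show "g ` {t..1} \<subseteq> Y - ?A"
      proof
        fix z assume "z \<in> g ` {t..1}"
        then obtain s where s: "t \<le> s" "s \<le> 1" "z = g s" by auto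
        have "z \<notin> ?A"
          using max[of s] gt s by (cases "s = t") (auto simp: path_image_def)
        moreover have "z \<in> Y" using gY[of s] s t by simp
        ultimately show "z \<in> Y - ?A" by blast
      qed
      show "y \<in> g ` {t..1}" using g(4) t(1) by (auto simp: pathfinish_def)
    qed (use t in auto)
    moreover have "g t \<in> {a 0, a 1}"
    proof -
      obtain u where u: "u \<in> {0..1}" "g t = a u" using t(2) by (auto simp: path_image_def)
      then have "u \<notin> {0<..<1}" using gt by auto
      then have "u = 0 \<or> u = 1" using u(1) by auto
      then show ?thesis using u by auto
    qed
    moreover have "g t \<noteq> v" using gY[OF t(1)] by simp
    ultimately show ?thesis by blast
  qed
  have half: "reversepath a (1/2) = a (1/2)" "reversepath a 0 = a 1" by (simp_all add: reversepath_def)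
  have "path_component (Y - ?A) (a 1) y" using exit[of "a 0"] y(1) by (auto simp: branch_def)
  moreover have "path_component (Y - ?A) (a 0) y" using exit[of "a 1"] y(2) half by (auto simp: branch_def)
  ultimately have "path_component (Y - ?A) (a 1) (a 0)"
    by (metis path_component_sym path_component_trans)
  then show False using open_cell_bridge[OF sc a] by simp
qed

text \<open>Seen from the end \<open>a 1\<close>, the cell \<open>a\<close> belongs to the branch that leads back to \<open>a 0\<close>, and this
  branch is disjoint from the branch that \<open>b\<close> starts.\<close>

lemma branch_nested:
  assumes sc: "simply_connected Y" and a: "open_cell Y a" and b: "open_cell Y b"
    and start: "b 0 = a 1" and disj: "a ` {0<..<1} \<inter> b ` {0<..<1} = {}"
  shows "branch Y b \<subseteq> branch Y a" "branch Y b \<inter> a ` {0..1} = {}"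
proof -
  note ca = open_cellD[OF a] and cb = open_cellD[OF b]
  have r: "open_cell Y (reversepath a)" by (rule open_cell_reversepath[OF a])
  have dis: "branch Y (reversepath a) \<inter> branch Y b = {}"
    by (rule branch_disjoint[OF sc r b]) (use start disj reversepath_image[of a] in \<open>auto simp: reversepath_def[of a]\<close>)
  have mem: "a t \<in> branch Y (reversepath a)" if "0 \<le> t" "t < 1" for t
    using open_cell_arc_in_branch[OF sc r, of "1 - t"] that by (simp add: reversepath_def)
  show avoid: "branch Y b \<inter> a ` {0..1} = {}"
  proof -
    have "a t \<notin> branch Y b" if "t \<in> {0..1}" for t
      using that mem[of t] dis branch_subset[of Y b] start by (cases "t = 1") auto
    then show ?thesis by blast
  qed
  define T where "T = (a ` {1/2..1} \<union> b ` {0..1/2}) \<union> branch Y b"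
  have pc: "path_connected T"
    unfolding T_def
  proof (intro path_connected_Un path_connected_arc_image ca cb path_connected_branch)
    have "a 1 \<in> a ` {1/2..1}" "a 1 \<in> b ` {0..1/2}" using start by (auto intro!: image_eqI[of _ _ 0])
    then show "a ` {1/2..1} \<inter> b ` {0..1/2} \<noteq> {}" by blast
    have "b (1/2) \<in> b ` {0..1/2}" "b (1/2) \<in> branch Y b"
      using open_cell_arc_in_branch[OF sc b, of "1/2"] by auto
    then show "(a ` {1/2..1} \<union> b ` {0..1/2}) \<inter> branch Y b \<noteq> {}" by blast
  qed auto
  have sub: "T \<subseteq> Y - {a 0}"
  proof
    fix y assume "y \<in> T"
    then consider t where "t \<in> {1/2..1}" "y = a t" | t where "t \<in> {0..1/2}" "y = b t" | "y \<in> branch Y b"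
      unfolding T_def by blast
    then show "y \<in> Y - {a 0}"
    proof cases
      case 1
      then show ?thesis using open_cell_eq_iff[OF sc a, of t 0] ca(3) by auto
    next
      case 2
      have "y \<noteq> a 0"
      proof (cases "t = 0")
        case True
        then show ?thesis using 2 start open_cell_ends_neq[OF sc a] by simp
      next
        case False
        then have "b t \<in> branch Y b" using 2 by (intro open_cell_arc_in_branch[OF sc b]) auto
        moreover have "a 0 \<notin> branch Y b" using avoid by auto
        ultimately show ?thesis using 2 by metis
      qed
      then show ?thesis using 2 cb(3)[of t] by auto
    next
      case 3
      moreover have "a 0 \<notin> branch Y b" using avoid by auto
      ultimately show ?thesis using branch_subset[of Y b] by auto
    qed
  qed
  show "branch Y b \<subseteq> branch Y a"
  proof
    fix y assume "y \<in> branch Y b"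
    show "y \<in> branch Y a"
      by (rule mem_branchI[where a = a, OF pc sub]) (use \<open>y \<in> branch Y b\<close> in \<open>auto simp: T_def\<close>)
  qed
qed

section \<open>Path lifting in metric covering spaces\<close>

text \<open>The parameters at which two lifts agree form a set that is closed, and that is open since the
  projection is locally injective.\<close>

lemma covering_lift_unique:
  fixes Y :: "'b::metric_space set" and X :: "'a::metric_space set" and f g :: "real \<Rightarrow> 'b"
  assumes cov: "covering_space Y p X" and T: "connected T" "t0 \<in> T" "t \<in> T"
    and f: "continuous_on T f" "\<And>t. t \<in> T \<Longrightarrow> f t \<in> Y"
    and g: "continuous_on T g" "\<And>t. t \<in> T \<Longrightarrow> g t \<in> Y"
    and eq: "\<And>t. t \<in> T \<Longrightarrow> p (f t) = p (g t)" and start: "f t0 = g t0"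
  shows "f t = g t"
proof -
  define Q where "Q = {t \<in> T. dist (f t) (g t) = 0}"
  have "closedin (top_of_set T) Q"
    unfolding Q_def by (intro continuous_closedin_preimage_constant continuous_intros f g)
  moreover have "openin (top_of_set T) Q"
  proof (subst openin_subopen, intro ballI)
    fix s assume s: "s \<in> Q"
    then have "f s \<in> Y" using f(2)[of s] by (simp add: Q_def)
    then obtain N U q where N: "f s \<in> N" "openin (top_of_set Y) N" "homeomorphism N U p q"
      by (rule covering_space_local_homeomorphism[OF cov])
    have inj: "x = y" if "x \<in> N" "y \<in> N" "p x = p y" for x y
      using N(3) that unfolding homeomorphism_def by metis
    have "openin (top_of_set T) (T \<inter> f -` N \<inter> (T \<inter> g -` N))"
      by (intro openin_Int continuous_openin_preimage[where T = Y] f(1) g(1) N(2)) (use f(2) g(2) in auto)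
    moreover have "s \<in> T \<inter> f -` N \<inter> (T \<inter> g -` N)" using s N(1) by (auto simp: Q_def)
    moreover have "T \<inter> f -` N \<inter> (T \<inter> g -` N) \<subseteq> Q" using inj eq by (auto simp: Q_def)
    ultimately show "\<exists>S. openin (top_of_set T) S \<and> s \<in> S \<and> S \<subseteq> Q" by blast
  qed
  moreover have "Q \<noteq> {}" using T(2) start by (auto simp: Q_def)
  ultimately have "Q = T" using T(1) unfolding connected_clopen by blast
  then show ?thesis using T(3) by (auto simp: Q_def)
qed

text \<open>Over a short parameter interval the path stays in an evenly covered set, and a local inverse of the
  projection lifts it. Lifts over adjacent intervals fit together once the second one starts where the
  first one ends, which is why the induction is over all starting points at once.\<close>

lemma covering_lift_path:
  fixes Y :: "'b::metric_space set" and X :: "'a::metric_space set" and g :: "real \<Rightarrow> 'a"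
  assumes cov: "covering_space Y p X" and g: "path g" "path_image g \<subseteq> X" and y: "y \<in> Y" "p y = g 0"
  obtains h where "path h" "h 0 = y" "\<And>t. t \<in> {0..1} \<Longrightarrow> h t \<in> Y" "\<And>t. t \<in> {0..1} \<Longrightarrow> p (h t) = g t"
proof -
  have contg: "continuous_on {0..1} g" using g(1) by (simp add: path_def)
  define P where "P u v \<longleftrightarrow> (0 \<le> u \<and> v \<le> 1 \<longrightarrow> (\<forall>y\<in>Y. p y = g u \<longrightarrow>
    (\<exists>h. continuous_on {u..v} h \<and> h u = y \<and> (\<forall>t\<in>{u..v}. h t \<in> Y \<and> p (h t) = g t))))" for u v
  have "P 0 1"
  proof (rule Bolzano[of 0 1 P])
    fix u v w assume uv: "P u v" and vw: "P v w" and le: "u \<le> v" "v \<le> w"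
    show "P u w"
      unfolding P_def
    proof (intro impI ballI)
      fix y assume uw: "0 \<le> u \<and> w \<le> 1" and y: "y \<in> Y" "p y = g u"
      obtain h where h: "continuous_on {u..v} h" "h u = y" "\<forall>t\<in>{u..v}. h t \<in> Y \<and> p (h t) = g t"
        using uv uw le y unfolding P_def by (meson order_trans)
      have "h v \<in> Y" "p (h v) = g v" using h(3) le by auto
      then obtain k where k: "continuous_on {v..w} k" "k v = h v" "\<forall>t\<in>{v..w}. k t \<in> Y \<and> p (k t) = g t"
        using vw uw le unfolding P_def by (meson order_trans)
      have "continuous_on ({u..v} \<union> {v..w}) (\<lambda>t. if t \<le> v then h t else k t)"
        by (intro continuous_on_cases h(1) k(1)) (use k(2) in auto)
      moreover have "{u..v} \<union> {v..w} = {u..w}" using le by auto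
      ultimately show "\<exists>h. continuous_on {u..w} h \<and> h u = y \<and> (\<forall>t\<in>{u..w}. h t \<in> Y \<and> p (h t) = g t)"
        using h k le by (intro exI[of _ "\<lambda>t. if t \<le> v then h t else k t"]) auto
    qed
  next
    fix x :: real assume x: "0 \<le> x" "x \<le> 1"
    then have "g x \<in> X" using g(2) by (auto simp: path_image_def)
    then obtain T \<V> where T: "g x \<in> T" "openin (top_of_set X) T" "\<Union>\<V> = Y \<inter> p -` T"
      "\<And>S. S \<in> \<V> \<Longrightarrow> \<exists>q. homeomorphism S T p q"
      using cov unfolding covering_space_def by meson
    obtain O' where O': "open O'" "T = X \<inter> O'" using T(2) by (auto simp: openin_open)
    then obtain e where e: "0 < e" "ball (g x) e \<subseteq> O'" using T(1) open_contains_ball by blast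
    obtain d where d: "0 < d" "\<And>t. t \<in> {0..1} \<Longrightarrow> dist t x < d \<Longrightarrow> dist (g t) (g x) < e"
      using contg[unfolded continuous_on_iff, rule_format, of x e] e(1) x by auto
    have "P u v" if uv: "u \<le> x" "x \<le> v" "v - u < d" for u v
      unfolding P_def
    proof (intro impI ballI)
      fix y assume uv': "0 \<le> u \<and> v \<le> 1" and y: "y \<in> Y" "p y = g u"
      have gT: "g t \<in> T" if t: "t \<in> {u..v}" for t
      proof -
        have "dist (g t) (g x) < e" using t uv uv' by (intro d(2)) (auto simp: dist_real_def)
        then have "g t \<in> O'" using e(2) by (auto simp: dist_commute subset_iff)
        moreover have "g t \<in> X" using g(2) t uv' by (auto simp: path_image_def)
        ultimately show ?thesis using O'(2) by blast
      qed
      have "y \<in> \<Union>\<V>" using T(3) y gT[of u] uv by auto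
      then obtain S q where S: "y \<in> S" "S \<in> \<V>" "homeomorphism S T p q" using T(4) by blast
      have SY: "S \<subseteq> Y" using T(3) S(2) by blast
      have "continuous_on {u..v} (q \<circ> g)"
      proof (rule continuous_on_compose)
        show "continuous_on {u..v} g" by (rule continuous_on_subset[OF contg]) (use uv' in auto)
        show "continuous_on (g ` {u..v}) q"
          using S(3) gT by (auto simp: homeomorphism_def intro: continuous_on_subset)
      qed
      moreover have "(q \<circ> g) u = y" using S y by (auto simp: homeomorphism_def)
      moreover have "(q \<circ> g) t \<in> Y \<and> p ((q \<circ> g) t) = g t" if "t \<in> {u..v}" for t
        using S(3) gT[OF that] SY by (auto simp: homeomorphism_def)
      ultimately show "\<exists>h. continuous_on {u..v} h \<and> h u = y \<and> (\<forall>t\<in>{u..v}. h t \<in> Y \<and> p (h t) = g t)"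
        by (intro exI[of _ "q \<circ> g"]) blast
    qed
    then show "\<exists>d>0. \<forall>u v. u \<le> x \<and> x \<le> v \<and> v - u < d \<longrightarrow> P u v" using d(1) by blast
  qed simp
  then obtain h where "continuous_on {0..1} h" "h 0 = y" "\<forall>t\<in>{0..1}. h t \<in> Y \<and> p (h t) = g t"
    using y unfolding P_def by auto
  then show ?thesis by (intro that[of h]) (auto simp: path_def)
qed

section \<open>Geometry of a simply connected metric cover\<close>

locale metric_cover =
  fixes Y :: "'b::metric_space set" and p :: "'b \<Rightarrow> 'a::metric_space" and X :: "'a set"
  assumes universal: "metric_universal_cover Y p X"
begin

lemma covering: "covering_space Y p X" and simply_conn: "simply_connected Y"
  using universal by (simp_all add: metric_universal_cover_def)

lemma proj_continuous: "continuous_on Y p"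
  by (rule covering_space_imp_continuous[OF covering])

lemma proj_in: "y \<in> Y \<Longrightarrow> p y \<in> X"
  using covering_space_imp_surjective[OF covering] by blast

lemma dist_eq_INF:
  assumes "x \<in> Y" "y \<in> Y"
  shows "ennreal (dist x y) =
        (INF g\<in>{g. path g \<and> path_image g \<subseteq> Y \<and> pathstart g = x \<and> pathfinish g = y}. curve_length (p \<circ> g))"
  using universal assms by (simp add: metric_universal_cover_def)

lemma dist_greatest:
  assumes "x \<in> Y" "y \<in> Y"
    and "\<And>g. path g \<Longrightarrow> path_image g \<subseteq> Y \<Longrightarrow> g 0 = x \<Longrightarrow> g 1 = y \<Longrightarrow> c \<le> curve_length_on (p \<circ> g) 0 1"
  shows "c \<le> ennreal (dist x y)"
  unfolding dist_eq_INF[OF assms(1,2)] curve_length_eq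
  by (rule INF_greatest) (use assms(3) in \<open>auto simp: pathstart_def pathfinish_def\<close>)

lemma dist_le_curve_length_on_proj:
  assumes h: "continuous_on {a..b} h" "\<And>t. t \<in> {a..b} \<Longrightarrow> h t \<in> Y" and "a \<le> b"
  shows "ennreal (dist (h a) (h b)) \<le> curve_length_on (p \<circ> h) a b"
proof (cases "a < b")
  case True
  have "path_image (subarc a b h) \<subseteq> Y"
    unfolding path_image_def subarc_image(2)[OF True] using h(2) by auto
  then have "ennreal (dist (h a) (h b)) \<le> curve_length (p \<circ> subarc a b h)"
    using h \<open>a \<le> b\<close> by (subst dist_eq_INF)
      (auto intro!: INF_lower simp: pathstart_def pathfinish_def path_subarc[OF h(1) True])
  also have "p \<circ> subarc a b h = subarc a b (p \<circ> h)" by (simp add: subarc_def comp_def)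
  also have "curve_length \<dots> \<le> curve_length_on (p \<circ> h) a b"
    by (rule curve_length_subarc_le) fact
  finally show ?thesis .
qed (use \<open>a \<le> b\<close> in simp)

lemma path_connected_cover: "path_connected Y"
proof -
  have "\<exists>g. path g \<and> path_image g \<subseteq> Y \<and> pathstart g = x \<and> pathfinish g = y" if "x \<in> Y" "y \<in> Y" for x y
  proof (rule ccontr)
    assume "\<not> ?thesis"
    then have empty: "{g. path g \<and> path_image g \<subseteq> Y \<and> pathstart g = x \<and> pathfinish g = y} = {}" by blast
    show False using dist_eq_INF[OF that] unfolding empty by simp
  qed
  then show ?thesis unfolding path_connected_def by blast
qed

text \<open>Lengths in the cover are lengths of projections. Injectivity of the projection on the open cell makes
  \<open>hausdorff1_open_arc\<close> applicable to it.\<close>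

definition arc_cell :: "(real \<Rightarrow> 'b) \<Rightarrow> bool" where
  "arc_cell a \<longleftrightarrow> open_cell Y a \<and> inj_on (p \<circ> a) {0<..<1}"

lemma arc_cellD:
  assumes "arc_cell a"
  shows "open_cell Y a" "inj_on (p \<circ> a) {0<..<1}" "continuous_on {0..1} a" "\<And>t. t \<in> {0..1} \<Longrightarrow> a t \<in> Y"
    "continuous_on {0..1} (p \<circ> a)"
proof -
  show o: "open_cell Y a" and "inj_on (p \<circ> a) {0<..<1}" using assms by (auto simp: arc_cell_def)
  show c: "continuous_on {0..1} a" and *: "\<And>t. t \<in> {0..1} \<Longrightarrow> a t \<in> Y" using open_cellD[OF o] by auto
  show "continuous_on {0..1} (p \<circ> a)"
    by (intro continuous_on_compose c continuous_on_subset[OF proj_continuous]) (use * in auto)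
qed

lemma arc_cell_subarc:
  assumes "arc_cell a" "0 \<le> s" "s < t" "t \<le> 1"
  shows "arc_cell (subarc s t a)"
  unfolding arc_cell_def
proof
  show "open_cell Y (subarc s t a)" by (intro open_cell_subarc arc_cellD(1) assms)
  show "inj_on (p \<circ> subarc s t a) {0<..<1}"
    using inj_on_subarc[OF arc_cellD(2)[OF assms(1)] assms(2-4)] by (simp add: subarc_def comp_def)
qed

lemma arc_cell_reversepath:
  assumes "arc_cell a"
  shows "arc_cell (reversepath a)"
  unfolding arc_cell_def
proof
  show "open_cell Y (reversepath a)" by (intro open_cell_reversepath arc_cellD(1) assms)
  show "inj_on (p \<circ> reversepath a) {0<..<1}"
    unfolding reversepath_def comp_def
    by (rule inj_onI, drule inj_onD[OF arc_cellD(2)[OF assms], unfolded comp_def]) auto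
qed

lemma arc_cell_length:
  assumes "arc_cell a" "0 \<le> s" "s \<le> t" "t \<le> 1"
  shows "curve_length_on (p \<circ> a) s t = hausdorff1 ((p \<circ> a) ` {s<..<t})"
  by (intro hausdorff1_open_arc continuous_on_subset[OF arc_cellD(5)[OF assms(1)]]
      inj_on_subset[OF arc_cellD(2)[OF assms(1)]]) (use assms in auto)

text \<open>By \<open>open_cell_crossing\<close> every path to \<open>a s\<close> runs over the whole arc up to that point, and so it is at
  least as long as the projection of the arc.\<close>

lemma arc_cell_dist:
  assumes a: "arc_cell a" and s: "s \<in> {0..1}"
  shows "ennreal (dist (a 0) (a s)) = curve_length_on (p \<circ> a) 0 s"
proof (rule antisym)
  show "ennreal (dist (a 0) (a s)) \<le> curve_length_on (p \<circ> a) 0 s"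
    by (rule dist_le_curve_length_on_proj)
       (use arc_cellD[OF a] s in \<open>auto intro: continuous_on_subset\<close>)
  show "curve_length_on (p \<circ> a) 0 s \<le> ennreal (dist (a 0) (a s))"
  proof (rule dist_greatest)
    fix g assume g: "path g" "path_image g \<subseteq> Y" "g 0 = a 0" "g 1 = a s"
    have "a ` {0<..<s} \<subseteq> path_image g"
      by (rule open_cell_crossing[OF simply_conn arc_cellD(1)[OF a] s])
         (use g in \<open>auto simp: pathstart_def pathfinish_def\<close>)
    then have "(p \<circ> a) ` {0<..<s} \<subseteq> path_image (p \<circ> g)"
      unfolding path_image_compose by auto
    then have "hausdorff1 ((p \<circ> a) ` {0<..<s}) \<le> hausdorff1 (path_image (p \<circ> g))"
      by (rule hausdorff1_mono)
    also have "\<dots> \<le> curve_length (p \<circ> g)"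
      by (intro hausdorff1_path_image_le path_continuous_image g continuous_on_subset[OF proj_continuous])
    finally show "curve_length_on (p \<circ> a) 0 s \<le> curve_length_on (p \<circ> g) 0 1"
      using arc_cell_length[OF a, of 0 s] s by (simp add: curve_length_eq)
  qed (use arc_cellD(4)[OF a] s in auto)
qed

text \<open>Superadditivity of the curve length and the triangle inequality squeeze the three distances into an
  equation.\<close>

lemma arc_cell_geodesic:
  assumes a: "arc_cell a" and st: "0 \<le> s" "s \<le> t" "t \<le> 1"
  shows "dist (a 0) (a t) = dist (a 0) (a s) + dist (a s) (a t)"
proof (rule antisym)
  show "dist (a 0) (a t) \<le> dist (a 0) (a s) + dist (a s) (a t)" by (rule dist_triangle)
  have "ennreal (dist (a s) (a t)) \<le> curve_length_on (p \<circ> a) s t"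
    by (rule dist_le_curve_length_on_proj)
       (use arc_cellD[OF a] st in \<open>auto intro: continuous_on_subset\<close>)
  then have "ennreal (dist (a 0) (a s)) + ennreal (dist (a s) (a t))
      \<le> curve_length_on (p \<circ> a) 0 s + curve_length_on (p \<circ> a) s t"
    using arc_cell_dist[OF a, of s] st by (intro add_mono) auto
  also have "\<dots> \<le> curve_length_on (p \<circ> a) 0 t" by (rule curve_length_on_add) (use st in auto)
  also have "\<dots> = ennreal (dist (a 0) (a t))" using arc_cell_dist[OF a, of t] st by simp
  finally show "dist (a 0) (a s) + dist (a s) (a t) \<le> dist (a 0) (a t)"
    by (simp add: ennreal_plus[symmetric] del: ennreal_plus)
qed

lemma arc_cell_dist_less:
  assumes a: "arc_cell a" and st: "0 \<le> s" "s < t" "t \<le> 1"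
  shows "dist (a 0) (a s) < dist (a 0) (a t)"
proof -
  have "a s \<noteq> a t" using open_cell_eq_iff[OF simply_conn arc_cellD(1)[OF a], of s t] st by auto
  then show ?thesis using arc_cell_geodesic[OF a, of s t] st by simp
qed

text \<open>On a geodesic the distance from the initial point is an isometry onto a subset of an interval.\<close>

lemma hausdorff1_arc_cell_ball:
  assumes a: "arc_cell a" and R: "0 \<le> R"
  shows "hausdorff1 (a ` {0<..<1} \<inter> ball (a 0) R) \<le> ennreal (min R (dist (a 0) (a 1)))"
proof -
  define S where "S = a ` {0<..<1} \<inter> ball (a 0) R"
  define f where "f = inv_into S (dist (a 0))"
  have geo: "dist y z \<le> dist (dist (a 0) y) (dist (a 0) z)" if yz: "y \<in> S" "z \<in> S" for y z
  proof -
    obtain s t where st: "s \<in> {0<..<1}" "t \<in> {0<..<1}" "y = a s" "z = a t"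
      using yz unfolding S_def by blast
    show ?thesis
    proof (cases "s \<le> t")
      case True
      then show ?thesis using arc_cell_geodesic[OF a, of s t] st by (simp add: dist_real_def)
    next
      case False
      then show ?thesis using arc_cell_geodesic[OF a, of t s] st by (simp add: dist_real_def dist_commute)
    qed
  qed
  have inj: "inj_on (dist (a 0)) S" by (rule inj_onI) (use geo in force)
  have "S = f ` (dist (a 0) ` S)" using inj by (auto simp: f_def image_iff)
  then have "hausdorff1 S \<le> hausdorff1 (f ` (dist (a 0) ` S))" by simp
  also have "\<dots> \<le> hausdorff1 (dist (a 0) ` S)"
    by (rule hausdorff1_lipschitz_image) (use inj geo in \<open>auto simp: f_def\<close>)
  also have "\<dots> \<le> hausdorff1 {0..min R (dist (a 0) (a 1))}"
  proof (rule hausdorff1_mono, clarify)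
    fix y assume y: "y \<in> S"
    then obtain s where "s \<in> {0<..<1}" "y = a s" by (auto simp: S_def)
    then have "dist (a 0) y \<le> dist (a 0) (a 1)" using arc_cell_dist_less[OF a, of s 1] by simp
    moreover have "dist (a 0) y < R" using y by (simp add: S_def)
    ultimately show "dist (a 0) y \<in> {0..min R (dist (a 0) (a 1))}" by simp
  qed
  also have "\<dots> \<le> ennreal (min R (dist (a 0) (a 1)))"
    by (rule hausdorff1_real_interval_le) (use R in simp)
  finally show ?thesis by (simp add: S_def)
qed

lemma inner_hausdorff1_arc_cell:
  assumes a: "arc_cell a" and s: "s \<in> {0..1}"
  shows "ennreal (dist (a 0) (a s)) \<le> inner_hausdorff1 (a ` {0<..<s})"
  by (rule dist_le_inner_hausdorff1_arc) (use arc_cellD(3)[OF a] s in \<open>auto intro: continuous_on_subset\<close>)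

lemma arc_cell_subset_ball:
  assumes a: "arc_cell a" and s: "s \<in> {0..1}" and "dist (a 0) (a s) \<le> R"
  shows "a ` {0<..<s} \<subseteq> branch Y a \<inter> ball (a 0) R"
proof
  fix y assume "y \<in> a ` {0<..<s}"
  then obtain t where t: "0 < t" "t < s" "y = a t" by auto
  then have "dist (a 0) y < R" using arc_cell_dist_less[OF a, of t s] s assms(3) by simp
  moreover have "y \<in> branch Y a"
    using open_cell_arc_in_branch[OF simply_conn arc_cellD(1)[OF a], of t] t s by simp
  ultimately show "y \<in> branch Y a \<inter> ball (a 0) R" by simp
qed

text \<open>If the ball does not reach beyond the first cell, then the part of the cell up to distance \<open>R\<close> has
  the required length.\<close>

lemma branch_ball_ge_short:
  assumes a: "arc_cell a" and R: "0 \<le> R" "R \<le> dist (a 0) (a 1)"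
  shows "ennreal R \<le> inner_hausdorff1 (branch Y a \<inter> ball (a 0) R)"
proof -
  have "\<exists>s\<ge>0. s \<le> 1 \<and> dist (a 0) (a s) = R"
    by (rule IVT') (use R arc_cellD(3)[OF a] in \<open>auto intro!: continuous_intros\<close>)
  then obtain s where s: "s \<in> {0..1}" "dist (a 0) (a s) = R" by auto
  have "ennreal R \<le> inner_hausdorff1 (a ` {0<..<s})" using inner_hausdorff1_arc_cell[OF a s(1)] s(2) by simp
  also have "\<dots> \<le> inner_hausdorff1 (branch Y a \<inter> ball (a 0) R)"
    by (intro inner_hausdorff1_mono arc_cell_subset_ball[OF a s(1)]) (use s(2) in simp)
  finally show ?thesis .
qed

text \<open>The cell and the branches that continue it are pairwise disjoint parts of the branch, and beyond the
  cell the remaining radius is smaller by the length of the cell.\<close>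

lemma branch_ball_ge_step:
  assumes a: "arc_cell a" and R: "dist (a 0) (a 1) \<le> R" and I: "finite I"
    and b: "\<And>i. i \<in> I \<Longrightarrow> arc_cell (b i)" "\<And>i. i \<in> I \<Longrightarrow> b i 0 = a 1"
      "\<And>i. i \<in> I \<Longrightarrow> a ` {0<..<1} \<inter> b i ` {0<..<1} = {}"
      "disjoint_family_on (\<lambda>i. b i ` {0<..<1}) I"
  shows "ennreal (dist (a 0) (a 1)) +
      (\<Sum>i\<in>I. inner_hausdorff1 (branch Y (b i) \<inter> ball (a 1) (R - dist (a 0) (a 1))))
    \<le> inner_hausdorff1 (branch Y a \<inter> ball (a 0) R)"
proof -
  note oa = arc_cellD(1)[OF a]
  let ?B = "\<lambda>i. branch Y (b i) \<inter> ball (a 1) (R - dist (a 0) (a 1))"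
  have nest: "branch Y (b i) \<subseteq> branch Y a" "branch Y (b i) \<inter> a ` {0..1} = {}" if "i \<in> I" for i
    using branch_nested[OF simply_conn oa arc_cellD(1)[OF b(1)] b(2,3)] that by auto
  have disj: "disjoint_family_on ?B I"
    unfolding disjoint_family_on_def
  proof (intro ballI impI)
    fix i j assume ij: "i \<in> I" "j \<in> I" "i \<noteq> j"
    have "branch Y (b i) \<inter> branch Y (b j) = {}"
      by (rule branch_disjoint[OF simply_conn arc_cellD(1)[OF b(1)] arc_cellD(1)[OF b(1)]])
         (use ij b(2) b(4) in \<open>auto simp: disjoint_family_on_def\<close>)
    then show "?B i \<inter> ?B j = {}" by blast
  qed
  have "ennreal (dist (a 0) (a 1)) + (\<Sum>i\<in>I. inner_hausdorff1 (?B i))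
      \<le> inner_hausdorff1 (a ` {0<..<1}) + inner_hausdorff1 (\<Union>i\<in>I. ?B i)"
    by (intro add_mono inner_hausdorff1_arc_cell[OF a] inner_hausdorff1_UN I disj) simp
  also have "\<dots> \<le> inner_hausdorff1 (a ` {0<..<1} \<union> (\<Union>i\<in>I. ?B i))"
  proof (rule inner_hausdorff1_Un)
    have "a ` {0<..<1} \<subseteq> a ` {0..1}" by auto
    then show "a ` {0<..<1} \<inter> (\<Union>i\<in>I. ?B i) = {}" using nest(2) by auto
  qed
  also have "\<dots> \<le> inner_hausdorff1 (branch Y a \<inter> ball (a 0) R)"
  proof (intro inner_hausdorff1_mono Un_least UN_least)
    show "a ` {0<..<1} \<subseteq> branch Y a \<inter> ball (a 0) R"
      by (rule arc_cell_subset_ball[OF a]) (use R in auto)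
    fix i assume i: "i \<in> I"
    show "?B i \<subseteq> branch Y a \<inter> ball (a 0) R"
    proof
      fix y assume y: "y \<in> ?B i"
      then have "dist (a 0) y < R" using dist_triangle[of "a 0" y "a 1"] by auto
      then show "y \<in> branch Y a \<inter> ball (a 0) R" using y nest(1)[OF i] by auto
    qed
  qed
  finally show ?thesis .
qed

text \<open>Every path into a branch passes through the point where the branch is attached.\<close>

lemma dist_into_branch:
  assumes v: "v \<in> Y" "v \<notin> branch Y b" and b: "open_cell Y b" and y: "y \<in> branch Y b"
  shows "dist v y = dist v (b 0) + dist (b 0) y"
proof (rule antisym)
  show "dist v y \<le> dist v (b 0) + dist (b 0) y" by (rule dist_triangle)
  have yY: "y \<in> Y" using y branch_subset by blast
  have "ennreal (dist v (b 0) + dist (b 0) y) \<le> ennreal (dist v y)"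
  proof (rule dist_greatest[OF v(1) yY])
    fix g assume g: "path g" "path_image g \<subseteq> Y" "g 0 = v" "g 1 = y"
    have "b 0 \<in> path_image g"
    proof (rule ccontr)
      assume "b 0 \<notin> path_image g"
      then have "path_image g \<subseteq> Y - {b 0}" using g(2) by blast
      moreover have "y \<in> path_image g" using g(4) by (auto simp: path_image_def)
      ultimately have "path_image g \<subseteq> branch Y b"
        using y by (intro branch_absorb[of _ _ _ y] path_connected_path_image g(1))
      moreover have "v \<in> path_image g" using g(3) by (auto simp: path_image_def)
      ultimately show False using v(2) by blast
    qed
    then obtain t where t: "t \<in> {0..1}" "g t = b 0" by (auto simp: path_image_def)
    have c: "continuous_on {0..1} g" "\<And>s. s \<in> {0..1} \<Longrightarrow> g s \<in> Y"
      using g(1,2) by (auto simp: path_def path_image_def)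
    have "ennreal (dist (g 0) (g t)) + ennreal (dist (g t) (g 1))
        \<le> curve_length_on (p \<circ> g) 0 t + curve_length_on (p \<circ> g) t 1"
      by (intro add_mono dist_le_curve_length_on_proj)
         (use c t in \<open>auto intro: continuous_on_subset\<close>)
    also have "\<dots> \<le> curve_length_on (p \<circ> g) 0 1" by (rule curve_length_on_add) (use t in auto)
    finally show "ennreal (dist v (b 0) + dist (b 0) y) \<le> curve_length_on (p \<circ> g) 0 1"
      using g t by simp
  qed
  then show "dist v (b 0) + dist (b 0) y \<le> dist v y" by (simp del: ennreal_plus)
qed

end

section \<open>Darts of a graph and their lifts\<close>

text \<open>A dart is an edge with a direction, where \<open>True\<close> is the direction of the characteristic map. Loops
  have two different darts at their vertex.\<close>

definition dart_path :: "('e \<Rightarrow> real \<Rightarrow> 'a) \<Rightarrow> 'e \<times> bool \<Rightarrow> real \<Rightarrow> 'a::topological_space" where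
  "dart_path \<phi> x = (if snd x then \<phi> (fst x) else reversepath (\<phi> (fst x)))"

definition dart_rev :: "'e \<times> bool \<Rightarrow> 'e \<times> bool" where
  "dart_rev x = (fst x, \<not> snd x)"

lemma dart_rev_simps [simp]:
  "dart_rev (dart_rev x) = x" "fst (dart_rev x) = fst x" "dart_rev x \<noteq> x"
  "dart_rev x \<in> E \<times> UNIV \<longleftrightarrow> x \<in> E \<times> UNIV"
  by (cases x; simp add: dart_rev_def)+

lemma dart_eq_or_rev: "fst x = fst y \<Longrightarrow> x = y \<or> x = dart_rev y"
  by (cases x; cases y) (auto simp: dart_rev_def)

lemma dart_path_rev: "dart_path \<phi> (dart_rev x) = reversepath (dart_path \<phi> x)"
  by (simp add: dart_path_def dart_rev_def)

lemma dart_path_rev_apply: "dart_path \<phi> (dart_rev x) t = dart_path \<phi> x (1 - t)"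
  by (simp add: dart_path_rev reversepath_def)

lemma dart_path_image: "dart_path \<phi> x ` {0<..<1} = \<phi> (fst x) ` {0<..<1}"
  by (simp add: dart_path_def reversepath_image)

lemma cw_graphD:
  assumes "cw_graph X V E \<phi>"
  shows "finite V" "finite E" "V \<subseteq> X"
    and "\<And>e. e \<in> E \<Longrightarrow> path (\<phi> e)" "\<And>e. e \<in> E \<Longrightarrow> \<phi> e 0 \<in> V" "\<And>e. e \<in> E \<Longrightarrow> \<phi> e 1 \<in> V"
    and "\<And>e. e \<in> E \<Longrightarrow> inj_on (\<phi> e) {0<..<1}" "\<And>e. e \<in> E \<Longrightarrow> \<phi> e ` {0<..<1} \<inter> V = {}"
    and "disjoint_family_on (\<lambda>e. \<phi> e ` {0<..<1}) E" "X = V \<union> (\<Union>e\<in>E. path_image (\<phi> e))"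
  using assms unfolding cw_graph_def pathstart_def pathfinish_def by blast+

lemma dart_pathD:
  assumes cw: "cw_graph X V E \<phi>" and x: "x \<in> E \<times> UNIV"
  shows "path (dart_path \<phi> x)" "continuous_on {0..1} (dart_path \<phi> x)"
    and "path_image (dart_path \<phi> x) \<subseteq> X" "\<And>t. t \<in> {0..1} \<Longrightarrow> dart_path \<phi> x t \<in> X"
    and "inj_on (dart_path \<phi> x) {0<..<1}" "\<And>t. t \<in> {0<..<1} \<Longrightarrow> dart_path \<phi> x t \<notin> V"
    and "dart_path \<phi> x 0 \<in> V" "dart_path \<phi> x 1 \<in> V"
proof -
  have e: "fst x \<in> E" using x by auto
  note c = cw_graphD[OF cw]
  show p: "path (dart_path \<phi> x)" using c(4)[OF e] by (simp add: dart_path_def path_reversepath)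
  then show "continuous_on {0..1} (dart_path \<phi> x)" by (simp add: path_def)
  have "path_image (dart_path \<phi> x) = path_image (\<phi> (fst x))" by (simp add: dart_path_def)
  moreover have "path_image (\<phi> (fst x)) \<subseteq> X" by (subst c(10)) (use e in blast)
  ultimately show im: "path_image (dart_path \<phi> x) \<subseteq> X" by simp
  show "dart_path \<phi> x t \<in> X" if "t \<in> {0..1}" for t using im that unfolding path_image_def by blast
  show "inj_on (dart_path \<phi> x) {0<..<1}"
  proof (cases "snd x")
    case False
    have "inj_on (\<lambda>t. \<phi> (fst x) (1 - t)) {0<..<1}"
      by (rule inj_onI, drule inj_onD[OF c(7)[OF e]]) auto
    then show ?thesis using False by (simp add: dart_path_def reversepath_def)
  qed (use c(7)[OF e] in \<open>simp add: dart_path_def\<close>)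
  show "dart_path \<phi> x t \<notin> V" if "t \<in> {0<..<1}" for t
    using that c(8)[OF e] dart_path_image[of \<phi> x] by blast
  show "dart_path \<phi> x 0 \<in> V" "dart_path \<phi> x 1 \<in> V"
    using c(5,6)[OF e] by (simp_all add: dart_path_def reversepath_def)
qed

lemma dart_path_inner_eqD:
  assumes cw: "cw_graph X V E \<phi>" and x: "x \<in> E \<times> UNIV" "x' \<in> E \<times> UNIV"
    and t: "t \<in> {0<..<1}" "t' \<in> {0..1}" and eq: "dart_path \<phi> x t = dart_path \<phi> x' t'"
  shows "x' = x \<and> t' = t \<or> x' = dart_rev x \<and> t' = 1 - t"
proof -
  have t': "t' \<in> {0<..<1}"
  proof (rule ccontr)
    assume "t' \<notin> {0<..<1}"
    then have "t' = 0 \<or> t' = 1" using t(2) by auto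
    then show False
      using dart_pathD(7,8)[OF cw x(2)] dart_pathD(6)[OF cw x(1) t(1)] eq by auto
  qed
  have "fst x' = fst x"
  proof (rule ccontr)
    assume ne: "fst x' \<noteq> fst x"
    have "dart_path \<phi> x t \<in> \<phi> (fst x) ` {0<..<1}" "dart_path \<phi> x t \<in> \<phi> (fst x') ` {0<..<1}"
      using t(1) t' eq dart_path_image[of \<phi> x] dart_path_image[of \<phi> x'] by blast+
    moreover have "\<phi> (fst x) ` {0<..<1} \<inter> \<phi> (fst x') ` {0<..<1} = {}"
      by (rule disjoint_family_onD[OF cw_graphD(9)[OF cw]]) (use x ne[symmetric] in \<open>simp_all add: mem_Times_iff\<close>)
    ultimately show False by blast
  qed
  then consider "x' = x" | "x' = dart_rev x" using dart_eq_or_rev by blast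
  then show ?thesis
  proof cases
    case 1
    then show ?thesis using inj_onD[OF dart_pathD(5)[OF cw x(1)], of t t'] eq t(1) t' by auto
  next
    case 2
    then have "dart_path \<phi> x t = dart_path \<phi> x (1 - t')" using eq by (simp add: dart_path_rev_apply)
    then have "t = 1 - t'" using inj_onD[OF dart_pathD(5)[OF cw x(1)], of t "1 - t'"] t(1) t' by auto
    then show ?thesis using 2 by auto
  qed
qed

text \<open>The complement is a finite union of compact sets: the vertices, the other closed edges, and the rest of
  the closed edge itself.\<close>

lemma openin_dart_path_image:
  assumes cw: "cw_graph X V E \<phi>" and x: "x \<in> E \<times> UNIV" and J: "J \<subseteq> {0<..<1}" "open J"
  shows "openin (top_of_set X) (dart_path \<phi> x ` J)"
proof -
  note c = cw_graphD[OF cw]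
  define K where "K = V \<union> (\<Union>e\<in>E - {fst x}. path_image (\<phi> e)) \<union> dart_path \<phi> x ` ({0..1} - J)"
  have "compact ({0..1} - J)" using J(2) by (intro compact_diff) auto
  then have "compact (dart_path \<phi> x ` ({0..1} - J))"
    by (intro compact_continuous_image continuous_on_subset[OF dart_pathD(2)[OF cw x]]) auto
  then have "compact K"
    unfolding K_def using c(1,2,4)
    by (intro compact_Un compact_UN) (auto intro: finite_imp_compact)
  then have "openin (top_of_set X) (X \<inter> - K)"
    by (intro openin_open_Int open_Compl compact_imp_closed)
  moreover have "X \<inter> - K = dart_path \<phi> x ` J"
  proof (intro set_eqI iffI)
    fix z assume z: "z \<in> X \<inter> - K"
    then have "z \<notin> V" "z \<in> X" by (auto simp: K_def)
    then obtain e where e: "e \<in> E" "z \<in> path_image (\<phi> e)" using c(10) by blast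
    then have "e = fst x" using z by (auto simp: K_def)
    then have "z \<in> path_image (dart_path \<phi> x)" using e(2) by (simp add: dart_path_def)
    then obtain t where t: "t \<in> {0..1}" "z = dart_path \<phi> x t" by (auto simp: path_image_def)
    then have "t \<in> J" using z by (auto simp: K_def)
    then show "z \<in> dart_path \<phi> x ` J" using t(2) by blast
  next
    fix z assume "z \<in> dart_path \<phi> x ` J"
    then obtain t where t: "t \<in> J" "z = dart_path \<phi> x t" by blast
    have t01: "t \<in> {0<..<1}" using t(1) J(1) by blast
    have "z \<notin> V" using dart_pathD(6)[OF cw x t01] t(2) by simp
    moreover have "z \<notin> path_image (\<phi> e)" if e: "e \<in> E - {fst x}" for e
    proof
      assume "z \<in> path_image (\<phi> e)"
      then obtain t' where t': "t' \<in> {0..1}" "z = dart_path \<phi> (e, True) t'"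
        by (auto simp: path_image_def dart_path_def)
      have "(e, True) = x \<or> (e, True) = dart_rev x"
        using dart_path_inner_eqD[OF cw x _ t01 t'(1), of "(e, True)"] e t(2) t'(2) by auto
      then show False using e by (auto simp: dart_rev_def)
    qed
    moreover have "z \<notin> dart_path \<phi> x ` ({0..1} - J)"
    proof
      assume "z \<in> dart_path \<phi> x ` ({0..1} - J)"
      then obtain t' where t': "t' \<in> {0..1} - J" "z = dart_path \<phi> x t'" by blast
      have "t' = t"
        using dart_path_inner_eqD[OF cw x x t01, of t'] t(2) t' by (metis DiffD1 dart_rev_simps(3))
      then show False using t(1) t'(1) by simp
    qed
    moreover have "z \<in> X" using dart_pathD(4)[OF cw x, of t] t01 t(2) by auto
    ultimately show "z \<in> X \<inter> - K" by (simp add: K_def)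
  qed
  ultimately show ?thesis by simp
qed

locale graph_cover = metric_cover Y p X
  for Y :: "'b::metric_space set" and p :: "'b \<Rightarrow> 'a::metric_space" and X +
  fixes V :: "'a set" and E :: "'e set" and \<phi> :: "'e \<Rightarrow> real \<Rightarrow> 'a"
  assumes cw: "cw_graph X V E \<phi>"
begin

abbreviation "dpath \<equiv> dart_path \<phi>"

definition darts :: "('e \<times> bool) set" where "darts = E \<times> UNIV"

lemma darts_rev [simp]: "dart_rev x \<in> darts \<longleftrightarrow> x \<in> darts"
  unfolding darts_def by (rule dart_rev_simps)

lemmas dpathD = dart_pathD[OF cw, folded darts_def]
lemmas dpath_eqD = dart_path_inner_eqD[OF cw, folded darts_def]

definition lift :: "'b \<Rightarrow> 'e \<times> bool \<Rightarrow> real \<Rightarrow> 'b" where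
  "lift y x = (SOME h. path h \<and> h 0 = y \<and> (\<forall>t\<in>{0..1}. h t \<in> Y \<and> p (h t) = dpath x t))"

definition based :: "'b \<Rightarrow> 'e \<times> bool \<Rightarrow> bool" where
  "based y x \<longleftrightarrow> y \<in> Y \<and> x \<in> darts \<and> p y = dpath x 0"

lemma lift:
  assumes "based y x"
  shows "path (lift y x)" "continuous_on {0..1} (lift y x)" "lift y x 0 = y"
    "\<And>t. t \<in> {0..1} \<Longrightarrow> lift y x t \<in> Y" "\<And>t. t \<in> {0..1} \<Longrightarrow> p (lift y x t) = dpath x t"
proof -
  have "\<exists>h. path h \<and> h 0 = y \<and> (\<forall>t\<in>{0..1}. h t \<in> Y \<and> p (h t) = dpath x t)"
    using covering_lift_path[OF covering dpathD(1,3), of x y] assms unfolding based_def by metis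
  from someI_ex[OF this, folded lift_def]
  show "path (lift y x)" "continuous_on {0..1} (lift y x)" "lift y x 0 = y"
    "\<And>t. t \<in> {0..1} \<Longrightarrow> lift y x t \<in> Y" "\<And>t. t \<in> {0..1} \<Longrightarrow> p (lift y x t) = dpath x t"
    by (auto simp: path_def)
qed

lemma lift_unique:
  assumes b: "based y x" and h: "continuous_on {0..1} h"
    "\<And>t. t \<in> {0..1} \<Longrightarrow> h t \<in> Y" "\<And>t. t \<in> {0..1} \<Longrightarrow> p (h t) = dpath x t"
    and s: "s \<in> {0..1}" "h s = lift y x s" and t: "t \<in> {0..1}"
  shows "h t = lift y x t"
  by (rule covering_lift_unique[OF covering _ s(1) t h(1,2) lift(2,4)[OF b] _ s(2)])
     (use h(3) lift(5)[OF b] in auto)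

lemma lift_in_fibre:
  assumes "based y x"
  shows "p (lift y x 1) = dpath (dart_rev x) 0" "based (lift y x 1) (dart_rev x)"
  using lift(4,5)[OF assms, of 1] assms by (simp_all add: dart_path_rev_apply based_def)

text \<open>Both sides are lifts of the reversed dart with the same initial point.\<close>

lemma lift_rev:
  assumes b: "based y x" and t: "t \<in> {0..1}"
  shows "lift (lift y x 1) (dart_rev x) t = lift y x (1 - t)"
proof -
  note b' = lift_in_fibre(2)[OF b]
  have "lift y x (1 - t) = lift (lift y x 1) (dart_rev x) t"
  proof (rule lift_unique[OF b', where s = 0 and h = "\<lambda>t. lift y x (1 - t)"])
    show "continuous_on {0..1} (\<lambda>t. lift y x (1 - t))"
      by (intro continuous_on_compose2[OF lift(2)[OF b]] continuous_intros) auto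
    show "lift y x (1 - s) \<in> Y" "p (lift y x (1 - s)) = dpath (dart_rev x) s" if "s \<in> {0..1}" for s
      using lift(4,5)[OF b, of "1 - s"] that by (simp_all add: dart_path_rev_apply)
    show "lift y x (1 - 0) = lift (lift y x 1) (dart_rev x) 0" using lift(3)[OF b'] by simp
  qed (use t in auto)
  then show ?thesis by simp
qed

lemma branch_cong: "a 0 = b 0 \<Longrightarrow> a (1/2) = b (1/2) \<Longrightarrow> branch Y a = branch Y b"
  by (simp add: branch_def)

lemma branch_lift_rev:
  assumes "based y x"
  shows "branch Y (lift (lift y x 1) (dart_rev x)) = branch Y (reversepath (lift y x))"
  by (rule branch_cong) (use lift_rev[OF assms] in \<open>auto simp: reversepath_def\<close>)

text \<open>Only openness needs an argument. Near a point of the lifted open edge the projection is injective, and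
  the lift already passes through all points of the neighbourhood that lie over the open edge.\<close>

lemma arc_cell_lift:
  assumes b: "based y x"
  shows "arc_cell (lift y x)"
proof -
  have x: "x \<in> darts" using b by (simp add: based_def)
  note l = lift[OF b] and d = dpathD[OF x]
  have inj: "inj_on (p \<circ> lift y x) {0<..<1}"
    by (rule inj_onI) (use inj_onD[OF d(5)] l(5) in auto)
  have ends: "lift y x s \<notin> lift y x ` {0<..<1}" if "s \<in> {0, 1}" for s
  proof
    assume "lift y x s \<in> lift y x ` {0<..<1}"
    then obtain t where t: "t \<in> {0<..<1}" "lift y x s = lift y x t" by blast
    then have "dpath x s = dpath x t" using l(5)[of s] l(5)[of t] that by auto
    then show False using d(6)[OF t(1)] d(7,8) that by auto
  qed
  have "openin (top_of_set Y) (lift y x ` {0<..<1})"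
  proof (subst openin_subopen, intro ballI)
    fix z assume "z \<in> lift y x ` {0<..<1}"
    then obtain t where t: "t \<in> {0<..<1}" "z = lift y x t" by blast
    have "z \<in> Y" using l(4)[of t] t by auto
    then obtain N U q where N: "z \<in> N" "openin (top_of_set Y) N" "homeomorphism N U p q"
      by (rule covering_space_local_homeomorphism[OF covering])
    have injN: "v = w" if "v \<in> N" "w \<in> N" "p v = p w" for v w
      using N(3) that unfolding homeomorphism_def by metis
    define J where "J = {0<..<1} \<inter> lift y x -` N"
    obtain O' where O': "open O'" "N = Y \<inter> O'" using N(2) by (auto simp: openin_open)
    have "J = {0<..<1} \<inter> lift y x -` O'" using O'(2) l(4) by (auto simp: J_def)
    moreover have "open ({0<..<1} \<inter> lift y x -` O')"
      by (rule continuous_open_preimage[OF continuous_on_subset[OF l(2)] _ O'(1)]) auto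
    ultimately have J: "J \<subseteq> {0<..<1}" "open J" by auto
    have "openin (top_of_set Y) (N \<inter> (Y \<inter> p -` (dpath x ` J)))"
      by (intro openin_Int N(2) continuous_openin_preimage[OF proj_continuous, where T = X]
          openin_dart_path_image[OF cw x[unfolded darts_def] J]) (use proj_in in auto)
    moreover have "z \<in> N \<inter> (Y \<inter> p -` (dpath x ` J))"
      using N(1) \<open>z \<in> Y\<close> t l(5)[of t] by (auto simp: J_def)
    moreover have "N \<inter> (Y \<inter> p -` (dpath x ` J)) \<subseteq> lift y x ` {0<..<1}"
    proof
      fix w assume w: "w \<in> N \<inter> (Y \<inter> p -` (dpath x ` J))"
      then obtain s where s: "s \<in> J" "p w = dpath x s" by auto
      then have "lift y x s \<in> N" "p (lift y x s) = p w" using l(5)[of s] by (auto simp: J_def)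
      then have "w = lift y x s" using injN w by auto
      then show "w \<in> lift y x ` {0<..<1}" using s(1) by (auto simp: J_def)
    qed
    ultimately show "\<exists>T. openin (top_of_set Y) T \<and> z \<in> T \<and> T \<subseteq> lift y x ` {0<..<1}" by blast
  qed
  then show ?thesis
    using inj l(1,4) ends inj_on_imageI2[OF inj]
    unfolding arc_cell_def open_cell_def path_image_def by auto
qed

lemma open_cell_lift: "based y x \<Longrightarrow> open_cell Y (lift y x)"
  using arc_cell_lift arc_cellD(1) by blast

text \<open>Lifts of different edges have disjoint projections. There remains a loop of the graph lifted in both
  directions; if the two lifts met, then one would be the reverse of the other, and its ends would coincide.\<close>

lemma lift_disjoint:
  assumes b: "based y x" "based y x'" and ne: "x \<noteq> x'"
  shows "lift y x ` {0<..<1} \<inter> lift y x' ` {0<..<1} = {}"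
proof (rule ccontr)
  assume "\<not> ?thesis"
  then obtain s s' where s: "s \<in> {0<..<1}" "s' \<in> {0<..<1}" "lift y x s = lift y x' s'" by blast
  have "dpath x s = dpath x' s'" using s lift(5)[OF b(1), of s] lift(5)[OF b(2), of s'] by auto
  then have x': "x' = dart_rev x" "s' = 1 - s"
    using dpath_eqD[of x x' s s'] s b ne by (auto simp: based_def)
  \<comment> \<open>Both are lifts of the same edge, run through in opposite directions.\<close>
  have "lift y x' (1 - 0) = lift y x 0"
  proof (rule lift_unique[OF b(1), where s = s and h = "\<lambda>t. lift y x' (1 - t)"])
    show "continuous_on {0..1} (\<lambda>t. lift y x' (1 - t))"
      by (intro continuous_on_compose2[OF lift(2)[OF b(2)]] continuous_intros) auto
    show "lift y x' (1 - r) \<in> Y" "p (lift y x' (1 - r)) = dpath x r" if "r \<in> {0..1}" for r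
      using lift(4,5)[OF b(2), of "1 - r"] that by (simp_all add: x' dart_path_rev_apply)
    show "lift y x' (1 - s) = lift y x s" using s(3) x'(2) by simp
  qed (use s(1) in auto)
  then have "lift y x' 1 = lift y x' 0" using lift(3)[OF b(1)] lift(3)[OF b(2)] by simp
  then show False using open_cell_ends_neq[OF simply_conn open_cell_lift[OF b(2)]] by simp
qed

lemma lift_disjoint_next:
  assumes b: "based y x" and b': "based (lift y x 1) x'" and ne: "x' \<noteq> dart_rev x"
  shows "lift y x ` {0<..<1} \<inter> lift (lift y x 1) x' ` {0<..<1} = {}"
proof -
  have "lift (lift y x 1) (dart_rev x) ` {0<..<1} = reversepath (lift y x) ` {0<..<1}"
    by (rule image_cong) (use lift_rev[OF b] in \<open>auto simp: reversepath_def\<close>)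
  then have "lift (lift y x 1) (dart_rev x) ` {0<..<1} = lift y x ` {0<..<1}"
    by (simp add: reversepath_image)
  then show ?thesis using lift_disjoint[OF lift_in_fibre(2)[OF b] b'] ne by auto
qed

lemma branch_lift_disjoint:
  assumes "based y x" "based y x'" "x \<noteq> x'"
  shows "branch Y (lift y x) \<inter> branch Y (lift y x') = {}"
  by (intro branch_disjoint[OF simply_conn] open_cell_lift lift_disjoint assms)
     (use lift(3) assms in auto)

lemma lift_through:
  assumes z: "z \<in> Y" "p z \<notin> V"
  obtains y x where "based y x" "z \<in> lift y x ` {0<..<1}"
proof -
  obtain e where e: "e \<in> E" "p z \<in> path_image (\<phi> e)"
    using proj_in[OF z(1)] z(2) cw_graphD(10)[OF cw] by blast
  define x where "x = (e, True)"
  have x: "x \<in> darts" using e by (simp add: x_def darts_def)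
  note d = dpathD[OF x]
  have "p z \<in> path_image (dpath x)" using e(2) by (simp add: x_def dart_path_def)
  then obtain s where s: "s \<in> {0..1}" "p z = dpath x s" by (auto simp: path_image_def)
  have "s \<noteq> 0" "s \<noteq> 1" using s(2) z(2) d(7,8) by metis+
  then have s01: "s \<in> {0<..<1}" using s(1) by auto
  \<comment> \<open>Lift the initial piece of the edge backwards from \<open>z\<close> to find the origin.\<close>
  define g where "g t = dpath x (s * (1 - t))" for t
  have in01: "s * (1 - t) \<in> {0..1}" if "t \<in> {0..1}" for t
    using that s01 by (auto intro: mult_le_one)
  have "path g"
    unfolding path_def g_def
    by (intro continuous_on_compose2[OF d(2)] continuous_intros) (use in01 in auto)
  moreover have "path_image g \<subseteq> X"
    using d(4) in01 unfolding path_image_def g_def by blast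
  ultimately obtain k where k: "path k" "k 0 = z" "\<And>t. t \<in> {0..1} \<Longrightarrow> k t \<in> Y" "\<And>t. t \<in> {0..1} \<Longrightarrow> p (k t) = g t"
    using covering_lift_path[OF covering _ _ z(1), of g] s(2) by (auto simp: g_def)
  define y where "y = k 1"
  have b: "based y x" using k(3,4)[of 1] x by (simp add: based_def y_def g_def)
  note l = lift[OF b]
  have in01': "1 - t / s \<in> {0..1}" if "t \<in> {0..s}" for t
    using that s01 by (auto simp: field_simps)
  have "k (1 - s / s) = lift y x s"
  proof (rule covering_lift_unique[OF covering, where T = "{0..s}" and ?t0.0 = 0 and t = s
        and f = "\<lambda>t. k (1 - t / s)" and g = "lift y x"])
    show "continuous_on {0..s} (\<lambda>t. k (1 - t / s))"
      by (intro continuous_on_compose2[OF k(1)[unfolded path_def]] continuous_intros) (use in01' s01 in auto)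
    show "continuous_on {0..s} (lift y x)"
      by (rule continuous_on_subset[OF l(2)]) (use s01 in auto)
    show "p (k (1 - t / s)) = p (lift y x t)" if "t \<in> {0..s}" for t
      using k(4)[OF in01'[OF that]] l(5)[of t] that s01 by (auto simp: g_def)
  qed (use k(3) in01' l(3,4) s01 in \<open>auto simp: y_def\<close>)
  then have "z = lift y x s" using k(2) s01 by simp
  then show ?thesis using that b s01 by blast
qed

text \<open>A path that leaves \<open>y\<close> for good meets no other vertex for a while. Hence it stays inside one open
  edge at first, \<open>y\<close> is an end of that edge, and the path runs in the branch which the edge starts.\<close>

lemma branches_cover:
  assumes y: "y \<in> Y" "p y \<in> V" and z: "z \<in> Y" "z \<noteq> y"
  obtains x where "based y x" "z \<in> branch Y (lift y x)"
proof -
  obtain g where g: "path g" "path_image g \<subseteq> Y" "g 0 = y" "g 1 = z"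
    using path_connected_cover y(1) z(1) unfolding path_connected_def pathstart_def pathfinish_def by blast
  have contg: "continuous_on {0..1} g" using g(1) by (simp add: path_def)
  have gY: "g t \<in> Y" if "t \<in> {0..1}" for t using g(2) that unfolding path_image_def by blast
  obtain t0 where t0: "t0 \<in> {0..1}" "g t0 = y" and after: "\<And>s. t0 < s \<Longrightarrow> s \<le> 1 \<Longrightarrow> g s \<noteq> y"
    using last_time_in[OF contg closed_singleton, of y] g(3) by auto
  have "t0 < 1" using t0 g(4) z(2) by (cases "t0 = 1") auto
  obtain N U q where N: "y \<in> N" "openin (top_of_set Y) N" "homeomorphism N U p q"
    using covering_space_local_homeomorphism[OF covering y(1)] by metis
  define W where "W = N \<inter> (Y \<inter> p -` (- (V - {p y})))"
  have "open (- (V - {p y}))" using cw_graphD(1)[OF cw] by (intro open_Compl finite_imp_closed) auto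
  then have "openin (top_of_set Y) W"
    unfolding W_def by (intro openin_Int N(2) continuous_openin_preimage_gen proj_continuous)
  then obtain O' where O': "open O'" "W = Y \<inter> O'" by (auto simp: openin_open)
  have "y \<in> W" using N(1) y by (auto simp: W_def)
  have noV: "p w \<notin> V" if "w \<in> W" "w \<noteq> y" for w
  proof
    assume "p w \<in> V"
    then have "p w = p y" "w \<in> N" using that by (auto simp: W_def)
    then show False using N(1,3) that(2) unfolding homeomorphism_def by metis
  qed
  obtain e where e: "0 < e" "ball y e \<subseteq> O'"
    using O' \<open>y \<in> W\<close> open_contains_ball by blast
  obtain d where d: "0 < d" "\<And>t. t \<in> {0..1} \<Longrightarrow> dist t t0 < d \<Longrightarrow> dist (g t) (g t0) < e"
    using contg[unfolded continuous_on_iff, rule_format, of t0 e] e(1) t0(1) by auto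
  define t1 where "t1 = min 1 (t0 + d/2)"
  have t1: "t0 < t1" "t1 \<le> 1" "t1 < t0 + d" using \<open>t0 < 1\<close> d(1) by (auto simp: t1_def min_def)
  have early: "p (g t) \<notin> V" if "t \<in> {t0<..t1}" for t
  proof -
    have "dist (g t) y < e" using d(2)[of t] that t1 t0 by (simp add: dist_real_def)
    then have "g t \<in> O'" using e(2) by (auto simp: dist_commute subset_iff)
    then have "g t \<in> W" using O'(2) gY[of t] that t1 t0 by simp
    then show ?thesis using noV after[of t] that t1 by simp
  qed
  obtain y' x' where b': "based y' x'" and z1: "g t1 \<in> lift y' x' ` {0<..<1}"
    by (rule lift_through[of "g t1"]) (use gY[of t1] early[of t1] t1 t0 in auto)
  define h where "h = lift y' x'"
  note l = lift[OF b', folded h_def] and oc = open_cell_lift[OF b', folded h_def]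
  have x': "x' \<in> darts" using b' by (simp add: based_def)
  have K: "closed (path_image h)" by (intro compact_imp_closed compact_path_image l)
  let ?S = "g ` {t0<..t1}"
  have contS: "continuous_on {t0<..t1} g" by (rule continuous_on_subset[OF contg]) (use t0 t1 in auto)
  have eqS: "?S \<inter> h ` {0<..<1} = ?S \<inter> path_image h"
  proof -
    have in_open: "h r \<in> h ` {0<..<1}" if r: "r \<in> {0..1}" "h r \<in> ?S" for r
    proof (cases "r \<in> {0<..<1}")
      case False
      then have "r = 0 \<or> r = 1" using r(1) by auto
      then have "p (h r) \<in> V" using l(5)[of 0] l(5)[of 1] dpathD(7,8)[OF x'] by auto
      then show ?thesis using early r(2) by auto
    qed blast
    have "?S \<inter> path_image h \<subseteq> h ` {0<..<1}"
      unfolding path_image_def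
    proof (intro subsetI)
      fix w assume w: "w \<in> ?S \<inter> h ` {0..1}"
      then obtain r where "r \<in> {0..1}" "w = h r" by (elim IntE imageE)
      then show "w \<in> h ` {0<..<1}" using in_open w by simp
    qed
    moreover have "h ` {0<..<1} \<subseteq> path_image h" by (auto simp: path_image_def)
    ultimately show ?thesis by (intro equalityI Int_greatest) (simp_all add: le_infI2)
  qed
  obtain O2 where O2: "open O2" "h ` {0<..<1} = Y \<inter> O2"
    using open_cellD(6)[OF oc] by (auto simp: openin_open)
  have SY: "?S \<subseteq> Y" using gY t0 t1 by auto
  have "?S \<inter> h ` {0<..<1} = ?S \<inter> O2" using O2(2) SY by blast
  then have "openin (top_of_set ?S) (?S \<inter> h ` {0<..<1})" using O2(1) by (simp add: openin_open_Int)
  moreover have "closedin (top_of_set ?S) (?S \<inter> h ` {0<..<1})"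
    unfolding eqS using K by (simp add: closedin_closed_Int)
  moreover have "connected ?S" by (intro connected_continuous_image contS) simp
  moreover have "g t1 \<in> ?S \<inter> h ` {0<..<1}" using z1 t1 by (auto simp: h_def)
  ultimately have "?S \<inter> h ` {0<..<1} = ?S" unfolding connected_clopen by blast
  then have SK: "?S \<subseteq> path_image h" using eqS by blast
  have "y \<in> path_image h"
  proof -
    have "g ` closure {t0<..t1} \<subseteq> closure ?S"
      by (intro image_closure_subset closed_closure closure_subset)
         (use contg t0 t1 in \<open>auto intro: continuous_on_subset\<close>)
    moreover have "closure {t0<..t1} = {t0..t1}" using t1 by simp
    ultimately have "y \<in> closure ?S" using t0(2) t1 by auto
    then show ?thesis using closure_minimal[OF SK K] by blast
  qed
  then obtain r where r: "r \<in> {0..1}" "y = h r" by (auto simp: path_image_def)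
  have "r \<notin> {0<..<1}" using dpathD(6)[OF x', of r] l(5)[OF r(1)] r y(2) by auto
  then have r01: "r = 0 \<or> r = 1" using r(1) by auto
  have pc: "path_connected (g ` {t0<..1})"
    by (intro path_connected_continuous_image convex_imp_path_connected)
       (use contg t0 in \<open>auto intro: continuous_on_subset\<close>)
  have sub: "g ` {t0<..1} \<subseteq> Y - {y}" using after gY t0 by auto
  have fin: "z \<in> branch Y a" if "a 0 = y" "g t1 \<in> branch Y a" for a
    using branch_absorb[of "g ` {t0<..1}" Y a "g t1"] pc sub that t1 t0 \<open>t0 < 1\<close> g(4) by auto
  obtain s where s: "s \<in> {0<..<1}" "g t1 = h s" using z1 by (auto simp: h_def)
  show ?thesis
  proof (cases "r = 0")
    case True
    then have "y' = y" using r l(3) by simp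
    moreover have "g t1 \<in> branch Y h" unfolding s(2) by (rule open_cell_arc_in_branch[OF simply_conn oc]) (use s in auto)
    ultimately show ?thesis using that[of x'] fin[of h] b' l(3) by (simp add: h_def)
  next
    case False
    then have y1: "lift y' x' 1 = y" using r r01 by (simp add: h_def)
    have b: "based y (dart_rev x')" using lift_in_fibre(2)[OF b'] y1 by simp
    have "lift y (dart_rev x') (1 - s) \<in> branch Y (lift y (dart_rev x'))"
      by (rule open_cell_arc_in_branch[OF simply_conn open_cell_lift[OF b]]) (use s in auto)
    moreover have "lift y (dart_rev x') (1 - s) = g t1"
      using lift_rev[OF b', of "1 - s"] y1 s by (simp add: h_def)
    ultimately show ?thesis using that[OF b] fin lift(3)[OF b] by simp
  qed
qed

end

section \<open>A subgraph that branches everywhere\<close>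

text \<open>The walks without backtracking from a vertex of degree at least \<open>3\<close> through vertices of degree \<open>2\<close>.
  Here \<open>W\<close> collects the inner vertices, \<open>F\<close> the edges, and \<open>x\<close> is the last dart; \<open>org\<close> assigns
  the initial vertex to a dart.\<close>

inductive dart_chain :: "('e \<times> bool) set \<Rightarrow> ('e \<times> bool \<Rightarrow> 'v) \<Rightarrow> 'v set \<Rightarrow> 'e set \<Rightarrow> 'e \<times> bool \<Rightarrow> bool"
  for D org where
  start: "x \<in> D \<Longrightarrow> 3 \<le> card {y \<in> D. org y = org x} \<Longrightarrow> dart_chain D org {} {fst x} x"
| step: "dart_chain D org W F x \<Longrightarrow> card {y \<in> D. org y = org (dart_rev x)} = 2 \<Longrightarrow> x' \<in> D \<Longrightarrow>
    org x' = org (dart_rev x) \<Longrightarrow> x' \<noteq> dart_rev x \<Longrightarrow>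
    dart_chain D org (insert (org (dart_rev x)) W) (insert (fst x') F) x'"

text \<open>A chain never meets itself, since it has already used both darts at each of its inner vertices. Hence
  it has one edge more than inner vertices, and its edges include all edges at them.\<close>

lemma dart_chain_invariant:
  assumes "dart_chain D org W F x" and D: "D = E \<times> UNIV" "\<And>y. y \<in> D \<Longrightarrow> org y \<in> V"
  shows "x \<in> D \<and> fst x \<in> F \<and> finite F \<and> F \<subseteq> E \<and> finite W \<and> W \<subseteq> V \<and> card F = card W + 1 \<and>
    org (dart_rev x) \<notin> W \<and> (\<forall>y\<in>D. org y \<in> W \<longrightarrow> fst y \<in> F) \<and>
    (\<forall>y\<in>D. fst y \<in> F \<longrightarrow> org y \<in> W \<or> y = dart_rev x \<or> 3 \<le> card {z \<in> D. org z = org y})"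
  using assms(1)
proof (induction rule: dart_chain.induct)
  case (start x)
  have "y = dart_rev x \<or> 3 \<le> card {z \<in> D. org z = org y}" if "fst y = fst x" for y
    using dart_eq_or_rev[OF that] start(2) by auto
  then show ?case using start D(1) by auto
next
  case (step W F x x')
  let ?w = "org (dart_rev x)"
  have rx: "dart_rev x \<in> D" "dart_rev x' \<in> D" using step D(1) dart_rev_simps(4) by blast+
  have two: "y = dart_rev x \<or> y = x'" if "y \<in> D" "org y = ?w" for y
  proof -
    have "finite {y \<in> D. org y = ?w}" using step(2) by (metis card.infinite zero_neq_numeral)
    moreover have "{dart_rev x, x'} \<subseteq> {y \<in> D. org y = ?w}" using rx step by auto
    moreover have "card {dart_rev x, x'} = card {y \<in> D. org y = ?w}" using step by simp
    ultimately have "{dart_rev x, x'} = {y \<in> D. org y = ?w}" by (metis card_subset_eq)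
    then show ?thesis using that by blast
  qed
  have new: "fst x' \<notin> F"
  proof
    assume "fst x' \<in> F"
    then have "org x' \<in> W \<or> 3 \<le> card {z \<in> D. org z = org x'}" using step by blast
    then show False using step by simp
  qed
  have "org (dart_rev x') \<notin> W" using step.IH rx(2) new by auto
  moreover have "org (dart_rev x') \<noteq> ?w"
  proof
    assume "org (dart_rev x') = ?w"
    then have "dart_rev x' = dart_rev x" using two[OF rx(2)] by auto
    then have "x' = x" by (metis dart_rev_simps(1))
    then show False using new step.IH by simp
  qed
  moreover have "\<forall>y\<in>D. org y \<in> insert ?w W \<longrightarrow> fst y \<in> insert (fst x') F"
    using two step.IH by (metis dart_rev_simps(2) insert_iff)
  moreover have "\<forall>y\<in>D. fst y \<in> insert (fst x') F \<longrightarrow>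
      org y \<in> insert ?w W \<or> y = dart_rev x' \<or> 3 \<le> card {z \<in> D. org z = org y}"
  proof (intro ballI impI)
    fix y assume y: "y \<in> D" "fst y \<in> insert (fst x') F"
    show "org y \<in> insert ?w W \<or> y = dart_rev x' \<or> 3 \<le> card {z \<in> D. org z = org y}"
    proof (cases "fst y \<in> F")
      case True
      then show ?thesis using step.IH y(1) by auto
    next
      case False
      then show ?thesis using y(2) dart_eq_or_rev[of y x'] step(4) by auto
    qed
  qed
  moreover have "fst x' \<in> E" "?w \<in> V" using step(3) D rx by auto
  ultimately show ?case using step new by auto
qed

text \<open>\<open>C x \<tau>\<close> certifies that a vertex with at least three darts in \<open>D\<close> can be reached within length
  \<open>\<tau>\<close>, measured from the origin of \<open>x\<close>, by following \<open>x\<close> and then further darts of \<open>D\<close> without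
  turning back.\<close>

definition early_branching ::
    "('e \<times> bool) set \<Rightarrow> ('e \<times> bool \<Rightarrow> 'v) \<Rightarrow> ('e \<Rightarrow> real) \<Rightarrow> ('e \<times> bool \<Rightarrow> real \<Rightarrow> bool) \<Rightarrow> bool" where
  "early_branching D org len C \<longleftrightarrow>
     (\<forall>x\<in>D. 3 \<le> card {y \<in> D. org y = org x} \<longrightarrow> C x 1) \<and>
     (\<forall>x \<tau>. C x \<tau> \<longrightarrow> x \<in> D \<and> len (fst x) \<le> \<tau> \<and> \<tau> \<le> 1 \<and>
       (3 \<le> card {y \<in> D. org y = org (dart_rev x)} \<or>
        (\<exists>x'\<in>D. org x' = org (dart_rev x) \<and> x' \<noteq> dart_rev x \<and> C x' (\<tau> - len (fst x)))))"

text \<open>Among all subgraphs choose one that maximises the number of edges minus the number of vertices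
  minus the total length. Removing a set of vertices with all edges at them cannot increase this
  number, so that there are no vertices of degree \<open>0\<close> or \<open>1\<close>, and a chain, which has one edge more
  than it has inner vertices, has length at most \<open>1\<close>. The certificate \<open>C x \<tau>\<close> is that \<open>x\<close> ends
  a chain whose other edges have total length \<open>1 - \<tau>\<close>.\<close>

lemma branching_subgraph:
  fixes org :: "'e \<times> bool \<Rightarrow> 'v" and len :: "'e \<Rightarrow> real"
  assumes fin: "finite V" "finite E" and org: "\<And>x. x \<in> E \<times> UNIV \<Longrightarrow> org x \<in> V"
    and len: "\<And>e. e \<in> E \<Longrightarrow> 0 < len e" and short: "(\<Sum>e\<in>E. len e) < real (card E) - real (card V)"
  obtains D u C where "D \<subseteq> E \<times> UNIV" "3 \<le> card {x \<in> D. org x = u}" "early_branching D org len C"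
proof -
  define Sub where "Sub = {(W, F). W \<subseteq> V \<and> F \<subseteq> E \<and> (\<forall>x\<in>F \<times> UNIV. org x \<in> W)}"
  define \<Phi> where "\<Phi> = (\<lambda>(W :: 'v set, F). real (card F) - real (card W) - (\<Sum>e\<in>F. len e))"
  have "finite Sub"
    by (rule finite_subset[of _ "Pow V \<times> Pow E"]) (use fin in \<open>auto simp: Sub_def\<close>)
  moreover have VE: "(V, E) \<in> Sub" using org by (auto simp: Sub_def)
  ultimately have "finite (\<Phi> ` Sub)" "\<Phi> ` Sub \<noteq> {}" by auto
  from Max_in[OF this] obtain M where M: "M \<in> Sub" "\<Phi> M = Max (\<Phi> ` Sub)" by (elim imageE) simp
  then have M: "M \<in> Sub" "\<And>N. N \<in> Sub \<Longrightarrow> \<Phi> N \<le> \<Phi> M"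
    using Max_ge[OF \<open>finite (\<Phi> ` Sub)\<close>] by simp_all
  obtain V' E' where M': "M = (V', E')" by (cases M)
  define D where "D = E' \<times> (UNIV :: bool set)"
  define deg where "deg v = card {x \<in> D. org x = v}" for v
  have sub: "V' \<subseteq> V" "E' \<subseteq> E" "\<And>x. x \<in> D \<Longrightarrow> org x \<in> V'"
    using M(1) by (auto simp: Sub_def M' D_def)
  have fin': "finite V'" "finite E'" "finite D"
    using sub(1,2) fin finite_subset by (auto simp: D_def intro!: finite_cartesian_product)
  have finD: "finite {x \<in> D. P x}" for P using fin'(3) by simp
  have pos: "\<Phi> (V', E') > 0" using M(2)[OF VE] short by (simp add: \<Phi>_def M')
  have removal: "(\<Sum>e\<in>F. len e) \<le> real (card F) - real (card W)"
    if W: "W \<subseteq> V'" and F: "F \<subseteq> E'" and inc: "\<And>x. x \<in> D \<Longrightarrow> org x \<in> W \<Longrightarrow> fst x \<in> F" for W F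
  proof -
    have "org x \<in> V' - W" if "x \<in> (E' - F) \<times> UNIV" for x
      using that sub(3)[of x] inc[of x] by (auto simp: D_def)
    then have "(V' - W, E' - F) \<in> Sub" using sub by (auto simp: Sub_def)
    then have "\<Phi> (V' - W, E' - F) \<le> \<Phi> (V', E')" using M(2) M' by blast
    moreover have "real (card (V' - W)) = real (card V') - real (card W)"
      using W fin' by (simp add: card_Diff_subset finite_subset card_mono of_nat_diff)
    moreover have "real (card (E' - F)) = real (card E') - real (card F)"
      using F fin' by (simp add: card_Diff_subset finite_subset card_mono of_nat_diff)
    moreover have "(\<Sum>e\<in>E' - F. len e) = (\<Sum>e\<in>E'. len e) - (\<Sum>e\<in>F. len e)"
      using F fin' by (simp add: sum_diff)
    ultimately show ?thesis by (simp add: \<Phi>_def)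
  qed
  have deg2: "2 \<le> deg v" if v: "v \<in> V'" for v
  proof (rule ccontr)
    assume "\<not> 2 \<le> deg v"
    then consider "deg v = 0" | "deg v = 1" by linarith
    then show False
    proof cases
      case 1
      then have "{x \<in> D. org x = v} = {}" using finD by (simp add: deg_def)
      then show False using removal[of "{v}" "{}"] v by auto
    next
      case 2
      then obtain x where x: "{y \<in> D. org y = v} = {x}" unfolding deg_def by (metis card_1_singletonE)
      then have "x \<in> D" by blast
      then have "fst x \<in> E'" by (auto simp: D_def)
      moreover have "fst y \<in> {fst x}" if "y \<in> D" "org y \<in> {v}" for y using x that by auto
      ultimately have "len (fst x) \<le> 0" using removal[of "{v}" "{fst x}"] v by auto
      then show False using len[of "fst x"] \<open>fst x \<in> E'\<close> sub(2) by auto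
    qed
  qed
  have "\<exists>u\<in>V'. 3 \<le> deg u"
  proof (rule ccontr)
    assume "\<not> ?thesis"
    then have le: "deg v \<le> 2" if "v \<in> V'" for v using that by force
    have "D = (\<Union>v\<in>V'. {x \<in> D. org x = v})" using sub(3) by auto
    then have "card D \<le> (\<Sum>v\<in>V'. deg v)"
      unfolding deg_def using card_UN_le[OF fin'(1)] by metis
    also have "\<dots> \<le> (\<Sum>v\<in>V'. 2)" by (rule sum_mono) (rule le)
    finally have "card E' \<le> card V'" by (simp add: D_def card_cartesian_product)
    moreover have "0 \<le> (\<Sum>e\<in>E'. len e)" using len sub(2) by (intro sum_nonneg) (auto intro: less_imp_le)
    ultimately show False using pos by (simp add: \<Phi>_def)
  qed
  then obtain u where u: "u \<in> V'" "3 \<le> deg u" by blast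
  define C where "C x \<tau> \<longleftrightarrow> (\<exists>W F. dart_chain D org W F x \<and> \<tau> = 1 - (\<Sum>e\<in>F - {fst x}. len e))" for x \<tau>
  have "x \<in> D \<and> len (fst x) \<le> \<tau> \<and> \<tau> \<le> 1 \<and>
       (3 \<le> deg (org (dart_rev x)) \<or>
        (\<exists>x'\<in>D. org x' = org (dart_rev x) \<and> x' \<noteq> dart_rev x \<and> C x' (\<tau> - len (fst x))))" if C: "C x \<tau>" for x \<tau>
  proof -
    obtain W F where ch: "dart_chain D org W F x" and \<tau>: "\<tau> = 1 - (\<Sum>e\<in>F - {fst x}. len e)"
      using C by (auto simp: C_def)
    have inv: "x \<in> D" "fst x \<in> F" "finite F" "F \<subseteq> E'" "W \<subseteq> V'" "card F = card W + 1"
      "\<And>y. y \<in> D \<Longrightarrow> org y \<in> W \<Longrightarrow> fst y \<in> F"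
      using dart_chain_invariant[OF ch D_def sub(3)] by auto
    have split: "(\<Sum>e\<in>F. len e) = len (fst x) + (\<Sum>e\<in>F - {fst x}. len e)"
      by (rule sum.remove) (use inv in auto)
    have "(\<Sum>e\<in>F. len e) \<le> 1" using removal[OF inv(5,4,7)] inv(6) by simp
    then have "len (fst x) \<le> \<tau>" using split \<tau> by simp
    moreover have "0 \<le> (\<Sum>e\<in>F - {fst x}. len e)"
      using len inv(4) sub(2) by (intro sum_nonneg) (auto intro: less_imp_le)
    then have "\<tau> \<le> 1" using \<tau> by simp
    moreover have "\<exists>x'\<in>D. org x' = org (dart_rev x) \<and> x' \<noteq> dart_rev x \<and> C x' (\<tau> - len (fst x))"
      if "\<not> 3 \<le> deg (org (dart_rev x))"
    proof -
      have rx: "dart_rev x \<in> D" using inv(1) unfolding D_def by (simp only: dart_rev_simps)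
      have two: "deg (org (dart_rev x)) = 2" using that deg2[OF sub(3)[OF rx]] by simp
      have "\<exists>x'. x' \<in> {y \<in> D. org y = org (dart_rev x)} \<and> x' \<noteq> dart_rev x"
      proof (rule ccontr)
        assume "\<not> ?thesis"
        then have "{y \<in> D. org y = org (dart_rev x)} \<subseteq> {dart_rev x}" by blast
        then have "deg (org (dart_rev x)) \<le> 1" unfolding deg_def using card_mono[of "{dart_rev x}"] by force
        then show False using two by simp
      qed
      then obtain x' where x': "x' \<in> D" "org x' = org (dart_rev x)" "x' \<noteq> dart_rev x" by blast
      have ch': "dart_chain D org (insert (org (dart_rev x)) W) (insert (fst x') F) x'"
        by (rule dart_chain.step[OF ch two[unfolded deg_def] x'])
      have "card (insert (org (dart_rev x)) W) = card W + 1"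
        using dart_chain_invariant[OF ch D_def sub(3)] by simp
      then have "card (insert (fst x') F) = card F + 1"
        using dart_chain_invariant[OF ch' D_def sub(3)] inv(6) by simp
      then have "fst x' \<notin> F" using inv(3) by (auto simp: card_insert_if split: if_splits)
      then have "insert (fst x') F - {fst x'} = F" by simp
      then have "C x' (\<tau> - len (fst x))" unfolding C_def using ch' split \<tau>
        by (intro exI[of _ "insert (org (dart_rev x)) W"] exI[of _ "insert (fst x') F"]) simp
      then show ?thesis using x' by blast
    qed
    ultimately show ?thesis using inv(1) by blast
  qed
  note chain = this
  have "C x 1" if "x \<in> D" "3 \<le> deg (org x)" for x
  proof -
    have "dart_chain D org {} {fst x} x" by (rule dart_chain.start[OF that(1) that(2)[unfolded deg_def]])
    then show ?thesis unfolding C_def by (intro exI[of _ "{}"] exI[of _ "{fst x}"]) simp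
  qed
  with chain have "early_branching D org len C" unfolding early_branching_def deg_def by blast
  moreover have "D \<subseteq> E \<times> UNIV" using sub(2) by (auto simp: D_def)
  ultimately show ?thesis using that u(2) unfolding deg_def by blast
qed

section \<open>The first Betti number\<close>

text \<open>Both inequalities come from spanning sets: a basis of the kernel extended to \<open>S\<close> bounds the dimension
  of the image, and a basis of the kernel together with preimages of a basis of the image spans \<open>S\<close>.\<close>

lemma rank_nullity_finite_span:
  fixes f :: "'a::real_vector \<Rightarrow> 'b::real_vector"
  assumes f: "linear f" and S: "subspace S" and B0: "finite B0" "S \<subseteq> span B0"
  shows "dim S = dim {x \<in> S. f x = 0} + dim (f ` S)"
proof -
  let ?Z = "{x \<in> S. f x = 0}"
  have fin: "finite A" if "A \<subseteq> S" "independent A" for A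
    using real_vector.independent_span_bound[OF B0(1) that(2)] that(1) B0(2) by blast
  obtain K where K: "K \<subseteq> ?Z" "independent K" "?Z \<subseteq> span K" "card K = dim ?Z"
    by (rule real_vector.basis_exists)
  have "K \<subseteq> S" using K(1) by blast
  then obtain B where B: "K \<subseteq> B" "B \<subseteq> S" "independent B" "S \<subseteq> span B"
    using real_vector.maximal_independent_subset_extend[OF _ K(2)] by metis
  have finB: "finite B" by (rule fin) fact+
  have finK: "finite K" by (rule finite_subset[OF B(1) finB])
  have fS: "f ` S \<subseteq> span (f ` (B - K))"
  proof -
    have "f ` B \<subseteq> insert 0 (f ` (B - K))" using K(1) by auto
    then have "span (f ` B) \<subseteq> span (insert 0 (f ` (B - K)))" by (rule real_vector.span_mono)
    then show ?thesis using B(4) linear_span_image[OF f, of B] by auto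
  qed
  have "dim (f ` S) \<le> card (f ` (B - K))" by (rule real_vector.dim_le_card[OF fS]) (use finB in simp)
  also have "\<dots> \<le> card (B - K)" by (rule card_image_le) (use finB in simp)
  also have "\<dots> = card B - card K" by (rule card_Diff_subset[OF finK B(1)])
  finally have "dim (f ` S) \<le> card B - card K" .
  moreover have "card K \<le> card B" by (rule card_mono[OF finB B(1)])
  moreover have "card B = dim S" by (rule real_vector.basis_card_eq_dim[OF B(2,4,3)])
  ultimately have 1: "dim ?Z + dim (f ` S) \<le> dim S" using K(4) by linarith
  obtain C where C: "C \<subseteq> f ` S" "independent C" "f ` S \<subseteq> span C" "card C = dim (f ` S)"
    by (rule real_vector.basis_exists)
  have "finite (f ` (B - K))" using finB by simp
  then have finC: "finite C" using real_vector.independent_span_bound[OF _ C(2)] C(1) fS by blast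
  obtain G where G: "G \<subseteq> S" "finite G" "C = f ` G" "card G \<le> card C"
  proof -
    obtain G where "G \<subseteq> S" "inj_on f G" "C = f ` G" using C(1) subset_image_inj[of C f S] by auto
    then show ?thesis using that finC by (metis card_image finite_imageD le_refl)
  qed
  have "S \<subseteq> span (K \<union> G)"
  proof
    fix x assume x: "x \<in> S"
    then have "f x \<in> f ` span G" using C(3) linear_span_image[OF f, of G] G(3) by auto
    then obtain y where y: "y \<in> span G" "f x = f y" by blast
    have "y \<in> S" using y(1) real_vector.span_minimal[OF G(1) S] by blast
    then have "x - y \<in> ?Z" using x y(2) real_vector.subspace_diff[OF S] linear_diff[OF f] by simp
    then have "x - y \<in> span (K \<union> G)" using K(3) real_vector.span_mono[of K "K \<union> G"] by blast
    moreover have "y \<in> span (K \<union> G)" using y(1) real_vector.span_mono[of G "K \<union> G"] by blast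
    ultimately have "(x - y) + y \<in> span (K \<union> G)" by (rule real_vector.span_add)
    then show "x \<in> span (K \<union> G)" by simp
  qed
  then have "dim S \<le> card (K \<union> G)" by (rule real_vector.dim_le_card) (use finK G in simp)
  also have "\<dots> \<le> card K + card G" by (rule card_Un_le)
  finally have "dim S \<le> dim ?Z + dim (f ` S)" using K(4) C(4) G(4) by linarith
  then show ?thesis using 1 by simp
qed

lemma lookup_scaleR: "Poly_Mapping.lookup (r *\<^sub>R c) i = r * Poly_Mapping.lookup c (i::'a)" for c :: "'a \<Rightarrow>\<^sub>0 real"
proof -
  have "finite {j. r * Poly_Mapping.lookup c j \<noteq> 0}"
    by (rule finite_subset[OF _ finite_lookup[of c]]) auto
  then show ?thesis by (simp add: scaleR_poly_mapping_def)
qed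

lemma independent_singles:
  "independent ((\<lambda>v. Poly_Mapping.single v (1::real)) ` A)" (is "independent (?s ` A)")
proof -
  have inj: "inj ?s" by (rule injI) (metis lookup_single_eq lookup_single_not_eq zero_neq_one)
  show ?thesis
    unfolding real_vector.independent_explicit_finite_subsets
  proof (intro allI impI ballI)
    fix S u w assume S: "S \<subseteq> ?s ` A" "finite S" "(\<Sum>v\<in>S. u v *\<^sub>R v) = 0" and "w \<in> S"
    then obtain a where a: "w = ?s a" by blast
    have other: "Poly_Mapping.lookup v a = 0" if "v \<in> S - {w}" for v
      using that S(1) a by (auto simp: lookup_single when_def)
    have "0 = Poly_Mapping.lookup (\<Sum>v\<in>S. u v *\<^sub>R v) a" using S(3) by simp
    also have "\<dots> = (\<Sum>v\<in>S. u v * Poly_Mapping.lookup v a)" by (simp add: lookup_sum lookup_scaleR)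
    also have "\<dots> = u w * Poly_Mapping.lookup w a + (\<Sum>v\<in>S - {w}. u v * Poly_Mapping.lookup v a)"
      by (rule sum.remove) fact+
    also have "\<dots> = u w" using other a by simp
    finally show "u w = 0" by simp
  qed
qed

lemma card_singles: "card ((\<lambda>v. Poly_Mapping.single v (1::real)) ` A) = card A"
  by (rule card_image, rule inj_onI) (metis lookup_single_eq lookup_single_not_eq zero_neq_one)

lemma chain_eq_sum_singles:
  fixes c :: "'e \<Rightarrow>\<^sub>0 real"
  assumes "finite A" "Poly_Mapping.keys c \<subseteq> A"
  shows "c = (\<Sum>e\<in>A. Poly_Mapping.lookup c e *\<^sub>R Poly_Mapping.single e 1)"
proof (rule poly_mapping_eqI)
  fix i
  have "Poly_Mapping.lookup (\<Sum>e\<in>A. Poly_Mapping.lookup c e *\<^sub>R Poly_Mapping.single e (1::real)) i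
      = (\<Sum>e\<in>A. if e = i then Poly_Mapping.lookup c e else 0)"
    by (simp add: lookup_sum lookup_scaleR lookup_single when_def if_distrib cong: if_cong)
  also have "\<dots> = (if i \<in> A then Poly_Mapping.lookup c i else 0)"
    using assms(1) by simp
  also have "\<dots> = Poly_Mapping.lookup c i"
    using assms(2) by (auto simp: in_keys_iff)
  finally show "Poly_Mapping.lookup c i
      = Poly_Mapping.lookup (\<Sum>e\<in>A. Poly_Mapping.lookup c e *\<^sub>R Poly_Mapping.single e (1::real)) i" by simp
qed

definition edge_boundary :: "('e \<Rightarrow> real \<Rightarrow> 'a::metric_space) \<Rightarrow> 'e \<Rightarrow> ('a \<Rightarrow>\<^sub>0 real)" where
  "edge_boundary \<phi> e = Poly_Mapping.single (\<phi> e 1) 1 - Poly_Mapping.single (\<phi> e 0) 1"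

lemma cellular_boundary_eq:
  assumes "finite A" "Poly_Mapping.keys c \<subseteq> A"
  shows "cellular_boundary \<phi> c = (\<Sum>e\<in>A. Poly_Mapping.lookup c e *\<^sub>R edge_boundary \<phi> e)"
  unfolding cellular_boundary_def edge_boundary_def pathstart_def pathfinish_def
  by (rule sum.mono_neutral_left) (use assms in \<open>auto simp: in_keys_iff\<close>)

lemma linear_cellular_boundary:
  fixes \<phi> :: "'e \<Rightarrow> real \<Rightarrow> 'a::metric_space"
  shows "linear (cellular_boundary \<phi>)"
proof (rule linearI)
  fix c d :: "'e \<Rightarrow>\<^sub>0 real" and r :: real
  let ?A = "Poly_Mapping.keys c \<union> Poly_Mapping.keys d"
  have "cellular_boundary \<phi> (c + d) = (\<Sum>e\<in>?A. Poly_Mapping.lookup (c + d) e *\<^sub>R edge_boundary \<phi> e)"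
    by (rule cellular_boundary_eq) (use keys_add[of c d] in auto)
  also have "\<dots> = cellular_boundary \<phi> c + cellular_boundary \<phi> d"
    using cellular_boundary_eq[of ?A c \<phi>] cellular_boundary_eq[of ?A d \<phi>]
    by (simp add: lookup_add scaleR_add_left sum.distrib)
  finally show "cellular_boundary \<phi> (c + d) = cellular_boundary \<phi> c + cellular_boundary \<phi> d" .
  have "Poly_Mapping.keys (r *\<^sub>R c) \<subseteq> Poly_Mapping.keys c" by (auto simp: in_keys_iff lookup_scaleR)
  then have "cellular_boundary \<phi> (r *\<^sub>R c)
      = (\<Sum>e\<in>Poly_Mapping.keys c. Poly_Mapping.lookup (r *\<^sub>R c) e *\<^sub>R edge_boundary \<phi> e)"
    by (intro cellular_boundary_eq) auto
  also have "\<dots> = r *\<^sub>R cellular_boundary \<phi> c"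
    using cellular_boundary_eq[of "Poly_Mapping.keys c" c \<phi>] by (simp add: lookup_scaleR scaleR_sum_right)
  finally show "cellular_boundary \<phi> (r *\<^sub>R c) = r *\<^sub>R cellular_boundary \<phi> c" .
qed

lemma edge_boundary_in_image:
  "e \<in> E \<Longrightarrow> edge_boundary \<phi> e \<in> cellular_boundary \<phi> ` {c. Poly_Mapping.keys c \<subseteq> E}"
  using cellular_boundary_eq[of "{e}" "Poly_Mapping.single e 1" \<phi>]
  by (intro image_eqI[of _ _ "Poly_Mapping.single e 1"]) auto

lemma subspace_chains: "subspace {c :: 'e \<Rightarrow>\<^sub>0 real. Poly_Mapping.keys c \<subseteq> E}"
proof (rule real_vector.subspaceI)
  fix c d :: "'e \<Rightarrow>\<^sub>0 real" and r :: real
  assume c: "c \<in> {c. Poly_Mapping.keys c \<subseteq> E}"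
  then show "r *\<^sub>R c \<in> {c. Poly_Mapping.keys c \<subseteq> E}"
    by (auto simp: in_keys_iff lookup_scaleR)
  assume "d \<in> {c. Poly_Mapping.keys c \<subseteq> E}"
  then show "c + d \<in> {c. Poly_Mapping.keys c \<subseteq> E}" using c keys_add[of c d] by blast
qed simp

text \<open>The Betti number is the dimension of the kernel of the boundary map on the chains, which have the edges
  as a basis.\<close>

lemma first_betti_rank:
  fixes E :: "'e set" and \<phi> :: "'e \<Rightarrow> real \<Rightarrow> 'a::metric_space"
  assumes "finite E"
  shows "card E = first_betti E \<phi> + dim (cellular_boundary \<phi> ` {c. Poly_Mapping.keys c \<subseteq> E})"
proof -
  let ?S = "{c :: 'e \<Rightarrow>\<^sub>0 real. Poly_Mapping.keys c \<subseteq> E}"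
  let ?B = "(\<lambda>e. Poly_Mapping.single e (1::real)) ` E"
  have span: "?S \<subseteq> span ?B"
  proof
    fix c assume "c \<in> ?S"
    then have c: "c = (\<Sum>e\<in>E. Poly_Mapping.lookup c e *\<^sub>R Poly_Mapping.single e 1)"
      using chain_eq_sum_singles[OF assms, of c] by simp
    show "c \<in> span ?B"
      by (subst c, intro real_vector.span_sum real_vector.span_scale real_vector.span_base imageI)
  qed
  have "?B \<subseteq> ?S" by auto
  then have "card ?B = dim ?S" by (rule real_vector.basis_card_eq_dim[OF _ span independent_singles])
  moreover have "dim ?S = dim {x \<in> ?S. cellular_boundary \<phi> x = 0} + dim (cellular_boundary \<phi> ` ?S)"
    by (rule rank_nullity_finite_span[OF linear_cellular_boundary subspace_chains _ span]) (use assms in simp)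
  ultimately show ?thesis by (simp add: first_betti_def card_singles)
qed

text \<open>Euler's formula in one direction: boundaries are combinations of differences of a vertex and a fixed one, so that the rank of the boundary
  map is less than the number of vertices.\<close>

lemma card_edges_le:
  fixes E :: "'e set" and \<phi> :: "'e \<Rightarrow> real \<Rightarrow> 'a::metric_space"
  assumes cw: "cw_graph X V E \<phi>" and V: "V \<noteq> {}"
  shows "card E + 1 \<le> first_betti E \<phi> + card V"
proof -
  note c = cw_graphD[OF cw]
  obtain v0 where v0: "v0 \<in> V" using V by blast
  let ?s = "\<lambda>v. Poly_Mapping.single v (1::real)"
  let ?W = "(\<lambda>v. ?s v - ?s v0) ` (V - {v0})"
  have d: "?s v - ?s v0 \<in> span ?W" if "v \<in> V" for v
    using that by (cases "v = v0") (auto intro: real_vector.span_base simp: real_vector.span_zero)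
  have "cellular_boundary \<phi> c \<in> span ?W" if "Poly_Mapping.keys c \<subseteq> E" for c
  proof -
    have "edge_boundary \<phi> e \<in> span ?W" if "e \<in> E" for e
    proof -
      have "(?s (\<phi> e 1) - ?s v0) - (?s (\<phi> e 0) - ?s v0) \<in> span ?W"
        by (intro real_vector.span_diff d c that)
      then show ?thesis by (simp add: edge_boundary_def)
    qed
    then show ?thesis
      unfolding cellular_boundary_eq[OF c(2) that]
      by (intro real_vector.span_sum real_vector.span_scale)
  qed
  then have "cellular_boundary \<phi> ` {c. Poly_Mapping.keys c \<subseteq> E} \<subseteq> span ?W" by auto
  then have "dim (cellular_boundary \<phi> ` {c. Poly_Mapping.keys c \<subseteq> E}) \<le> card ?W"
    by (rule real_vector.dim_le_card) (use c(1) in simp)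
  also have "\<dots> \<le> card (V - {v0})" by (rule card_image_le) (use c(1) in simp)
  also have "\<dots> = card V - 1" using v0 by simp
  finally have "dim (cellular_boundary \<phi> ` {c. Poly_Mapping.keys c \<subseteq> E}) \<le> card V - 1" .
  moreover have "0 < card V" using V c(1) by (simp add: card_gt_0_iff)
  ultimately show ?thesis using first_betti_rank[OF c(2), of \<phi>] by linarith
qed

text \<open>Conversely, connectedness makes the rank at least the number of vertices minus \<open>1\<close>. The vertices
  \<open>v\<close> for which \<open>v - v0\<close> is a boundary are closed under passing along an edge, so that they and
  their edges form one of two disjoint closed parts of the graph, and the other part must be empty.\<close>

lemma card_edges_ge:
  fixes E :: "'e set" and \<phi> :: "'e \<Rightarrow> real \<Rightarrow> 'a::metric_space"
  assumes cw: "cw_graph X V E \<phi>" and conn: "connected X"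
  shows "first_betti E \<phi> + card V \<le> card E + 1"
proof (cases "V = {}")
  case True
  then have "E = {}" using cw_graphD(5)[OF cw] by blast
  then show ?thesis using first_betti_rank[of E \<phi>] True by simp
next
  case False
  note c = cw_graphD[OF cw]
  obtain v0 where v0: "v0 \<in> V" using False by blast
  let ?s = "\<lambda>v. Poly_Mapping.single v (1::real)"
  let ?im = "cellular_boundary \<phi> ` {c. Poly_Mapping.keys c \<subseteq> E}"
  have sub: "subspace ?im" by (intro linear_subspace_image linear_cellular_boundary subspace_chains)
  define A where "A = {v \<in> V. ?s v - ?s v0 \<in> ?im}"
  have A_iff: "\<phi> e 0 \<in> A \<longleftrightarrow> \<phi> e 1 \<in> A" if e: "e \<in> E" for e
  proof -
    have b: "?s (\<phi> e 1) - ?s (\<phi> e 0) \<in> ?im" using edge_boundary_in_image[OF e, of \<phi>] by (simp add: edge_boundary_def)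
    have "?s (\<phi> e 1) - ?s v0 \<in> ?im" if "?s (\<phi> e 0) - ?s v0 \<in> ?im"
      using real_vector.subspace_add[OF sub b that] by simp
    moreover have "?s (\<phi> e 0) - ?s v0 \<in> ?im" if "?s (\<phi> e 1) - ?s v0 \<in> ?im"
      using real_vector.subspace_diff[OF sub that b] by simp
    ultimately show ?thesis using c(5,6)[OF e] by (auto simp: A_def)
  qed
  define P where "P B = B \<union> (\<Union>e\<in>{e\<in>E. \<phi> e 0 \<in> B}. path_image (\<phi> e))" for B
  have closedP: "closed (P B)" if "B \<subseteq> V" for B
  proof -
    have "finite B" using that c(1) finite_subset by blast
    moreover have "compact (path_image (\<phi> e))" if "e \<in> E" for e using c(4)[OF that] by blast
    ultimately have "compact (P B)"
      unfolding P_def using c(2) by (intro compact_Un compact_UN) (auto intro: finite_imp_compact)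
    then show ?thesis by (rule compact_imp_closed)
  qed
  \<comment> \<open>Neither end of an edge that starts in \<open>B\<close> leads out of \<open>B\<close>.\<close>
  have cases: "z \<in> B \<or> (\<exists>e\<in>E. \<phi> e 0 \<in> B \<and> z \<in> \<phi> e ` {0<..<1})"
    if z: "z \<in> P B" and B: "\<And>e. e \<in> E \<Longrightarrow> \<phi> e 0 \<in> B \<Longrightarrow> \<phi> e 1 \<in> B" for z B
  proof (cases "z \<in> B")
    case False
    then obtain e t where e: "e \<in> E" "\<phi> e 0 \<in> B" "t \<in> {0..1}" "z = \<phi> e t"
      using z by (auto simp: P_def path_image_def)
    then have "t \<noteq> 0" "t \<noteq> 1" using False B[of e] by metis+
    then have "t \<in> {0<..<1}" using e(3) by auto
    then show ?thesis using e by blast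
  qed blast
  have disj: "P A \<inter> P (V - A) = {}"
  proof (rule ccontr)
    assume "P A \<inter> P (V - A) \<noteq> {}"
    then obtain z where z: "z \<in> P A" "z \<in> P (V - A)" by blast
    have z1: "z \<in> A \<or> (\<exists>e\<in>E. \<phi> e 0 \<in> A \<and> z \<in> \<phi> e ` {0<..<1})"
      by (rule cases[OF z(1)]) (use A_iff in blast)
    have z2: "z \<in> V - A \<or> (\<exists>e\<in>E. \<phi> e 0 \<in> V - A \<and> z \<in> \<phi> e ` {0<..<1})"
      by (rule cases[OF z(2)]) (use A_iff c(6) in blast)
    show False
    proof (cases "z \<in> V")
      case True
      then have "z \<notin> \<phi> e ` {0<..<1}" if "e \<in> E" for e using c(8)[OF that] by blast
      then show False using z1 z2 by blast
    next
      case False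
      then obtain e e' where e: "e \<in> E" "e' \<in> E" "\<phi> e 0 \<in> A" "\<phi> e' 0 \<in> V - A"
        "z \<in> \<phi> e ` {0<..<1}" "z \<in> \<phi> e' ` {0<..<1}"
        using z1 z2 A_def by blast
      then have "e = e'" using disjoint_family_onD[OF c(9) e(1,2)] by blast
      then show False using e by blast
    qed
  qed
  have "X \<subseteq> P A \<union> P (V - A)"
  proof
    fix z assume "z \<in> X"
    then consider "z \<in> V" | e where "e \<in> E" "z \<in> path_image (\<phi> e)" using c(10) by blast
    then show "z \<in> P A \<union> P (V - A)"
      using c(5) by cases (auto simp: P_def)
  qed
  moreover have "?s v0 - ?s v0 \<in> ?im" using real_vector.subspace_0[OF sub] by simp
  then have "v0 \<in> P A \<inter> X" using v0 c(3) by (auto simp: A_def P_def)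
  moreover have "closed (P A)" "closed (P (V - A))" by (rule closedP; auto simp: A_def)+
  ultimately have "P (V - A) \<inter> X = {}"
    using conn disj unfolding connected_closed by blast
  then have "V - A = {}" using c(3) by (auto simp: P_def)
  then have all: "?s v - ?s v0 \<in> ?im" if "v \<in> V" for v using that by (auto simp: A_def)
  obtain C where C: "C \<subseteq> ?im" "independent C" "?im \<subseteq> span C" "card C = dim ?im"
    by (rule real_vector.basis_exists)
  have "finite ?im \<or> finite C"
  proof -
    have "?im \<subseteq> span (edge_boundary \<phi> ` E)"
    proof (clarify)
      fix d :: "'e \<Rightarrow>\<^sub>0 real" assume "Poly_Mapping.keys d \<subseteq> E"
      then show "cellular_boundary \<phi> d \<in> span (edge_boundary \<phi> ` E)"
        unfolding cellular_boundary_eq[OF c(2) \<open>Poly_Mapping.keys d \<subseteq> E\<close>]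
        by (intro real_vector.span_sum real_vector.span_scale real_vector.span_base imageI)
    qed
    then show ?thesis using real_vector.independent_span_bound[of "edge_boundary \<phi> ` E" C] C(1,2) c(2) by auto
  qed
  then have finC: "finite C" using C(1) finite_subset by blast
  have "?s ` V \<subseteq> span (insert (?s v0) C)"
  proof clarify
    fix v assume "v \<in> V"
    then have "?s v - ?s v0 \<in> span (insert (?s v0) C)"
      using all C(3) real_vector.span_mono[of C "insert (?s v0) C"] by blast
    moreover have "?s v0 \<in> span (insert (?s v0) C)" by (rule real_vector.span_base) simp
    ultimately have "(?s v - ?s v0) + ?s v0 \<in> span (insert (?s v0) C)" by (rule real_vector.span_add)
    then show "?s v \<in> span (insert (?s v0) C)" by simp
  qed
  then have "card (?s ` V) \<le> card (insert (?s v0) C)"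
    using real_vector.independent_span_bound[OF _ independent_singles] finC by blast
  also have "\<dots> \<le> card C + 1" using finC by (simp add: card_insert_if)
  finally have "card V \<le> dim ?im + 1" using C(4) by (simp add: card_singles)
  then show ?thesis using first_betti_rank[OF c(2), of \<phi>] by linarith
qed

section \<open>Balls in the trivalent tree\<close>

text \<open>For \<open>R \<ge> 0\<close> this is the length of the ball of radius \<open>R\<close> around the root of the tree that consists
  of an edge at the root and then branches in two after every unit of length: between the distances \<open>n\<close>
  and \<open>n + 1\<close> from the root there are \<open>2 ^ n\<close> edges. In \<open>stem_length\<close> the first edge has the length
  \<open>\<tau>\<close>; the maximum is there because \<open>binary_length\<close> continues by \<open>R\<close> to negative radii.\<close>

definition binary_length :: "real \<Rightarrow> real" where
  "binary_length R = 2 ^ nat \<lfloor>R\<rfloor> * (1 + R - nat \<lfloor>R\<rfloor>) - 1"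

definition stem_length :: "real \<Rightarrow> real \<Rightarrow> real" where
  "stem_length \<tau> R = min R \<tau> + 2 * max 0 (binary_length (R - \<tau>))"

lemma binary_length_short: "R < 1 \<Longrightarrow> binary_length R = R"
proof -
  assume "R < 1"
  then have "nat \<lfloor>R\<rfloor> = 0" by (simp add: floor_less_iff)
  then show ?thesis by (simp add: binary_length_def)
qed

lemma binary_length_step:
  assumes "1 \<le> R"
  shows "binary_length R = 1 + 2 * binary_length (R - 1)"
proof -
  define n where "n = nat \<lfloor>R - 1\<rfloor>"
  have "0 \<le> \<lfloor>R - 1\<rfloor>" using assms by simp
  then have "nat \<lfloor>R\<rfloor> = Suc n" unfolding n_def by linarith
  then show ?thesis unfolding binary_length_def n_def[symmetric] by (simp add: algebra_simps)
qed

text \<open>The slopes of the linear pieces increase, so that each piece, continued to all radii, stays below the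
  function.\<close>

lemma binary_length_ge_affine:
  assumes "0 \<le> R"
  shows "2 ^ m * (1 + R - real m) - 1 \<le> binary_length R"
proof -
  define n where "n = nat \<lfloor>R\<rfloor>"
  have n: "real n \<le> R" "R < real n + 1" using assms by (simp_all add: n_def)
  have "2 ^ m * (1 + R - real m) \<le> 2 ^ n * (1 + R - real n)"
  proof (cases "n \<le> m")
    case True
    then obtain k where k: "m = n + k" using le_Suc_ex by blast
    define x where "x = 1 + R - real n"
    have x: "x \<le> 2" "1 \<le> x" using n by (auto simp: x_def)
    have "2 ^ k * (x - real k) \<le> x"
    proof (cases "k = 0")
      case False
      have "(2 ^ k - 1) * x \<le> (2 ^ k - 1) * 2" using x by (intro mult_left_mono) auto
      also have "\<dots> \<le> 2 ^ k * real k"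
      proof (cases "k = 1")
        case False
        then have "2 ^ k * 2 \<le> 2 ^ k * real k" using \<open>k \<noteq> 0\<close> by (intro mult_left_mono) auto
        moreover have "(2 ^ k - 1) * 2 \<le> (2 ^ k * 2 :: real)" by simp
        ultimately show ?thesis by linarith
      qed simp
      finally show ?thesis by (simp add: algebra_simps)
    qed simp
    then have "2 ^ n * (2 ^ k * (x - real k)) \<le> 2 ^ n * x" by (intro mult_left_mono) auto
    then show ?thesis by (simp add: k x_def power_add algebra_simps)
  next
    case False
    then obtain k where k: "n = m + k" using le_Suc_ex nat_le_linear by blast
    define x where "x = 1 + R - real n"
    have x: "1 \<le> x" using n by (auto simp: x_def)
    have "Suc k \<le> 2 ^ k" by (simp add: Suc_le_eq)
    then have "real (Suc k) \<le> real (2 ^ k)" by (simp only: of_nat_le_iff)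
    then have "1 + real k \<le> 2 ^ k" by simp
    then have "(1 + real k) * x \<le> 2 ^ k * x" using x by (intro mult_right_mono) auto
    moreover have "real k * 1 \<le> real k * x" using x by (intro mult_left_mono) auto
    ultimately have "x + real k \<le> 2 ^ k * x" by (simp add: algebra_simps)
    then have "2 ^ m * (x + real k) \<le> 2 ^ m * (2 ^ k * x)" by (intro mult_left_mono) auto
    then show ?thesis by (simp add: k x_def power_add algebra_simps)
  qed
  then show ?thesis by (simp add: binary_length_def n_def)
qed

lemma binary_length_ge: "0 \<le> R \<Longrightarrow> R \<le> binary_length R"
  using binary_length_ge_affine[of R 0] by simp

lemma binary_length_slope:
  assumes "0 \<le> R" "R \<le> S"
  shows "S - R \<le> binary_length S - binary_length R"
proof -
  define n where "n = nat \<lfloor>R\<rfloor>"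
  have "1 * (S - R) \<le> 2 ^ n * (S - R)" using assms by (intro mult_right_mono) auto
  also have "\<dots> = (2 ^ n * (1 + S - real n) - 1) - binary_length R"
    by (simp add: binary_length_def n_def algebra_simps)
  also have "\<dots> \<le> binary_length S - binary_length R"
    using binary_length_ge_affine[of S n] assms by simp
  finally show ?thesis by simp
qed

text \<open>The linear piece that computes the value at \<open>R - t\<close> is a lower bound at \<open>R\<close> and at \<open>R - 1\<close>.\<close>

lemma binary_length_convex:
  assumes "1 \<le> R" "0 \<le> t" "t \<le> 1"
  shows "binary_length (R - t) \<le> (1 - t) * binary_length R + t * binary_length (R - 1)"
proof -
  define n where "n = nat \<lfloor>R - t\<rfloor>"
  have "binary_length (R - t) = (1 - t) * (2 ^ n * (1 + R - real n) - 1) + t * (2 ^ n * (1 + (R - 1) - real n) - 1)"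
    by (simp add: binary_length_def n_def algebra_simps)
  also have "\<dots> \<le> (1 - t) * binary_length R + t * binary_length (R - 1)"
    using assms by (intro add_mono mult_left_mono binary_length_ge_affine) auto
  finally show ?thesis .
qed

lemma stem_length_one: "stem_length 1 R = binary_length R"
proof (cases "R < 1")
  case True
  then show ?thesis by (simp add: stem_length_def binary_length_short)
next
  case False
  then show ?thesis
    using binary_length_ge[of "R - 1"] binary_length_step[of R] by (simp add: stem_length_def)
qed

lemma stem_length_small: "R \<le> \<tau> \<Longrightarrow> stem_length \<tau> R = R"
  by (simp add: stem_length_def binary_length_short)

lemma stem_length_large: "\<tau> \<le> R \<Longrightarrow> stem_length \<tau> R = \<tau> + 2 * binary_length (R - \<tau>)"
  using binary_length_ge[of "R - \<tau>"] by (simp add: stem_length_def)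

lemma stem_length_step: "l \<le> R \<Longrightarrow> l \<le> \<tau> \<Longrightarrow> stem_length \<tau> R = l + stem_length (\<tau> - l) (R - l)"
  by (simp add: stem_length_def min_def)

lemma stem_length_antimono:
  assumes "\<tau> \<le> \<tau>'"
  shows "stem_length \<tau>' R \<le> stem_length \<tau> R"
proof -
  consider "R \<le> \<tau>" | "\<tau> < R" "R \<le> \<tau>'" | "\<tau>' < R" using assms by linarith
  then show ?thesis
  proof cases
    case 1
    then show ?thesis using assms by (simp add: stem_length_small)
  next
    case 2
    then show ?thesis
      using binary_length_ge[of "R - \<tau>"] by (simp add: stem_length_small stem_length_large)
  next
    case 3
    then show ?thesis
      using assms binary_length_slope[of "R - \<tau>'" "R - \<tau>"] by (simp add: stem_length_large)
  qed
qed

text \<open>The two summands belong to the two sides of a point that divides an edge into parts of length \<open>\<tau>\<close> and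
  \<open>1 - \<tau>\<close>. By convexity the sum is largest for \<open>\<tau> = 0\<close>, when the point is a vertex.\<close>

lemma stem_length_sum_le:
  assumes "0 \<le> R" "0 \<le> \<tau>" "\<tau> \<le> 1"
  shows "stem_length \<tau> R + stem_length (1 - \<tau>) R \<le> 3 * binary_length R"
proof (cases "R < 1")
  case True
  then show ?thesis
    using assms by (auto simp: stem_length_def binary_length_short min_def max_def)
next
  case False
  have "binary_length (R - \<tau>) + binary_length (R - (1 - \<tau>)) \<le> binary_length R + binary_length (R - 1)"
    using binary_length_convex[of R \<tau>] binary_length_convex[of R "1 - \<tau>"] False assms
    by (simp add: algebra_simps)
  moreover have "binary_length R = 1 + 2 * binary_length (R - 1)"
    using False by (intro binary_length_step) simp
  ultimately show ?thesis using False assms by (simp add: stem_length_large)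
qed

lemma stem_length_ennreal:
  assumes "0 \<le> R" "0 \<le> \<tau>"
  shows "ennreal (min R \<tau>) + 2 * ennreal (binary_length (R - \<tau>)) = ennreal (stem_length \<tau> R)"
proof -
  have "ennreal (binary_length (R - \<tau>)) = ennreal (max 0 (binary_length (R - \<tau>)))"
    by (simp add: max_def ennreal_neg)
  then show ?thesis
    using assms by (simp add: stem_length_def ennreal_plus ennreal_mult)
qed

section \<open>Growth of graph covers\<close>

context graph_cover
begin

definition edge_length :: "'e \<Rightarrow> real" where
  "edge_length e = enn2real (hausdorff1 (\<phi> e ` {0<..<1}))"

lemma dist_lift:
  assumes b: "based y x"
  shows "ennreal (dist y (lift y x 1)) = hausdorff1 (\<phi> (fst x) ` {0<..<1})"
    and "dist y (lift y x 1) = edge_length (fst x)"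
proof -
  have "(p \<circ> lift y x) ` {0<..<1} = dpath x ` {0<..<1}"
    by (rule image_cong) (use lift(5)[OF b] in auto)
  then show "ennreal (dist y (lift y x 1)) = hausdorff1 (\<phi> (fst x) ` {0<..<1})"
    using arc_cell_dist[OF arc_cell_lift[OF b], of 1] arc_cell_length[OF arc_cell_lift[OF b], of 0 1]
      lift(3)[OF b] dart_path_image[of \<phi> x] by simp
  then show "dist y (lift y x 1) = edge_length (fst x)"
    unfolding edge_length_def by (metis enn2real_ennreal zero_le_dist)
qed

lemma based_exists:
  assumes "x \<in> darts"
  obtains y where "based y x"
proof -
  have "dpath x 0 \<in> p ` Y"
    using dpathD(4)[OF assms, of 0] covering_space_imp_surjective[OF covering] by simp
  then show ?thesis using that assms by (auto simp: based_def)
qed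

lemma edge_length:
  assumes "e \<in> E"
  shows "0 < edge_length e" "ennreal (edge_length e) = hausdorff1 (\<phi> e ` {0<..<1})"
proof -
  have "(e, True) \<in> darts" using assms by (simp add: darts_def)
  then obtain y where b: "based y (e, True)" by (rule based_exists)
  have "y \<noteq> lift y (e, True) 1"
    using open_cell_ends_neq[OF simply_conn open_cell_lift[OF b]] lift(3)[OF b] by simp
  then show "0 < edge_length e" using dist_lift(2)[OF b] by (metis fst_conv zero_less_dist_iff)
  show "ennreal (edge_length e) = hausdorff1 (\<phi> e ` {0<..<1})" using dist_lift[OF b] by simp
qed

text \<open>Open edges are disjoint, and for open arcs inner and outer measure agree.\<close>

lemma sum_edge_length_le: "(\<Sum>e\<in>E. ennreal (edge_length e)) \<le> hausdorff1 X"
proof -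
  have "(\<Sum>e\<in>E. ennreal (edge_length e)) = (\<Sum>e\<in>E. inner_hausdorff1 (\<phi> e ` {0<..<1}))"
  proof (rule sum.cong[OF refl])
    fix e assume e: "e \<in> E"
    have "inner_hausdorff1 (\<phi> e ` {0<..<1}) = hausdorff1 (\<phi> e ` {0<..<1})"
      by (rule hausdorff1_open_arc(2)) (use cw_graphD(4,7)[OF cw e] in \<open>auto simp: path_def\<close>)
    then show "ennreal (edge_length e) = inner_hausdorff1 (\<phi> e ` {0<..<1})"
      using edge_length(2)[OF e] by simp
  qed
  also have "\<dots> \<le> inner_hausdorff1 (\<Union>e\<in>E. \<phi> e ` {0<..<1})"
    by (rule inner_hausdorff1_UN) (use cw_graphD(2,9)[OF cw] in auto)
  also have "\<dots> \<le> hausdorff1 (\<Union>e\<in>E. \<phi> e ` {0<..<1})" by (rule inner_le_hausdorff1)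
  also have "\<dots> \<le> hausdorff1 X"
  proof (rule hausdorff1_mono, rule UN_least)
    fix e assume "e \<in> E"
    then show "\<phi> e ` {0<..<1} \<subseteq> X"
      using dart_pathD(4)[OF cw, of "(e, True)"] by (auto simp: dart_path_def)
  qed
  finally show ?thesis .
qed

lemma finite_darts: "finite darts"
  using cw_graphD(2)[OF cw] by (simp add: darts_def)

lemma based_next: "based y x \<Longrightarrow> x' \<in> darts \<Longrightarrow> dpath x' 0 = dpath (dart_rev x) 0 \<Longrightarrow> based (lift y x 1) x'"
  using lift_in_fibre[of y x] by (simp add: based_def)

text \<open>Following one dart shortens both the radius and the distance to the next branching vertex by the length of
  the edge; at a branching vertex at least two darts continue, each of them with distance at most \<open>1\<close> to
  the next such vertex. The induction is on the number of steps, which the least edge length bounds.\<close>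

lemma branch_growth_ge:
  assumes D: "D \<subseteq> darts" and early: "early_branching D (\<lambda>x. dpath x 0) edge_length C"
    and b: "based y x" and Cx: "C x \<tau>" and R: "0 \<le> R"
  shows "ennreal (stem_length \<tau> R) \<le> inner_hausdorff1 (branch Y (lift y x) \<inter> ball y R)"
proof -
  have start: "C x 1" if "x \<in> D" "3 \<le> card {z \<in> D. dpath z 0 = dpath x 0}" for x
    using early that unfolding early_branching_def by blast
  have C: "x \<in> D \<and> edge_length (fst x) \<le> \<tau> \<and> \<tau> \<le> 1 \<and>
       (3 \<le> card {z \<in> D. dpath z 0 = dpath (dart_rev x) 0} \<or>
        (\<exists>x'\<in>D. dpath x' 0 = dpath (dart_rev x) 0 \<and> x' \<noteq> dart_rev x \<and> C x' (\<tau> - edge_length (fst x))))"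
    if "C x \<tau>" for x \<tau>
    using early that unfolding early_branching_def by blast
  \<comment> \<open>The number \<open>1\<close> only keeps the set from being empty.\<close>
  define \<delta> where "\<delta> = Min (insert 1 (edge_length ` E))"
  have finE: "finite (insert 1 (edge_length ` E))" using cw_graphD(2)[OF cw] by simp
  have "\<delta> \<in> insert 1 (edge_length ` E)" unfolding \<delta>_def by (rule Min_in[OF finE]) simp
  then have \<delta>: "0 < \<delta>" using edge_length(1) by auto
  have \<delta>_le: "\<delta> \<le> edge_length e" if "e \<in> E" for e unfolding \<delta>_def using finE that by simp
  have "ennreal (stem_length \<tau> R) \<le> inner_hausdorff1 (branch Y (lift y x) \<inter> ball y R)"
    if "based y x" "C x \<tau>" "0 \<le> R" "R \<le> real n * \<delta>" for n y x \<tau> R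
    using that
  proof (induction n arbitrary: y x \<tau> R)
    case 0
    then have "R = 0" "0 \<le> \<tau>" using C[OF 0(2)] edge_length(1)[of "fst x"] D by (auto simp: darts_def)
    then show ?case by (simp add: stem_length_small)
  next
    case (Suc n)
    note b = Suc.prems(1)
    have x: "x \<in> D" "edge_length (fst x) \<le> \<tau>" "\<tau> \<le> 1" using C[OF Suc.prems(2)] by auto
    define l where "l = edge_length (fst x)"
    have l: "\<delta> \<le> l" "l \<le> \<tau>" using x D by (auto simp: l_def darts_def intro!: \<delta>_le)
    note cell = arc_cell_lift[OF b]
    have dl: "dist (lift y x 0) (lift y x 1) = l" using dist_lift(2)[OF b] lift(3)[OF b] by (simp add: l_def)
    show ?case
    proof (cases "R \<le> l")
      case True
      then show ?thesis
        using branch_ball_ge_short[OF cell, of R] dl lift(3)[OF b] Suc.prems(3) l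
        by (simp add: stem_length_small)
    next
      case False
      then have Rl: "l \<le> R" "0 \<le> R - l" "R - l \<le> real n * \<delta>"
        using Suc.prems(4) l(1) by (auto simp: algebra_simps)
      define w where "w = lift y x 1"
      \<comment> \<open>The bound that the darts of \<open>I\<close>, which continue the walk, contribute.\<close>
      have grow: "ennreal l + (\<Sum>i\<in>I. ennreal (stem_length (\<sigma> i) (R - l)))
          \<le> inner_hausdorff1 (branch Y (lift y x) \<inter> ball y R)"
        if I: "I \<subseteq> {z \<in> D. dpath z 0 = dpath (dart_rev x) 0} - {dart_rev x}"
          and \<sigma>: "\<And>i. i \<in> I \<Longrightarrow> C i (\<sigma> i)" for I \<sigma>
      proof -
        have bI: "based w i" if "i \<in> I" for i
          unfolding w_def by (rule based_next[OF b]) (use I D that in auto)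
        have "ennreal l + (\<Sum>i\<in>I. ennreal (stem_length (\<sigma> i) (R - l)))
            \<le> ennreal l + (\<Sum>i\<in>I. inner_hausdorff1 (branch Y (lift w i) \<inter> ball w (R - l)))"
          by (intro add_left_mono sum_mono Suc.IH bI \<sigma> Rl)
        also have "\<dots> \<le> inner_hausdorff1 (branch Y (lift y x) \<inter> ball y R)"
        proof -
          have "I \<subseteq> darts" using I D by auto
          then have fin: "finite I" using finite_darts by (rule finite_subset)
          have disj: "disjoint_family_on (\<lambda>i. lift w i ` {0<..<1}) I"
            unfolding disjoint_family_on_def by (intro ballI impI lift_disjoint bI)
          have next_disj: "lift y x ` {0<..<1} \<inter> lift w i ` {0<..<1} = {}" if "i \<in> I" for i
            unfolding w_def by (rule lift_disjoint_next[OF b]) (use bI[OF that] that I w_def in auto)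
          have "ennreal (dist (lift y x 0) (lift y x 1)) + (\<Sum>i\<in>I. inner_hausdorff1
                (branch Y (lift w i) \<inter> ball (lift y x 1) (R - dist (lift y x 0) (lift y x 1))))
              \<le> inner_hausdorff1 (branch Y (lift y x) \<inter> ball (lift y x 0) R)"
            by (rule branch_ball_ge_step[OF cell _ fin])
               (use Rl(1) dl arc_cell_lift[OF bI] lift(3)[OF bI] next_disj disj w_def in simp_all)
          then show ?thesis unfolding dl unfolding lift(3)[OF b] w_def[symmetric] .
        qed
        finally show ?thesis .
      qed
      consider "3 \<le> card {z \<in> D. dpath z 0 = dpath (dart_rev x) 0}"
        | x' where "x' \<in> D" "dpath x' 0 = dpath (dart_rev x) 0" "x' \<noteq> dart_rev x" "C x' (\<tau> - l)"
        using C[OF Suc.prems(2)] unfolding l_def by blast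
      then show ?thesis
      proof cases
        case 1
        define I where "I = {z \<in> D. dpath z 0 = dpath (dart_rev x) 0} - {dart_rev x}"
        have "finite {z \<in> D. dpath z 0 = dpath (dart_rev x) 0}"
          by (rule finite_subset[OF _ finite_darts]) (use D in auto)
        then have "card {z \<in> D. dpath z 0 = dpath (dart_rev x) 0} - 1 \<le> card I"
          by (simp add: I_def card_Diff_singleton_if)
        then have card: "2 \<le> card I" using 1 by linarith
        have "C i 1" if "i \<in> I" for i using that start[of i] 1 by (simp add: I_def)
        then have "ennreal l + (\<Sum>i\<in>I. ennreal (stem_length 1 (R - l)))
            \<le> inner_hausdorff1 (branch Y (lift y x) \<inter> ball y R)"
          by (intro grow) (simp_all add: I_def)
        note via_I = this
        have "(2::ennreal) \<le> of_nat (card I)" using of_nat_mono[OF card, where 'a = ennreal] by simp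
        then have "2 * ennreal (binary_length (R - l)) \<le> of_nat (card I) * ennreal (binary_length (R - l))"
          by (intro mult_right_mono) simp_all
        then have two: "2 * ennreal (binary_length (R - l)) \<le> (\<Sum>i\<in>I. ennreal (stem_length 1 (R - l)))"
          by (simp add: stem_length_one)
        have "ennreal (stem_length \<tau> R) \<le> ennreal (stem_length l R)"
          by (intro ennreal_leI stem_length_antimono l)
        also have "\<dots> = ennreal l + 2 * ennreal (binary_length (R - l))"
          using stem_length_ennreal[of R l] Rl \<delta> l by simp
        also have "\<dots> \<le> ennreal l + (\<Sum>i\<in>I. ennreal (stem_length 1 (R - l)))"
          by (rule add_left_mono[OF two])
        also note via_I
        finally show ?thesis .
      next
        case 2
        have "ennreal l + ennreal (stem_length (\<tau> - l) (R - l))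
            \<le> inner_hausdorff1 (branch Y (lift y x) \<inter> ball y R)"
          using grow[of "{x'}" "\<lambda>_. \<tau> - l"] 2 by simp
        moreover have "ennreal (stem_length \<tau> R) \<le> ennreal l + ennreal (stem_length (\<tau> - l) (R - l))"
          using stem_length_step[of l R \<tau>] Rl l \<delta> by (simp add: ennreal_plus_if)
        ultimately show ?thesis by (rule order_trans[rotated])
      qed
    qed
  qed
  moreover obtain n where "R / \<delta> \<le> real n" using real_arch_simple by blast
  then have "R \<le> real n * \<delta>" using \<delta> by (simp add: field_simps)
  ultimately show ?thesis using b Cx R by blast
qed

lemma ball_length_ge:
  assumes I: "I \<subseteq> darts" "\<And>x. x \<in> I \<Longrightarrow> dpath x 0 = p y" and y: "y \<in> Y"
    and ge: "\<And>x. x \<in> I \<Longrightarrow> c \<le> inner_hausdorff1 (branch Y (lift y x) \<inter> ball y R)"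
  shows "of_nat (card I) * c \<le> ball_length Y y R"
proof -
  have b: "based y x" if "x \<in> I" for x using I y that by (auto simp: based_def)
  have "of_nat (card I) * c = (\<Sum>x\<in>I. c)" by simp
  also have "\<dots> \<le> (\<Sum>x\<in>I. inner_hausdorff1 (branch Y (lift y x) \<inter> ball y R))"
    by (intro sum_mono ge)
  also have "\<dots> \<le> inner_hausdorff1 (\<Union>x\<in>I. branch Y (lift y x) \<inter> ball y R)"
  proof (rule inner_hausdorff1_UN)
    show "finite I" using I(1) finite_darts finite_subset by blast
    show "disjoint_family_on (\<lambda>x. branch Y (lift y x) \<inter> ball y R) I"
      unfolding disjoint_family_on_def
    proof (intro ballI impI)
      fix i j assume "i \<in> I" "j \<in> I" "i \<noteq> j"
      then have "branch Y (lift y i) \<inter> branch Y (lift y j) = {}" by (intro branch_lift_disjoint b)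
      then show "(branch Y (lift y i) \<inter> ball y R) \<inter> (branch Y (lift y j) \<inter> ball y R) = {}" by blast
    qed
  qed
  also have "\<dots> \<le> hausdorff1 (\<Union>x\<in>I. branch Y (lift y x) \<inter> ball y R)" by (rule inner_le_hausdorff1)
  also have "\<dots> \<le> ball_length Y y R"
    unfolding ball_length_def by (intro hausdorff1_mono UN_least) (use branch_subset[of Y] in blast)
  finally show ?thesis .
qed

end

locale trivalent_cover = graph_cover Y p X V E \<phi>
  for Y :: "'b::metric_space set" and p :: "'b \<Rightarrow> 'a::metric_space" and X
    and V :: "'a set" and E :: "'e set" and \<phi> :: "'e \<Rightarrow> real \<Rightarrow> 'a" +
  assumes degree3: "\<And>v. v \<in> V \<Longrightarrow> card {x \<in> E \<times> UNIV. dart_path \<phi> x 0 = v} = 3"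
    and unit: "\<And>e. e \<in> E \<Longrightarrow> hausdorff1 (\<phi> e ` {0<..<1}) = 1"
begin

lemma unit_length: "x \<in> darts \<Longrightarrow> edge_length (fst x) = 1"
  using unit[of "fst x"] by (auto simp: edge_length_def darts_def)

definition others :: "'e \<times> bool \<Rightarrow> ('e \<times> bool) set" where
  "others x = {z \<in> darts. dpath z 0 = dpath x 0} - {x}"

lemma card_others:
  assumes "x \<in> darts"
  shows "finite (others x)" "card (others x) = 2"
proof -
  have "finite {z \<in> darts. dpath z 0 = dpath x 0}" using finite_darts by simp
  moreover have "card {z \<in> darts. dpath z 0 = dpath x 0} = 3"
    using degree3[OF dpathD(7)[OF assms]] by (simp add: darts_def)
  ultimately show "finite (others x)" "card (others x) = 2" using assms by (auto simp: others_def)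
qed

lemma sum_others_le:
  assumes "x \<in> darts" and "\<And>i. i \<in> others x \<Longrightarrow> h i \<le> c"
  shows "(\<Sum>i\<in>others x. h i) \<le> 2 * (c::ennreal)"
  using sum_bounded_above[of "others x" h c] assms card_others by simp

lemma based_others:
  assumes "based y x" "i \<in> others x"
  shows "based y i" "i \<noteq> x"
  using assms by (auto simp: based_def others_def)

lemma branch_cases:
  assumes b: "based y x" and z: "z \<in> Y" "z \<noteq> y" "z \<notin> branch Y (lift y x)"
  obtains i where "i \<in> others x" "z \<in> branch Y (lift y i)"
proof -
  have x: "x \<in> darts" "y \<in> Y" "p y = dpath x 0" using b by (auto simp: based_def)
  obtain i where i: "based y i" "z \<in> branch Y (lift y i)"
    by (rule branches_cover[OF x(2) _ z(1,2)]) (use dpathD(7)[OF x(1)] x(3) in auto)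
  then have "i \<in> others x" using z(3) x by (auto simp: others_def based_def)
  then show ?thesis using that i by blast
qed

text \<open>A point of the branch lies on the first cell, at its end, or in one of the two branches that continue
  there; a point in one of these is further away by the length \<open>1\<close> of the cell.\<close>

lemma branch_growth_le:
  assumes "based y x"
  shows "hausdorff1 (branch Y (lift y x) \<inter> ball y R) \<le> ennreal (binary_length R)"
proof -
  have "hausdorff1 (branch Y (lift y x) \<inter> ball y R) \<le> ennreal (binary_length R)"
    if "based y x" "R \<le> real n" for n y x R
    using that
  proof (induction n arbitrary: y x R)
    case 0
    then have "branch Y (lift y x) \<inter> ball y R = {}" by (simp add: ball_empty)
    then show ?case by (simp only: hausdorff1_empty zero_le)
  next
    case (Suc n)
    note b = Suc.prems(1)
    show ?case
    proof (cases "0 < R")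
      case False
      then have "branch Y (lift y x) \<inter> ball y R = {}" by (simp add: ball_empty)
      then show ?thesis by (simp only: hausdorff1_empty zero_le)
    next
      case True
      define w where "w = lift y x 1"
      define rx where "rx = dart_rev x"
      have x: "x \<in> darts" "rx \<in> darts" using b by (auto simp: based_def rx_def)
      have dw: "dist y w = 1" using dist_lift(2)[OF b] unit_length[OF x(1)] by (simp add: w_def)
      have brx: "based w rx" using lift_in_fibre(2)[OF b] by (simp add: w_def rx_def)
      have a0: "lift y x 0 = y" using lift(3)[OF b] .
      let ?A = "lift y x ` {0<..<1} \<inter> ball y R"
      let ?B = "\<lambda>i. branch Y (lift w i) \<inter> ball w (R - 1)"
      have "branch Y (lift y x) \<inter> ball y R \<subseteq> ?A \<union> ({w} \<union> (\<Union>i\<in>others rx. ?B i))"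
      proof
        fix z assume z: "z \<in> branch Y (lift y x) \<inter> ball y R"
        then have zY: "z \<in> Y" using branch_subset[of Y "lift y x"] by blast
        consider "z = w" | "z \<in> branch Y (lift w rx)" | "z \<noteq> w" "z \<notin> branch Y (lift w rx)" by blast
        then show "z \<in> ?A \<union> ({w} \<union> (\<Union>i\<in>others rx. ?B i))"
        proof cases
          case 2
          then have "z \<in> branch Y (reversepath (lift y x))"
            using branch_lift_rev[OF b] by (simp add: w_def rx_def)
          then have "z \<in> lift y x ` {0<..<1}"
            using branch_reverse_Int[OF simply_conn open_cell_lift[OF b]] z by blast
          then show ?thesis using z by blast
        next
          case 3
          then obtain i where i: "i \<in> others rx" "z \<in> branch Y (lift w i)"
            using branch_cases[OF brx zY] by blast
          note bi = based_others[OF brx i(1)]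
          have "lift y x ` {0<..<1} \<inter> lift w i ` {0<..<1} = {}"
            using lift_disjoint_next[OF b bi(1)[unfolded w_def]] bi(2) by (simp add: w_def rx_def)
          then have "branch Y (lift w i) \<inter> lift y x ` {0..1} = {}"
            by (intro branch_nested(2)[OF simply_conn] open_cell_lift b bi)
               (simp_all add: lift(3)[OF bi(1)], simp add: w_def)
          moreover have "y \<in> lift y x ` {0..1}" using a0 by (intro image_eqI[of _ _ 0]) auto
          ultimately have "y \<notin> branch Y (lift w i)" by blast
          then have "dist y z = 1 + dist w z"
            using dist_into_branch[of y "lift w i" z] open_cell_lift[OF bi(1)] i(2) lift(3)[OF bi(1)] dw b
            by (simp add: based_def)
          then show ?thesis using z i by auto
        qed blast
      qed
      then have "hausdorff1 (branch Y (lift y x) \<inter> ball y R) \<le> hausdorff1 (?A \<union> ({w} \<union> (\<Union>i\<in>others rx. ?B i)))"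
        by (rule hausdorff1_mono)
      also have "\<dots> \<le> hausdorff1 ?A + (hausdorff1 {w} + (\<Sum>i\<in>others rx. hausdorff1 (?B i)))"
        by (intro order_trans[OF hausdorff1_Un] add_left_mono hausdorff1_UN card_others x)
      also have "\<dots> \<le> ennreal (min R 1) + (0 + 2 * ennreal (binary_length (R - 1)))"
      proof (intro add_mono)
        show "hausdorff1 ?A \<le> ennreal (min R 1)"
          using hausdorff1_arc_cell_ball[OF arc_cell_lift[OF b], of R] True a0 dw by (simp add: w_def)
        show "(\<Sum>i\<in>others rx. hausdorff1 (?B i)) \<le> 2 * ennreal (binary_length (R - 1))"
          by (rule sum_others_le[OF x(2)], rule Suc.IH) (use based_others[OF brx] Suc.prems(2) in auto)
      qed simp
      also have "\<dots> = ennreal (binary_length R)"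
        using stem_length_ennreal[of R 1] True by (simp add: stem_length_one)
      finally show ?thesis .
    qed
  qed
  moreover obtain n where "R \<le> real n" using real_arch_simple by blast
  ultimately show ?thesis using assms by blast
qed

lemma ball_length_vertex_le:
  assumes y: "y \<in> Y" "p y \<in> V"
  shows "ball_length Y y R \<le> 3 * ennreal (binary_length R)"
proof -
  define I where "I = {x \<in> darts. dpath x 0 = p y}"
  have I: "finite I" "card I = 3" using finite_darts degree3[OF y(2)] by (auto simp: I_def darts_def)
  have b: "based y x" if "x \<in> I" for x using that y by (simp add: I_def based_def)
  have "Y \<inter> ball y R \<subseteq> {y} \<union> (\<Union>x\<in>I. branch Y (lift y x) \<inter> ball y R)"
  proof
    fix z assume z: "z \<in> Y \<inter> ball y R"
    show "z \<in> {y} \<union> (\<Union>x\<in>I. branch Y (lift y x) \<inter> ball y R)"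
    proof (cases "z = y")
      case False
      obtain x where x: "based y x" "z \<in> branch Y (lift y x)"
        by (rule branches_cover[OF y, of z]) (use z False in auto)
      then have "x \<in> I" by (simp add: I_def based_def)
      then show ?thesis using z x(2) by blast
    qed simp
  qed
  then have "ball_length Y y R \<le> hausdorff1 ({y} \<union> (\<Union>x\<in>I. branch Y (lift y x) \<inter> ball y R))"
    unfolding ball_length_def by (rule hausdorff1_mono)
  also have "\<dots> \<le> hausdorff1 {y} + (\<Sum>x\<in>I. hausdorff1 (branch Y (lift y x) \<inter> ball y R))"
    by (intro order_trans[OF hausdorff1_Un] add_left_mono hausdorff1_UN I)
  also have "\<dots> \<le> 0 + of_nat (card I) * ennreal (binary_length R)"
    by (intro add_mono sum_bounded_above branch_growth_le b) auto
  finally show ?thesis using I(2) by simp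
qed

text \<open>Up to finitely many points the ball lies in the two parts into which its centre divides the edge, and in
  four branches, two at each end of the edge.\<close>

lemma ball_length_edge_le:
  assumes b: "based y x" and s: "s \<in> {0<..<1}" and R: "0 \<le> R"
  shows "ball_length Y (lift y x s) R \<le> 3 * ennreal (binary_length R)"
proof -
  define h where "h = lift y x"
  define v where "v = h s"
  define w where "w = h 1"
  define rx where "rx = dart_rev x"
  define \<alpha> where "\<alpha> = subarc s 1 h"
  define \<beta> where "\<beta> = reversepath (subarc 0 s h)"
  have x: "x \<in> darts" "rx \<in> darts" "y \<in> Y" using b by (auto simp: based_def rx_def)
  note cell = arc_cell_lift[OF b, folded h_def] and oc = open_cell_lift[OF b, folded h_def]
  have h0: "h 0 = y" using lift(3)[OF b] by (simp add: h_def)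
  have brx: "based w rx" using lift_in_fibre(2)[OF b] by (simp add: w_def rx_def h_def)
  have vY: "v \<in> Y" using lift(4)[OF b, of s] s by (simp add: v_def h_def)
  have ca: "arc_cell \<alpha>" "\<alpha> 0 = v" "\<alpha> 1 = w" "\<alpha> ` {0<..<1} = h ` {s<..<1}"
    using s by (auto simp: \<alpha>_def v_def w_def subarc_image intro!: arc_cell_subarc[OF cell])
  have cb: "arc_cell \<beta>" "\<beta> 0 = v" "\<beta> 1 = y" "\<beta> ` {0<..<1} = h ` {0<..<s}"
    using s by (auto simp: \<beta>_def v_def h0 reversepath_image subarc_image intro!: arc_cell_reversepath arc_cell_subarc[OF cell])
       (simp_all add: reversepath_def h0)
  define \<tau> where "\<tau> = dist v w"
  have "dist (h 0) (h 1) = 1" using dist_lift(2)[OF b] unit_length[OF x(1)] by (simp add: h_def h0[unfolded h_def])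
  moreover have "dist (h 0) (h 1) = dist (h 0) (h s) + dist (h s) (h 1)"
    using arc_cell_geodesic[OF cell, of s 1] s by simp
  ultimately have "dist v y = 1 - \<tau>" by (simp add: \<tau>_def v_def w_def h0 dist_commute)
  moreover from this have "\<tau> \<le> 1" using zero_le_dist[of v y] by linarith
  ultimately have \<tau>: "dist v y = 1 - \<tau>" "0 \<le> \<tau>" "\<tau> \<le> 1" by (simp_all add: \<tau>_def)
  let ?A = "\<alpha> ` {0<..<1} \<inter> ball v R" and ?B = "\<beta> ` {0<..<1} \<inter> ball v R"
  let ?P = "\<lambda>i. branch Y (lift w i) \<inter> ball w (R - \<tau>)"
  let ?Q = "\<lambda>i. branch Y (lift y i) \<inter> ball y (R - (1 - \<tau>))"
  let ?U = "{y, w, v} \<union> ((?A \<union> (\<Union>i\<in>others rx. ?P i)) \<union> (?B \<union> (\<Union>i\<in>others x. ?Q i)))"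
  have "Y \<inter> ball v R \<subseteq> ?U"
  proof
    fix z assume z: "z \<in> Y \<inter> ball v R"
    consider "z \<in> {y, w}" | "z \<notin> {y, w}" "z \<notin> branch Y h" | "z \<notin> {y, w}" "z \<notin> branch Y (lift w rx)"
      | "z \<in> branch Y h" "z \<in> branch Y (lift w rx)" by blast
    then show "z \<in> ?U"
    proof cases
      case 2
      then obtain i where i: "i \<in> others x" "z \<in> branch Y (lift y i)"
        using branch_cases[OF b, of z] z by (auto simp: h_def)
      note bi = based_others[OF b i(1)]
      have "v \<in> branch Y h" unfolding v_def by (rule open_cell_arc_in_branch[OF simply_conn oc]) (use s in auto)
      then have "v \<notin> branch Y (lift y i)" using branch_lift_disjoint[OF b bi(1)] bi(2) by (auto simp: h_def)
      then have "dist v z = (1 - \<tau>) + dist y z"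
        using dist_into_branch[OF vY _ open_cell_lift[OF bi(1)] i(2)] lift(3)[OF bi(1)] \<tau>(1) by simp
      then show ?thesis using z i by auto
    next
      case 3
      then obtain i where i: "i \<in> others rx" "z \<in> branch Y (lift w i)"
        using branch_cases[OF brx, of z] z by auto
      note bi = based_others[OF brx i(1)]
      have "h ` {0<..<1} \<inter> lift w i ` {0<..<1} = {}"
        using lift_disjoint_next[OF b bi(1)[unfolded w_def h_def]] bi(2) by (simp add: w_def rx_def h_def)
      then have "branch Y (lift w i) \<inter> h ` {0..1} = {}"
        by (intro branch_nested(2)[OF simply_conn] oc open_cell_lift bi)
           (simp_all add: lift(3)[OF bi(1)], simp add: w_def)
      moreover have "v \<in> h ` {0..1}" using s by (auto simp: v_def)
      ultimately have "v \<notin> branch Y (lift w i)" by blast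
      then have "dist v z = \<tau> + dist w z"
        using dist_into_branch[OF vY _ open_cell_lift[OF bi(1)] i(2)] lift(3)[OF bi(1)] by (simp add: \<tau>_def)
      then show ?thesis using z i by auto
    next
      case 4
      then have "z \<in> branch Y (reversepath h)"
        using branch_lift_rev[OF b] by (simp add: w_def rx_def h_def)
      then have "z \<in> h ` {0<..<1}" using branch_reverse_Int[OF simply_conn oc 4(1)] by simp
      then obtain t where t: "t \<in> {0<..<1}" "z = h t" by blast
      consider "t < s" | "t = s" | "s < t" by linarith
      then have "z \<in> \<alpha> ` {0<..<1} \<union> {v} \<union> \<beta> ` {0<..<1}"
        unfolding ca(4) cb(4) v_def using t by cases auto
      then show ?thesis using z by blast
    qed blast
  qed
  then have "ball_length Y v R \<le> hausdorff1 ?U"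
    unfolding ball_length_def by (rule hausdorff1_mono)
  also have "\<dots> \<le> hausdorff1 {y, w, v} + ((hausdorff1 ?A + (\<Sum>i\<in>others rx. hausdorff1 (?P i)))
      + (hausdorff1 ?B + (\<Sum>i\<in>others x. hausdorff1 (?Q i))))"
    by (intro order_trans[OF hausdorff1_Un] add_mono order_refl hausdorff1_UN card_others x)
  also have "\<dots> \<le> 0 + ((ennreal (min R \<tau>) + 2 * ennreal (binary_length (R - \<tau>)))
      + (ennreal (min R (1 - \<tau>)) + 2 * ennreal (binary_length (R - (1 - \<tau>)))))"
  proof (intro add_mono)
    show "hausdorff1 ?A \<le> ennreal (min R \<tau>)"
      using hausdorff1_arc_cell_ball[OF ca(1) R] ca(2,3) by (simp add: \<tau>_def)
    show "hausdorff1 ?B \<le> ennreal (min R (1 - \<tau>))"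
      using hausdorff1_arc_cell_ball[OF cb(1) R] cb(2,3) \<tau>(1) by simp
    show "(\<Sum>i\<in>others rx. hausdorff1 (?P i)) \<le> 2 * ennreal (binary_length (R - \<tau>))"
      by (rule sum_others_le[OF x(2)], rule branch_growth_le) (rule based_others[OF brx])
    show "(\<Sum>i\<in>others x. hausdorff1 (?Q i)) \<le> 2 * ennreal (binary_length (R - (1 - \<tau>)))"
      by (rule sum_others_le[OF x(1)], rule branch_growth_le) (rule based_others[OF b])
  qed (simp add: hausdorff1_finite)
  also have "\<dots> = ennreal (stem_length \<tau> R) + ennreal (stem_length (1 - \<tau>) R)"
    using stem_length_ennreal[OF R] \<tau> by simp
  also have "\<dots> \<le> ennreal (3 * binary_length R)"
  proof -
    have "0 \<le> stem_length t R" if "0 \<le> t" for t using R that by (simp add: stem_length_def)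
    then show ?thesis
      using stem_length_sum_le[OF R \<tau>(2,3)] \<tau> by (simp add: ennreal_plus[symmetric] ennreal_leI del: ennreal_plus)
  qed
  also have "\<dots> = 3 * ennreal (binary_length R)"
    using binary_length_ge[OF R] R by (simp add: ennreal_mult)
  finally show ?thesis by (simp add: v_def h_def)
qed

lemma sup_ball_length_le:
  assumes R: "0 \<le> R"
  shows "sup_ball_length Y R \<le> 3 * ennreal (binary_length R)"
  unfolding sup_ball_length_def
proof (rule SUP_least)
  fix v assume v: "v \<in> Y"
  show "ball_length Y v R \<le> 3 * ennreal (binary_length R)"
  proof (cases "p v \<in> V")
    case True
    then show ?thesis by (rule ball_length_vertex_le[OF v])
  next
    case False
    then obtain y x where "based y x" "v \<in> lift y x ` {0<..<1}" by (rule lift_through[OF v])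
    then show ?thesis using ball_length_edge_le[OF _ _ R] by blast
  qed
qed

end

section \<open>The comparison of growth\<close>

lemma card_darts_at:
  assumes "finite E"
  shows "card {x \<in> E \<times> UNIV. dart_path \<phi> x 0 = v} = vertex_degree E \<phi> v"
proof -
  let ?P = "{e \<in> E. pathstart (\<phi> e) = v}" and ?Q = "{e \<in> E. pathfinish (\<phi> e) = v}"
  have "{x \<in> E \<times> UNIV. dart_path \<phi> x 0 = v} = (\<lambda>e. (e, True)) ` ?P \<union> (\<lambda>e. (e, False)) ` ?Q"
    by (auto simp: dart_path_def reversepath_def pathstart_def pathfinish_def)
  also have "card \<dots> = card ((\<lambda>e. (e, True)) ` ?P) + card ((\<lambda>e. (e, False)) ` ?Q)"
    by (rule card_Un_disjoint) (use assms in auto)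
  also have "\<dots> = card ?P + card ?Q"
    by (simp add: card_image inj_on_def)
  finally show ?thesis by (simp add: vertex_degree_def)
qed

lemma trivalent_card:
  assumes cw: "cw_graph X V E \<phi>" and tri: "trivalent V E \<phi>"
  shows "2 * card E = 3 * card V"
proof -
  note c = cw_graphD[OF cw]
  have "E \<times> (UNIV :: bool set) = (\<Union>v\<in>V. {x \<in> E \<times> UNIV. dart_path \<phi> x 0 = v})"
    using dart_pathD(7)[OF cw] by auto
  then have "card (E \<times> (UNIV :: bool set)) = (\<Sum>v\<in>V. card {x \<in> E \<times> UNIV. dart_path \<phi> x 0 = v})"
    using c(1,2) by (subst card_UN_disjoint[symmetric]) auto
  also have "\<dots> = (\<Sum>v\<in>V. 3)"
    using tri unfolding card_darts_at[OF c(2)] trivalent_def by simp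
  finally show ?thesis by (simp add: card_cartesian_product)
qed

lemma hausdorff1_open_edge:
  assumes "path g"
  shows "hausdorff1 (g ` {0<..<1}) = hausdorff1 (path_image g)"
proof (rule antisym)
  show "hausdorff1 (g ` {0<..<1}) \<le> hausdorff1 (path_image g)"
    by (rule hausdorff1_mono) (auto simp: path_image_def)
  have "{0..1} = {0<..<1} \<union> {0, 1::real}" by auto
  then have "path_image g = g ` {0<..<1} \<union> {g 0, g 1}" by (auto simp: path_image_def)
  then have "hausdorff1 (path_image g) \<le> hausdorff1 (g ` {0<..<1}) + hausdorff1 {g 0, g 1}"
    by (simp only: hausdorff1_Un)
  then show "hausdorff1 (path_image g) \<le> hausdorff1 (g ` {0<..<1})"
    by (simp add: hausdorff1_finite)
qed

lemma hausdorff1_unit_graph_le: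
  assumes cw: "cw_graph X V E \<phi>" and unit: "unit_edges E \<phi>"
  shows "hausdorff1 X \<le> of_nat (card E)"
proof -
  note c = cw_graphD[OF cw]
  have "hausdorff1 X \<le> hausdorff1 V + (\<Sum>e\<in>E. hausdorff1 (path_image (\<phi> e)))"
    by (subst c(10)) (intro order_trans[OF hausdorff1_Un] add_left_mono hausdorff1_UN c(2))
  also have "\<dots> = of_nat (card E)"
    using unit c(1) by (simp add: hausdorff1_finite unit_edges_def)
  finally show ?thesis .
qed

text \<open>Euler's formula turns the bound on the length into the hypothesis of \<open>branching_subgraph\<close>. At a vertex
  of degree at least \<open>3\<close> in the subgraph, each of three darts starts a branch that grows like the binary
  tree.\<close>

theorem (in graph_cover) exists_fast_growing_vertex:
  assumes conn: "connected X" and short: "(\<Sum>e\<in>E. edge_length e) < real (first_betti E \<phi>) - 1"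
  obtains u where "u \<in> Y" "p u \<in> V"
    "\<And>R. 0 \<le> R \<Longrightarrow> 3 * ennreal (binary_length R) \<le> ball_length Y u R"
proof -
  have "first_betti E \<phi> + card V \<le> card E + 1" by (rule card_edges_ge[OF cw conn])
  then have "real (first_betti E \<phi>) + real (card V) \<le> real (card E) + 1" by linarith
  then have "(\<Sum>e\<in>E. edge_length e) < real (card E) - real (card V)" using short by simp
  note sub = branching_subgraph[where org = "\<lambda>x. dpath x 0", OF cw_graphD(1,2)[OF cw]
      dart_pathD(7)[OF cw] edge_length(1) this, folded darts_def]
  obtain D u0 C where D: "D \<subseteq> darts" "3 \<le> card {x \<in> D. dpath x 0 = u0}"
    and early: "early_branching D (\<lambda>x. dpath x 0) edge_length C"
    by (rule sub)
  define I where "I = {x \<in> D. dpath x 0 = u0}"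
  have I: "I \<subseteq> darts" "3 \<le> card I" using D by (auto simp: I_def)
  then have "I \<noteq> {}" by auto
  then have u0: "u0 \<in> V" using dpathD(7) I(1) by (auto simp: I_def)
  then have "u0 \<in> p ` Y" using cw_graphD(3)[OF cw] covering_space_imp_surjective[OF covering] by blast
  then obtain u where u: "u \<in> Y" "p u = u0" by blast
  have "3 * ennreal (binary_length R) \<le> ball_length Y u R" if R: "0 \<le> R" for R
  proof -
    have "ennreal (binary_length R) \<le> inner_hausdorff1 (branch Y (lift u x) \<inter> ball u R)" if x: "x \<in> I" for x
    proof -
      have "based u x" using x u I(1) by (auto simp: based_def I_def)
      moreover have "C x 1" using early x I(2) unfolding early_branching_def I_def by simp
      ultimately show ?thesis
        using branch_growth_ge[OF D(1) early, of u x 1 R] R by (simp add: stem_length_one)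
    qed
    then have "of_nat (card I) * ennreal (binary_length R) \<le> ball_length Y u R"
      by (intro ball_length_ge) (use I(1) u in \<open>auto simp: I_def\<close>)
    moreover have "3 * ennreal (binary_length R) \<le> of_nat (card I) * ennreal (binary_length R)"
      using of_nat_mono[OF I(2), where 'a = ennreal] by (intro mult_right_mono) auto
    ultimately show ?thesis by (rule order_trans[rotated])
  qed
  then show ?thesis using that u u0 by blast
qed

theorem theorem3:
  fixes lam :: real and b :: nat
    and X :: "'a::metric_space set" and V :: "'a set" and E :: "'e set"
    and \<phi> :: "'e \<Rightarrow> real \<Rightarrow> 'a"
    and Y :: "'b::metric_space set" and p :: "'b \<Rightarrow> 'a"
    and Xb :: "'c::metric_space set" and Vb :: "'c set" and Eb :: "'f set"
    and \<phi>b :: "'f \<Rightarrow> real \<Rightarrow> 'c"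
    and Yb :: "'d::metric_space set" and pb :: "'d \<Rightarrow> 'c"
  assumes "0 < lam" and "lam < 1 / 3" and "b \<ge> 2"
    and "metric_graph X V E \<phi>" and "connected X" and "first_betti E \<phi> = b"
    and "metric_universal_cover Y p X"
    and "metric_graph Xb Vb Eb \<phi>b" and "connected Xb" and "first_betti Eb \<phi>b = b"
    and "trivalent Vb Eb \<phi>b" and "unit_edges Eb \<phi>b"
    and "metric_universal_cover Yb pb Xb"
    and "hausdorff1 X \<le> ennreal lam * hausdorff1 Xb"
  shows "(\<exists>u\<in>Y. p u \<in> V \<and>
            (\<forall>R\<ge>0. ball_length Y u R \<ge> ennreal (1 - 3 * lam) * sup_ball_length Yb R)) \<and>
         (\<forall>R\<ge>0. sup_ball_length Y R \<ge> ennreal (1 - 3 * lam) * sup_ball_length Yb R)"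
proof -
  have cw: "cw_graph X V E \<phi>" and cwb: "cw_graph Xb Vb Eb \<phi>b"
    using assms(4,8) by (simp_all add: metric_graph_def)
  note cb = cw_graphD[OF cwb]
  interpret G: graph_cover Y p X V E \<phi>
    by unfold_locales (use assms(7) cw in auto)
  interpret T: trivalent_cover Yb pb Xb Vb Eb \<phi>b
  proof unfold_locales
    show "card {x \<in> Eb \<times> UNIV. dart_path \<phi>b x 0 = v} = 3" if "v \<in> Vb" for v
      using that assms(11) unfolding card_darts_at[OF cb(2)] trivalent_def by simp
    show "hausdorff1 (\<phi>b e ` {0<..<1}) = 1" if "e \<in> Eb" for e
      using that assms(12) hausdorff1_open_edge[OF cb(4)] by (simp add: unit_edges_def)
  qed (use assms(13) cwb in auto)
  \<comment> \<open>The trivalent graph has \<open>3b - 3\<close> edges.\<close>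
  have "b \<le> card Eb" using first_betti_rank[OF cb(2), of \<phi>b] assms(10) by simp
  then have "Vb \<noteq> {}" using trivalent_card[OF cwb assms(11)] assms(3) by auto
  then have "card Eb + 1 \<le> b + card Vb" using card_edges_le[OF cwb] assms(10) by simp
  then have "card Eb + 3 \<le> 3 * b" using trivalent_card[OF cwb assms(11)] by linarith
  then have "real (card Eb + 3) \<le> real (3 * b)" by (simp only: of_nat_le_iff)
  then have Eb: "real (card Eb) \<le> 3 * (real b - 1)" by simp
  have "ennreal (\<Sum>e\<in>E. G.edge_length e) = (\<Sum>e\<in>E. ennreal (G.edge_length e))"
    by (rule sum_ennreal[symmetric]) (use G.edge_length(1) in \<open>auto intro: less_imp_le\<close>)
  also have "\<dots> \<le> hausdorff1 X" by (rule G.sum_edge_length_le)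
  also have "\<dots> \<le> ennreal lam * of_nat (card Eb)"
    by (rule order_trans[OF assms(14) mult_left_mono[OF hausdorff1_unit_graph_le[OF cwb assms(12)]]]) simp
  also have "\<dots> = ennreal (lam * real (card Eb))"
    using assms(1) by (simp add: ennreal_mult ennreal_of_nat_eq_real_of_nat)
  finally have "(\<Sum>e\<in>E. G.edge_length e) \<le> lam * real (card Eb)"
    using assms(1) by (simp add: ennreal_le_iff)
  also have "\<dots> \<le> lam * (3 * (real b - 1))" using Eb assms(1) by (intro mult_left_mono) auto
  also have "\<dots> = (3 * lam) * (real b - 1)" by simp
  also have "\<dots> < 1 * (real b - 1)" using assms(2,3) by (intro mult_strict_right_mono) auto
  finally have "(\<Sum>e\<in>E. G.edge_length e) < real (first_betti E \<phi>) - 1" using assms(6) by simp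
  then obtain u where u: "u \<in> Y" "p u \<in> V"
    and ge: "\<And>R. 0 \<le> R \<Longrightarrow> 3 * ennreal (binary_length R) \<le> ball_length Y u R"
    using G.exists_fast_growing_vertex[OF assms(5)] by blast
  have main: "ennreal (1 - 3 * lam) * sup_ball_length Yb R \<le> ball_length Y u R" if R: "0 \<le> R" for R
  proof -
    have "ennreal (1 - 3 * lam) * sup_ball_length Yb R \<le> 1 * sup_ball_length Yb R"
      by (intro mult_right_mono) (use assms(1) in auto)
    also have "\<dots> \<le> 3 * ennreal (binary_length R)" using T.sup_ball_length_le[OF R] by simp
    also have "\<dots> \<le> ball_length Y u R" by (rule ge[OF R])
    finally show ?thesis .
  qed
  moreover have "ball_length Y u R \<le> sup_ball_length Y R" for R
    unfolding sup_ball_length_def by (rule SUP_upper) (rule u(1))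
  ultimately have "ennreal (1 - 3 * lam) * sup_ball_length Yb R \<le> sup_ball_length Y R" if "0 \<le> R" for R
    using that order_trans by blast
  then show ?thesis using u main by blast
qed

end
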